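(* Let $d\geq 2$ and, for $\alpha \in (1,2)$, let $\mu_\alpha$ be a non-degenerate symmetric $\alpha$-stable probability measure on $\mathbb{R}^d$ with L\'evy measure $\nu_\alpha$ whose spherical component $\sigma$ does not depend on $\alpha$. Let $D^{\alpha-1}$ be the associated fractional gradient operator and let $D_\sigma$ be the anisotropic local gradient operator $D_\sigma(f)(x)=\int_{\mathbb{S}^{d-1}}y\langle y;\nabla(f)(x)\rangle\sigma(dy)$. Then, for all $p \in [1, +\infty)$ and all $f \in W^{1,p}(\mathbb{R}^d,dx)$, $$\lim_{\alpha \rightarrow 2^-} \| (2-\alpha) D^{\alpha-1}(f) - D_\sigma(f)\|_{L^p(\mathbb{R}^d,dx)} = 0.$$
   Context: $\|\cdot\|$ and $\langle\cdot;\cdot\rangle$ (between vectors) are the Euclidean norm and inner product on $\mathbb{R}^d$; $\mathbb{S}^{d-1}$ is the Euclidean unit sphere. The symmetric $\alpha$-stable L\'evy measure with spherical component $\sigma$ (a finite positive symmetric Borel measure on $\mathbb{S}^{d-1}$, $\sigma(B)=\sigma(-B)$) is $\nu_\alpha(B)=\int_{\mathbb{S}^{d-1}}\int_0^{+\infty} \mathbf{1}_B(ry)\,\frac{dr}{r^{\alpha+1}}\,\sigma(dy)$. With $\lambda_1 = -\cos(\alpha\pi/2)\frac{\Gamma(2-\alpha)}{\alpha(\alpha-1)}\sigma$, non-degeneracy means $\inf_{y\in\mathbb{S}^{d-1}}\int_{\mathbb{S}^{d-1}}|\langle y;x\rangle|^\alpha\lambda_1(dx)>0$, and $\mu_\alpha$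 is the probability measure with Fourier transform $\exp(-\int_{\mathbb{S}^{d-1}}|\langle y;\xi\rangle|^\alpha\lambda_1(dy))$. For $f\in L^p(\mathbb{R}^d,dx)$, $D^{\alpha-1}(f)$ is the $\mathbb{R}^d$-valued tempered distribution with components $\langle D^{\alpha-1}_k(f);\varphi\rangle=\int_{\mathbb{R}^d}f(x)(D^{\alpha-1}_k)^*(\varphi)(x)dx$, $\varphi\in\mathcal{S}(\mathbb{R}^d)$, where $(D^{\alpha-1}_k)^*(\varphi)(x)=\int_{\mathbb{R}^d}(\varphi(x-u)-\varphi(x))u_k\nu_\alpha(du)$ (for $f\in\mathcal{S}(\mathbb{R}^d)$, $D^{\alpha-1}(f)(x)=\int_{\mathbb{R}^d}(f(x+u)-f(x))u\,\nu_\alpha(du)$); it belongs to $L^p$ for $f\in W^{1,p}(\mathbb{R}^d,dx)$. $W^{1,p}(\mathbb{R}^d,dx)$ is the classical first order Sobolev space and $\nabla(f)$ the weak gradient. $L^p$ norms of $\mathbb{R}^d$-valued functions are $L^p$ norms of their Euclidean norms. *)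

theory Defs
  imports "HOL-Probability.Probability"
begin

subsection \<open>Smooth, Schwartz and test functions\<close>

text \<open>\<open>iter_partial [b\<^sub>1, \<dots>, b\<^sub>k] \<phi> = \<partial>\<^bsub>b\<^sub>1\<^esub> \<dots> \<partial>\<^bsub>b\<^sub>k\<^esub> \<phi>\<close>; the directions are
  meant to be taken from \<^const>\<open>Basis\<close>.\<close>

fun iter_partial :: "'a::euclidean_space list \<Rightarrow> ('a \<Rightarrow> real) \<Rightarrow> 'a \<Rightarrow> real" where
  "iter_partial [] \<phi> = \<phi>"
| "iter_partial (b # bs) \<phi> = (\<lambda>x. frechet_derivative (iter_partial bs \<phi>) (at x) b)"

definition smooth :: "('a::euclidean_space \<Rightarrow> real) \<Rightarrow> bool" where
  "smooth \<phi> \<longleftrightarrow> (\<forall>bs\<in>lists Basis. \<forall>x. iter_partial bs \<phi> differentiable (at x))"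

definition Schwartz_space :: "('a::euclidean_space \<Rightarrow> real) set" where
  "Schwartz_space = {\<phi>. smooth \<phi> \<and>
     (\<forall>bs\<in>lists Basis. \<forall>k::nat. bounded (range (\<lambda>x. norm x ^ k * iter_partial bs \<phi> x)))}"

definition test_functions :: "('a::euclidean_space \<Rightarrow> real) set" where
  "test_functions = {\<phi>. smooth \<phi> \<and> compact (closure {x. \<phi> x \<noteq> 0})}"

subsection \<open>Lebesgue and Sobolev spaces\<close>

text \<open>The norm is \<^typ>\<open>ennreal\<close>-valued, hence meaningful for every measurable function.\<close>

definition Lp_norm :: "real \<Rightarrow> ('a::euclidean_space \<Rightarrow> 'b::euclidean_space) \<Rightarrow> ennreal" where
  "Lp_norm p f = (let I = (\<integral>\<^sup>+x. ennreal (norm (f x) powr p) \<partial>lborel)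
                  in if I = \<top> then \<top> else ennreal (enn2real I powr (1 / p)))"

definition Lp_space :: "real \<Rightarrow> ('a::euclidean_space \<Rightarrow> 'b::euclidean_space) set" where
  "Lp_space p = {f \<in> borel_measurable lborel. Lp_norm p f < \<top>}"

definition locally_integrable :: "('a::euclidean_space \<Rightarrow> 'b::euclidean_space) \<Rightarrow> bool" where
  "locally_integrable f \<longleftrightarrow> (\<forall>K. compact K \<longrightarrow> set_integrable lborel K f)"

text \<open>The weak gradient is only determined up to null sets, so it is a relation between
  representatives.\<close>

definition has_weak_gradient ::
    "('a::euclidean_space \<Rightarrow> real) \<Rightarrow> ('a \<Rightarrow> 'a) \<Rightarrow> bool" where
  "has_weak_gradient f g \<longleftrightarrow> locally_integrable f \<and> locally_integrable g \<and>
     (\<forall>\<phi>\<in>test_functions. \<forall>b\<in>Basis.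
        (\<integral>x. f x * iter_partial [b] \<phi> x \<partial>lborel) = - (\<integral>x. (g x \<bullet> b) * \<phi> x \<partial>lborel))"

definition Sobolev1 :: "real \<Rightarrow> ('a::euclidean_space \<Rightarrow> real) set" where
  "Sobolev1 p = {f \<in> Lp_space p. \<exists>g\<in>Lp_space p. has_weak_gradient f g}"

subsection \<open>Stable measures\<close>

definition spherical_component :: "'a::euclidean_space measure \<Rightarrow> bool" where
  "spherical_component \<sigma> \<longleftrightarrow>
     sets \<sigma> = sets (restrict_space borel (sphere 0 1)) \<and> finite_measure \<sigma> \<and>
     (\<forall>B\<in>sets \<sigma>. emeasure \<sigma> (uminus ` B) = emeasure \<sigma> B)"

definition levy_measure :: "real \<Rightarrow> 'a::euclidean_space measure \<Rightarrow> 'a measure" where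
  "levy_measure \<alpha> \<sigma> = measure_of UNIV (sets borel)
     (\<lambda>B. \<integral>\<^sup>+y. (\<integral>\<^sup>+r\<in>{0<..}. indicator B (r *\<^sub>R y) * ennreal (1 / r powr (\<alpha> + 1)) \<partial>lborel) \<partial>\<sigma>)"

definition spectral_measure :: "real \<Rightarrow> 'a::euclidean_space measure \<Rightarrow> 'a measure" where
  "spectral_measure \<alpha> \<sigma> =
     scale_measure (ennreal (- cos (\<alpha> * pi / 2) * Gamma (2 - \<alpha>) / (\<alpha> * (\<alpha> - 1)))) \<sigma>"

definition nondegenerate :: "real \<Rightarrow> 'a::euclidean_space measure \<Rightarrow> bool" where
  "nondegenerate \<alpha> \<sigma> \<longleftrightarrow>
     (INF y\<in>sphere 0 1. \<integral>x. \<bar>y \<bullet> x\<bar> powr \<alpha> \<partial>spectral_measure \<alpha> \<sigma>) > 0"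

definition symmetric_stable ::
    "real \<Rightarrow> 'a::euclidean_space measure \<Rightarrow> 'a measure \<Rightarrow> bool" where
  "symmetric_stable \<alpha> \<sigma> \<mu> \<longleftrightarrow> prob_space \<mu> \<and> sets \<mu> = sets borel \<and>
     (\<forall>\<xi>. (CLINT x|\<mu>. exp (\<i> * of_real (x \<bullet> \<xi>))) =
          of_real (exp (- (\<integral>y. \<bar>y \<bullet> \<xi>\<bar> powr \<alpha> \<partial>spectral_measure \<alpha> \<sigma>))))"

text \<open>The set function in \<^const>\<open>levy_measure\<close> is a measure, so that \<^const>\<open>measure_of\<close> does not
  return its default value.\<close>

lemma
  assumes "spherical_component \<sigma>"
  shows sets_levy_measure: "sets (levy_measure \<alpha> \<sigma>) = sets borel"
    and emeasure_levy_measure: "\<And>B. B \<in> sets borel \<Longrightarrow> emeasure (levy_measure \<alpha> \<sigma>) B =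
      (\<integral>\<^sup>+y. (\<integral>\<^sup>+r\<in>{0<..}. indicator B (r *\<^sub>R y) * ennreal (1 / r powr (\<alpha> + 1)) \<partial>lborel) \<partial>\<sigma>)"
proof -
  have \<sigma>: "sets \<sigma> = sets (restrict_space borel (sphere 0 1))"
    using assms by (simp add: spherical_component_def)
  have id[measurable]: "(\<lambda>y. y) \<in> borel_measurable \<sigma>"
    using \<sigma> by (simp cong: measurable_cong_sets add: measurable_restrict_space1)
  show sets: "sets (levy_measure \<alpha> \<sigma>) = sets borel"
    using sets.sigma_sets_eq[of borel] by (simp add: levy_measure_def sets_measure_of_conv)
  fix B :: "'a set" assume B: "B \<in> sets borel"
  let ?\<mu> = "\<lambda>B. (\<integral>\<^sup>+y. (\<integral>\<^sup>+r\<in>{0<..}. indicator B (r *\<^sub>R y) * ennreal (1 / r powr (\<alpha> + 1)) \<partial>lborel) \<partial>\<sigma>)"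
  show "emeasure (levy_measure \<alpha> \<sigma>) B = ?\<mu> B"
  proof (rule emeasure_measure_of[OF levy_measure_def])
    show "positive (sets (levy_measure \<alpha> \<sigma>)) ?\<mu>" by (simp add: positive_def)
    show "B \<in> sets (levy_measure \<alpha> \<sigma>)" using B sets by simp
    show "countably_additive (sets (levy_measure \<alpha> \<sigma>)) ?\<mu>"
      unfolding sets
    proof (rule countably_additiveI)
      fix A :: "nat \<Rightarrow> 'a set"
      assume "range A \<subseteq> sets borel" and disj: "disjoint_family A"
      then have [measurable]: "\<And>i. A i \<in> sets borel" by auto
      have "(\<Sum>i. ?\<mu> (A i)) = (\<integral>\<^sup>+y. (\<Sum>i. \<integral>\<^sup>+r\<in>{0<..}. indicator (A i) (r *\<^sub>R y) *
              ennreal (1 / r powr (\<alpha> + 1)) \<partial>lborel) \<partial>\<sigma>)"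
        by (subst nn_integral_suminf) auto
      also have "\<dots> = (\<integral>\<^sup>+y. (\<integral>\<^sup>+r. (\<Sum>i. indicator (A i) (r *\<^sub>R y) *
              ennreal (1 / r powr (\<alpha> + 1)) * indicator {0<..} r) \<partial>lborel) \<partial>\<sigma>)"
        by (subst nn_integral_suminf) auto
      also have "\<dots> = ?\<mu> (\<Union>i. A i)"
        by (simp add: ennreal_suminf_multc suminf_indicator[OF disj])
      finally show "(\<Sum>i. ?\<mu> (A i)) = ?\<mu> (\<Union>i. A i)" .
    qed
  qed simp
qed

subsection \<open>Gradient operators\<close>

text \<open>The vector of the operators \<open>(D\<^sub>k\<^bsup>\<alpha>-1\<^esup>)\<^sup>*\<close>.\<close>

definition frac_gradient_adj ::
    "'a::euclidean_space measure \<Rightarrow> real \<Rightarrow> ('a \<Rightarrow> real) \<Rightarrow> 'a \<Rightarrow> 'a" where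
  "frac_gradient_adj \<sigma> \<alpha> \<phi> x = (\<integral>u. (\<phi> (x - u) - \<phi> x) *\<^sub>R u \<partial>levy_measure \<alpha> \<sigma>)"

text \<open>\<open>D\<^bsup>\<alpha>-1\<^esup>(f)\<close> as a vector-valued distribution, to be applied to Schwartz functions.\<close>

definition frac_gradient ::
    "'a::euclidean_space measure \<Rightarrow> real \<Rightarrow> ('a \<Rightarrow> real) \<Rightarrow> ('a \<Rightarrow> real) \<Rightarrow> 'a" where
  "frac_gradient \<sigma> \<alpha> f \<phi> = (\<integral>x. f x *\<^sub>R frac_gradient_adj \<sigma> \<alpha> \<phi> x \<partial>lborel)"

definition distribution_is_Lp ::
    "real \<Rightarrow> (('a::euclidean_space \<Rightarrow> real) \<Rightarrow> 'a) \<Rightarrow> ('a \<Rightarrow> 'a) \<Rightarrow> bool" where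
  "distribution_is_Lp p T h \<longleftrightarrow>
     h \<in> Lp_space p \<and> (\<forall>\<phi>\<in>Schwartz_space. T \<phi> = (\<integral>x. \<phi> x *\<^sub>R h x \<partial>lborel))"

text \<open>\<open>D\<^sub>\<sigma>(f)\<close>, where \<open>g\<close> is the weak gradient of \<open>f\<close>.\<close>

definition aniso_gradient ::
    "'a::euclidean_space measure \<Rightarrow> ('a \<Rightarrow> 'a) \<Rightarrow> 'a \<Rightarrow> 'a" where
  "aniso_gradient \<sigma> g x = (\<integral>y. (y \<bullet> g x) *\<^sub>R y \<partial>\<sigma>)"

end

theory Submission
  imports Defs
begin

text \<open>In polar coordinates \<open>D\<^sup>\<alpha>\<^sup>-\<^sup>1(f)(x)\<close> is the average of the difference quotients
  \<open>(f(x + r y) - f(x)) / min r 1\<close> times \<open>y\<close> with respect to the finite measure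
  \<open>min r 1 \<cdot> r\<^sup>-\<^sup>\<alpha> dr \<sigma>(dy)\<close>. Multiplied by \<open>2 - \<alpha>\<close>, this measure has bounded mass and concentrates at
  \<open>r = 0\<close>, its part on \<open>{r \<le> 1}\<close> having radial mass exactly \<open>1\<close>, so \<open>D\<^sub>\<sigma>(f)\<close> is the same
  average of \<open>\<langle>y; \<nabla>f(x)\<rangle>\<close> over \<open>{r \<le> 1}\<close>. By Jensen's inequality the \<open>p\<close>-th power of the distance is
  bounded by the average of \<open>\<parallel>(f(\<cdot> + r y) - f)/r - \<langle>y; \<nabla>f\<rangle>\<parallel>\<^sup>p\<close>, which is uniformly bounded and tends to
  \<open>0\<close> with \<open>r\<close>: for Sobolev functions \<open>f(x + u) - f(x)\<close> is the integral of \<open>\<langle>u; \<nabla>f(x + t u)\<rangle>\<close> over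
  \<open>t \<in> [0, 1]\<close>, and translations are continuous in \<open>L\<^sup>p\<close>.\<close>

subsection \<open>Smooth bump functions\<close>

text \<open>The fractional gradient of a Sobolev function is given only by duality with Schwartz
  functions, and its representatives are arbitrary. So the average over jumps has to be matched with
  the distribution, by moving each translation from the Schwartz function to f under Fubini, and
  representatives have to be identified almost everywhere. Both rest on the fundamental lemma of the
  calculus of variations, which is why explicit bump functions are built. The increment formula for
  f is also obtained by duality with test functions, so neither mollification nor density of smooth
  functions enters. The jump measure is not normalised: its mass m is of order 1/(2 - \<alpha>),
  while its mass on jumps longer than a fixed \<delta> stays bounded as \<alpha> tends to 2. With c
  = 2 - \<alpha>, the identity c^p m^(p-1) = (c m)^(p-1) c distributes the powers of c so that only
  the bounded quantity c m and c times the tail mass remain. All estimates are for integrals of p-th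
  powers in \<open>ennreal\<close>; a triangle inequality with constant 2^p stands in for
  Minkowski's.\<close>

fun times_differentiable :: "nat \<Rightarrow> ('a::euclidean_space \<Rightarrow> real) \<Rightarrow> bool" where
  "times_differentiable 0 f \<longleftrightarrow> (\<forall>x. f differentiable at x)"
| "times_differentiable (Suc n) f \<longleftrightarrow> (\<forall>x. f differentiable at x) \<and>
     (\<forall>b\<in>Basis. times_differentiable n (\<lambda>x. frechet_derivative f (at x) b))"

lemma times_differentiable_differentiable: "times_differentiable n f \<Longrightarrow> f differentiable at x"
  by (cases n) auto

lemma times_differentiable_SucD: "times_differentiable (Suc n) f \<Longrightarrow> times_differentiable n f"
  by (induction n arbitrary: f) auto

text \<open>\<open>times_differentiable\<close> counts orders instead of listing directions, so that
  sums and products are handled by induction on the order. Each direction of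
  \<open>iter_partial\<close> costs one order, hence the induction over the list carries all n at
  once.\<close>

lemma smooth_if_times_differentiable:
  assumes "\<And>n. times_differentiable n f"
  shows "smooth f"
proof -
  have *: "times_differentiable n (iter_partial bs f)" if "bs \<in> lists Basis" for bs n
    using that
  proof (induction bs arbitrary: n)
    case Nil
    then show ?case using assms by simp
  next
    case (Cons b bs)
    then have "times_differentiable (Suc n) (iter_partial bs f)" "b \<in> Basis" by auto
    then show ?case by simp
  qed
  then show ?thesis
    unfolding smooth_def using times_differentiable_differentiable by blast
qed

lemma times_differentiable_const: "times_differentiable n (\<lambda>x. c)"
  by (induction n arbitrary: c) (auto simp: frechet_derivative_const)

lemma times_differentiable_add: "times_differentiable n f \<Longrightarrow> times_differentiable n g \<Longrightarrow> times_differentiable n (\<lambda>x. f x + g x)"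
proof (induction n arbitrary: f g)
  case (Suc n)
  have "frechet_derivative (\<lambda>x. f x + g x) (at x) = (\<lambda>v. frechet_derivative f (at x) v + frechet_derivative g (at x) v)" for x
    using Suc.prems by (intro frechet_derivative_at[symmetric] has_derivative_add)
       (auto simp: frechet_derivative_works)
  with Suc show ?case by auto
qed auto

lemma times_differentiable_mult: "times_differentiable n f \<Longrightarrow> times_differentiable n g \<Longrightarrow> times_differentiable n (\<lambda>x. f x * g x)"
proof (induction n arbitrary: f g)
  case (Suc n)
  have "frechet_derivative (\<lambda>x. f x * g x) (at x) = (\<lambda>v. f x * frechet_derivative g (at x) v + frechet_derivative f (at x) v * g x)" for x
    using Suc.prems by (intro frechet_derivative_at[symmetric] has_derivative_mult)
       (auto simp: frechet_derivative_works)
  \<comment> \<open>The Leibniz rule leaves one factor undifferentiated, so order n of f and g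
    themselves is needed beside that of their partial derivatives.\<close>
  moreover have "times_differentiable n f" "times_differentiable n g" using Suc.prems times_differentiable_SucD by blast+
  ultimately show ?case using Suc by (auto intro!: times_differentiable_add)
qed auto

lemma times_differentiable_prod: "finite I \<Longrightarrow> (\<And>i. i \<in> I \<Longrightarrow> times_differentiable n (f i)) \<Longrightarrow> times_differentiable n (\<lambda>x. \<Prod>i\<in>I. f i x)"
  by (induction I rule: finite_induct) (auto simp: times_differentiable_const intro!: times_differentiable_mult)

text \<open>The functions \<open>P(1/t) e\<^sup>-\<^sup>1\<^sup>/\<^sup>t\<close> with \<open>P\<close> a polynomial form a family closed under differentiation,
  which gives smoothness of \<open>e\<^sup>-\<^sup>1\<^sup>/\<^sup>t\<close> at \<open>0\<close> without computing higher derivatives.\<close>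

definition flat :: "real poly \<Rightarrow> real \<Rightarrow> real" where
  "flat P t = (if t > 0 then poly P (1 / t) * exp (- (1 / t)) else 0)"

lemma poly_exp_tendsto_0:
  fixes P :: "real poly"
  shows "((\<lambda>s. poly P s * exp (- s)) \<longlongrightarrow> 0) at_top"
proof -
  have "((\<lambda>s. \<Sum>i\<le>degree P. coeff P i * (s ^ i / exp s)) \<longlongrightarrow> (\<Sum>i\<le>degree P. coeff P i * 0)) at_top"
    by (intro tendsto_sum tendsto_mult tendsto_const tendsto_power_div_exp_0)
  then show ?thesis
    by (simp add: poly_altdef sum_distrib_right exp_minus divide_inverse mult.assoc)
qed

text \<open>With s = 1/t one has ds/dt = -s^2, and P(s) e^-s has s-derivative (P' - P)(s) e^-s. This
  gives s^2 (P - P')(s) e^-s, and \<open>[:0, 0, 1:]\<close> is the polynomial s^2.\<close>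

lemma DERIV_flat: "(flat P has_real_derivative flat ([:0, 0, 1:] * (P - pderiv P)) t) (at t)"
proof -
  consider "t > 0" | "t < 0" | "t = 0" by linarith
  then show ?thesis
  proof cases
    case 1
    have "((\<lambda>t. poly P (1 / t) * exp (- (1 / t))) has_real_derivative
        flat ([:0, 0, 1:] * (P - pderiv P)) t) (at t)"
      using 1
      by (auto intro!: derivative_eq_intros poly_DERIV DERIV_chain2[where f = "poly P"] simp: flat_def field_simps power2_eq_square)
    then show ?thesis
      by (rule has_field_derivative_transform_within_open[of _ _ _ "{0<..}"]) (use 1 in \<open>auto simp: flat_def\<close>)
  next
    case 2
    have "((\<lambda>t. 0) has_real_derivative flat ([:0, 0, 1:] * (P - pderiv P)) t) (at t)"
      using 2 by (auto simp: flat_def)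
    then show ?thesis
      by (rule has_field_derivative_transform_within_open[of _ _ _ "{..<0}"]) (use 2 in \<open>auto simp: flat_def\<close>)
  next
    case 3
    have "((\<lambda>h. flat P h / h) \<longlongrightarrow> 0) (at_left 0)"
      by (rule tendsto_eventually) (auto simp: eventually_at_filter flat_def)
    moreover have "((\<lambda>h. flat P h / h) \<longlongrightarrow> 0) (at_right 0)"
    proof -
      \<comment> \<open>For s = 1/h the difference quotient at 0 is s P(s) e^-s, and
        \<open>pCons 0 P\<close> is the polynomial s P(s).\<close>
      have "((\<lambda>h. poly (pCons 0 P) (inverse h) * exp (- inverse h)) \<longlongrightarrow> 0) (at_right (0::real))"
        by (rule filterlim_compose[OF poly_exp_tendsto_0 filterlim_inverse_at_top_right])
      moreover have "\<forall>\<^sub>F h in at_right 0. poly (pCons 0 P) (inverse h) * exp (- inverse h) = flat P h / h"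
        unfolding eventually_at_filter by (rule always_eventually) (auto simp: flat_def field_simps)
      ultimately show ?thesis by (rule Lim_transform_eventually)
    qed
    ultimately have "((\<lambda>h. flat P h / h) \<longlongrightarrow> 0) (at 0)"
      by (rule filterlim_split_at)
    then show ?thesis
      using 3 by (simp add: DERIV_def flat_def)
  qed
qed

lemma times_differentiable_flat_affine: "times_differentiable n (\<lambda>x. flat P (x \<bullet> v + c))"
proof (induction n arbitrary: P)
  case 0
  have "((\<lambda>x. flat P (x \<bullet> v + c)) has_derivative (\<lambda>h. (h \<bullet> v) * flat ([:0, 0, 1:] * (P - pderiv P)) (x \<bullet> v + c))) (at x)" for x
    by (rule DERIV_compose_FDERIV[OF DERIV_flat]) (auto intro!: derivative_eq_intros)
  then show ?case by (auto simp: differentiable_def)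
next
  case (Suc n)
  have D: "((\<lambda>x. flat P (x \<bullet> v + c)) has_derivative (\<lambda>h. (h \<bullet> v) * flat ([:0, 0, 1:] * (P - pderiv P)) (x \<bullet> v + c))) (at x)" for x
    by (rule DERIV_compose_FDERIV[OF DERIV_flat]) (auto intro!: derivative_eq_intros)
  then have "frechet_derivative (\<lambda>x. flat P (x \<bullet> v + c)) (at x) = (\<lambda>h. (h \<bullet> v) * flat ([:0, 0, 1:] * (P - pderiv P)) (x \<bullet> v + c))" for x
    by (rule frechet_derivative_at[symmetric])
  with D Suc show ?case by (auto simp: differentiable_def intro!: times_differentiable_mult times_differentiable_const)
qed

text \<open>In each coordinate, e^(-1/t) is evaluated at the rescaled distances to the two faces of
  the box. Stretching these distances by \<open>Suc k\<close> sends every factor inside the box to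
  1, so the bumps converge to the indicator of the open box without any convolution.\<close>

definition box_bump :: "'a::euclidean_space \<Rightarrow> 'a \<Rightarrow> nat \<Rightarrow> 'a \<Rightarrow> real" where
  "box_bump a c k x = (\<Prod>b\<in>Basis. flat 1 (real (Suc k) * (x \<bullet> b - a \<bullet> b)) * flat 1 (real (Suc k) * (c \<bullet> b - x \<bullet> b)))"

lemma flat_1: "flat 1 t = (if t > 0 then exp (- (1 / t)) else 0)"
  by (simp add: flat_def)

lemma box_bump_eq_0: "x \<notin> box a c \<Longrightarrow> box_bump a c k x = 0"
  by (auto simp: box_bump_def flat_1 mem_box zero_less_mult_iff split: if_splits)

lemma box_bump_bounds: "0 \<le> box_bump a c k x" "box_bump a c k x \<le> 1"
  by (auto simp: box_bump_def flat_1 intro!: prod_nonneg prod_le_1 mult_le_one)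

lemma box_bump_tendsto: "(\<lambda>k. box_bump a c k x) \<longlonglongrightarrow> indicator (box a c) x"
proof (cases "x \<in> box a c")
  case True
  have *: "(\<lambda>k. flat 1 (real (Suc k) * d)) \<longlonglongrightarrow> 1" if "d > 0" for d
  proof -
    have "(\<lambda>k. exp (- (1 / (real (Suc k) * d)))) \<longlonglongrightarrow> 1"
    proof -
      have "(\<lambda>k. exp (- (inverse (real (Suc k)) * (1 / d)))) \<longlonglongrightarrow> exp (- (0 * (1 / d)))"
        by (intro tendsto_intros LIMSEQ_inverse_real_of_nat)
      then show ?thesis by (simp add: field_simps)
    qed
    then show ?thesis using that by (simp add: flat_1 add_pos_nonneg)
  qed
  have "(\<lambda>k. box_bump a c k x) \<longlonglongrightarrow> (\<Prod>b\<in>(Basis::'a set). 1 * 1)"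
    unfolding box_bump_def using True
    by (intro tendsto_prod tendsto_mult *) (auto simp: mem_box)
  then show ?thesis using True by simp
qed (simp add: box_bump_eq_0)

lemma box_bump_test: "box_bump a c k \<in> test_functions"
proof -
  have "times_differentiable n (box_bump a c k)" for n
  proof -
    have "times_differentiable n (\<lambda>x. \<Prod>b\<in>Basis. flat 1 (x \<bullet> (real (Suc k) *\<^sub>R b) + - real (Suc k) * (a \<bullet> b)) *
         flat 1 (x \<bullet> (- real (Suc k) *\<^sub>R b) + real (Suc k) * (c \<bullet> b)))"
      by (intro times_differentiable_prod times_differentiable_mult times_differentiable_flat_affine) auto
    then show ?thesis
      by (simp add: box_bump_def[abs_def] algebra_simps del: of_nat_Suc)
  qed
  moreover have "compact (closure {x. box_bump a c k x \<noteq> 0})"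
    using box_bump_eq_0[of _ a c k] bounded_subset[OF bounded_box[of a c], of "{x. box_bump a c k x \<noteq> 0}"]
    by (auto simp: compact_closure)
  ultimately show ?thesis by (auto simp: test_functions_def intro: smooth_if_times_differentiable)
qed

subsection \<open>The fundamental lemma of the calculus of variations\<close>

text \<open>Local integrability speaks only of restrictions to compact sets; global measurability is
  recovered by exhausting the space with balls.\<close>

lemma borel_measurable_locally_integrable:
  fixes H :: "'a::euclidean_space \<Rightarrow> 'b::euclidean_space"
  assumes "locally_integrable H"
  shows "H \<in> borel_measurable borel"
proof (rule borel_measurable_LIMSEQ_metric)
  show "(\<lambda>x. indicator (cball 0 (real n)) x *\<^sub>R H x) \<in> borel_measurable borel" for n
    using assms borel_measurable_integrable[of lborel "\<lambda>x. indicator (cball 0 (real n)) x *\<^sub>R H x"]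
    by (simp add: locally_integrable_def set_integrable_def)
  fix x :: 'a
  have "\<forall>\<^sub>F n in sequentially. norm x \<le> real n"
    by (meson eventually_sequentiallyI le_trans real_nat_ceiling_ge of_nat_mono order.trans)
  then have "\<forall>\<^sub>F n in sequentially. indicator (cball 0 (real n)) x *\<^sub>R H x = H x"
    by eventually_elim auto
  then show "(\<lambda>n. indicator (cball 0 (real n)) x *\<^sub>R H x) \<longlonglongrightarrow> H x"
    by (rule tendsto_eventually)
qed

text \<open>Lebesgue differentiation: outside a negligible set N, H x is the limit of the averages
  of H over cubes with corner x, and all of these averages vanish. Open and closed boxes differ by a
  null set, which links the hypothesis to the closed cubes.\<close>

lemma AE_zero_if_box_integrals_zero:
  fixes H :: "'a::euclidean_space \<Rightarrow> real"
  assumes H: "locally_integrable H"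
    and zero: "\<And>a c. (\<integral>x. indicator (box a c) x * H x \<partial>lborel) = 0"
  shows "AE x in lborel. H x = 0"
proof -
  have [measurable]: "H \<in> borel_measurable borel"
    using H by (rule borel_measurable_locally_integrable)
  have int: "set_integrable lborel (cbox a c) H" for a c
    using H by (simp add: locally_integrable_def)
  have on: "H integrable_on cbox a c" for a c
    using set_borel_integral_eq_integral(1)[OF int] .
  have I0: "integral (cbox a c) H = 0" for a c
  proof -
    have "set_lebesgue_integral lborel (cbox a c) H = set_lebesgue_integral lborel (box a c) H"
    proof -
      have "AE x in lborel. x \<notin> cbox a c - box a c"
        by (rule AE_not_in) (auto simp: null_sets_def emeasure_lborel_cbox_eq emeasure_lborel_box_eq emeasure_Diff box_subset_cbox)
      then show ?thesis
        unfolding set_lebesgue_integral_def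
        using box_subset_cbox[of a c]
        by (intro integral_cong_AE) (auto elim!: eventually_mono simp: indicator_def)
    qed
    also have "\<dots> = 0" using zero by (simp add: set_lebesgue_integral_def)
    finally show ?thesis using set_borel_integral_eq_integral(2)[OF int] by simp
  qed
  obtain N where N: "negligible N" and
    d: "\<And>x e. \<lbrakk>x \<notin> N; 0 < e\<rbrakk> \<Longrightarrow> \<exists>d>0. \<forall>h. 0 < h \<and> h < d \<longrightarrow>
         norm(integral (cbox x (x + h *\<^sub>R One)) H /\<^sub>R h ^ DIM('a) - H x) < e"
    using integrable_ccontinuous_explicit[of H] on by metis
  have "H x = 0" if xN: "x \<notin> N" for x
  proof (rule ccontr)
    assume "H x \<noteq> 0"
    then obtain \<delta> where "\<delta> > 0" "\<forall>h. 0 < h \<and> h < \<delta> \<longrightarrow>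
         norm(integral (cbox x (x + h *\<^sub>R One)) H /\<^sub>R h ^ DIM('a) - H x) < \<bar>H x\<bar>"
      using d[OF xN, of "\<bar>H x\<bar>"] by auto
    then have "norm(integral (cbox x (x + (\<delta>/2) *\<^sub>R One)) H /\<^sub>R (\<delta>/2) ^ DIM('a) - H x) < \<bar>H x\<bar>"
      by auto
    then show False using I0 by simp
  qed
  then have "AE x in lebesgue. H x = 0"
    using N by (intro AE_I'[of N]) (auto simp: negligible_iff_null_sets)
  then show ?thesis by (simp add: AE_completion_iff)
qed

text \<open>Only boxes have to be tested. The bumps are at most 1 and vanish outside the box, so |H|
  on the compact \<open>cbox a c\<close> is an integrable majorant for passing from bumps to the
  indicator.\<close>

lemma fundamental_lemma_calculus_of_variations:
  fixes H :: "'a::euclidean_space \<Rightarrow> real"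
  assumes H: "locally_integrable H"
    and zero: "\<And>\<phi>. \<phi> \<in> test_functions \<Longrightarrow> (\<integral>x. H x * \<phi> x \<partial>lborel) = 0"
  shows "AE x in lborel. H x = 0"
proof (rule AE_zero_if_box_integrals_zero[OF H])
  fix a c :: 'a
  have [measurable]: "H \<in> borel_measurable borel"
    using H by (rule borel_measurable_locally_integrable)
  have [measurable]: "box_bump a c k \<in> borel_measurable borel" for k
    unfolding box_bump_def flat_1 by measurable
  have "(\<lambda>k. \<integral>x. H x * box_bump a c k x \<partial>lborel) \<longlonglongrightarrow> (\<integral>x. H x * indicator (box a c) x \<partial>lborel)"
  proof (rule integral_dominated_convergence[where w = "\<lambda>x. \<bar>indicator (cbox a c) x *\<^sub>R H x\<bar>"])
    show "integrable lborel (\<lambda>x. \<bar>indicator (cbox a c) x *\<^sub>R H x\<bar>)"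
      using H by (auto simp: locally_integrable_def set_integrable_def simp del: real_scaleR_def intro!: integrable_abs)
    show "AE x in lborel. norm (H x * box_bump a c k x) \<le> \<bar>indicator (cbox a c) x *\<^sub>R H x\<bar>" for k
    proof (rule AE_I2)
      fix x show "norm (H x * box_bump a c k x) \<le> \<bar>indicator (cbox a c) x *\<^sub>R H x\<bar>"
        using box_bump_bounds[of a c k x] box_bump_eq_0[of x a c k] box_subset_cbox[of a c]
        by (cases "x \<in> box a c") (auto simp: abs_mult mult_left_le)
    qed
  qed (auto intro!: tendsto_mult box_bump_tendsto)
  moreover have "(\<integral>x. H x * box_bump a c k x \<partial>lborel) = 0" for k
    by (rule zero[OF box_bump_test])
  ultimately show "(\<integral>x. indicator (box a c) x * H x \<partial>lborel) = 0"
    by (simp add: LIMSEQ_const_iff mult.commute)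
qed

subsection \<open>Schwartz functions\<close>

lemma iter_partial_differentiable: "smooth \<phi> \<Longrightarrow> bs \<in> lists Basis \<Longrightarrow> iter_partial bs \<phi> differentiable (at x)"
  by (simp add: smooth_def)

lemma continuous_on_iter_partial: "smooth \<phi> \<Longrightarrow> bs \<in> lists Basis \<Longrightarrow> continuous_on UNIV (iter_partial bs \<phi>)"
  by (simp add: continuous_on_eq_continuous_within differentiable_imp_continuous_within iter_partial_differentiable)

lemma borel_measurable_iter_partial: "smooth \<phi> \<Longrightarrow> bs \<in> lists Basis \<Longrightarrow> iter_partial bs \<phi> \<in> borel_measurable borel"
  by (intro borel_measurable_continuous_onI continuous_on_iter_partial)

text \<open>On the open complement of the closed support the function is locally zero, hence so are
  all its derivatives; on the compact support the weighted derivatives are continuous and therefore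
  bounded.\<close>

lemma test_functions_subset_Schwartz_space: "test_functions \<subseteq> (Schwartz_space :: ('a::euclidean_space \<Rightarrow> real) set)"
proof
  fix \<phi> :: "'a \<Rightarrow> real" assume \<phi>: "\<phi> \<in> test_functions"
  define K where "K = closure {x. \<phi> x \<noteq> 0}"
  have K: "compact K" and sm: "smooth \<phi>" using \<phi> by (auto simp: test_functions_def K_def)
  have op: "open (- K)" unfolding K_def by (intro open_Compl closed_closure)
  have zero: "iter_partial bs \<phi> x = 0" if "bs \<in> lists Basis" "x \<notin> K" for bs x
    using that
  proof (induction bs arbitrary: x)
    case Nil
    then show ?case using closure_subset[of "{x. \<phi> x \<noteq> 0}"] by (auto simp: K_def)
  next
    case (Cons b bs)
    have "(iter_partial bs \<phi> has_derivative (\<lambda>_. 0)) (at x)"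
    proof (rule has_derivative_transform_within_open[OF has_derivative_const op])
      show "x \<in> - K" using Cons by simp
      show "\<And>y. y \<in> - K \<Longrightarrow> 0 = iter_partial bs \<phi> y" using Cons by simp
    qed
    from frechet_derivative_at[OF this] show ?case by (simp add: fun_eq_iff)
  qed
  have "bounded (range (\<lambda>x. norm x ^ k * iter_partial bs \<phi> x))" if bs: "bs \<in> lists Basis" for bs k
  proof -
    have "compact ((\<lambda>x. norm x ^ k * iter_partial bs \<phi> x) ` K)"
      using K by (intro compact_continuous_image continuous_intros
        continuous_on_subset[OF continuous_on_iter_partial[OF sm bs]]) auto
    then have "bounded (insert 0 ((\<lambda>x. norm x ^ k * iter_partial bs \<phi> x) ` K))"
      by (simp add: compact_imp_bounded)
    moreover have "range (\<lambda>x. norm x ^ k * iter_partial bs \<phi> x) \<subseteq> insert 0 ((\<lambda>x. norm x ^ k * iter_partial bs \<phi> x) ` K)"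
      using zero[OF bs] by force
    ultimately show ?thesis by (rule bounded_subset)
  qed
  with sm show "\<phi> \<in> Schwartz_space" by (simp add: Schwartz_space_def)
qed

section \<open>Translates of test functions\<close>

lemma iter_partial_translate:
  assumes "smooth \<phi>" "bs \<in> lists Basis"
  shows "iter_partial bs (\<lambda>x. \<phi> (x - a)) x = iter_partial bs \<phi> (x - a)"
  using assms(2)
proof (induction bs arbitrary: x)
  case (Cons b bs)
  have "(iter_partial bs \<phi> has_derivative frechet_derivative (iter_partial bs \<phi>) (at (x - a))) (at (x - a))"
    using iter_partial_differentiable[OF assms(1), of bs] Cons frechet_derivative_works by auto
  then have "((\<lambda>x. iter_partial bs \<phi> (x - a)) has_derivative frechet_derivative (iter_partial bs \<phi>) (at (x - a))) (at x)"
    by (rule has_derivative_compose[of "\<lambda>x. x - a" "\<lambda>h. h" x UNIV "iter_partial bs \<phi>", rotated]) (auto intro!: derivative_eq_intros)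
  then have "frechet_derivative (\<lambda>x. iter_partial bs \<phi> (x - a)) (at x) = frechet_derivative (iter_partial bs \<phi>) (at (x - a))"
    by (rule frechet_derivative_at[symmetric])
  moreover have "iter_partial bs (\<lambda>x. \<phi> (x - a)) = (\<lambda>x. iter_partial bs \<phi> (x - a))"
    using Cons by auto
  ultimately show ?case by simp
qed simp

lemma smooth_translate: "smooth \<phi> \<Longrightarrow> smooth (\<lambda>x. \<phi> (x - a))"
  unfolding smooth_def
proof (intro ballI allI)
  fix bs x assume sm: "\<forall>bs\<in>lists Basis. \<forall>x. iter_partial bs \<phi> differentiable at x" and bs: "bs \<in> lists (Basis::'a set)"
  then have "smooth \<phi>" by (simp add: smooth_def)
  then have "iter_partial bs (\<lambda>x. \<phi> (x - a)) = (\<lambda>x. iter_partial bs \<phi> (x - a))"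
    using bs iter_partial_translate by blast
  moreover have "(\<lambda>x. iter_partial bs \<phi> (x - a)) differentiable at x"
    using differentiable_chain_at[of "\<lambda>x. x - a" x "iter_partial bs \<phi>"] iter_partial_differentiable[OF \<open>smooth \<phi>\<close> bs]
    by (simp add: comp_def)
  ultimately show "iter_partial bs (\<lambda>x. \<phi> (x - a)) differentiable at x" by simp
qed

lemma test_functions_translate:
  assumes "\<phi> \<in> test_functions" shows "(\<lambda>x. \<phi> (x - a)) \<in> test_functions"
proof -
  have "{x. \<phi> (x - a) \<noteq> 0} = (+) a ` {x. \<phi> x \<noteq> 0}"
    by (auto simp: image_iff) (metis add_diff_cancel_left' diff_add_cancel add.commute)
  then show ?thesis
    using assms by (auto simp: test_functions_def smooth_translate closure_translation compact_translation simp del: compact_closure)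
qed

lemma Schwartz_bounded:
  assumes "\<phi> \<in> Schwartz_space" "bs \<in> lists Basis"
  obtains A where "A > 0" "\<And>x. \<bar>iter_partial bs \<phi> x\<bar> \<le> A"
proof -
  have "bounded (range (\<lambda>x. norm x ^ 0 * iter_partial bs \<phi> x))"
    using assms unfolding Schwartz_space_def by blast
  then show ?thesis using that by (auto simp: bounded_pos)
qed

text \<open>The majorant is a product over coordinates, so its integral factors into copies of the
  integral of 1/(1 + t^2). The price is decay of order 2 d, where d is \<open>DIM('a)\<close>: the
  product of the 1 + x_b^2 is at most (1 + |x|^2)^d, hence at most 2^d (1 + |x|^(2d)).\<close>

lemma Schwartz_integrable:
  fixes \<phi> :: "'a::euclidean_space \<Rightarrow> real"
  assumes "\<phi> \<in> Schwartz_space" and bs: "bs \<in> lists Basis"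
  shows "integrable lborel (iter_partial bs \<phi>)"
proof -
  let ?\<psi> = "iter_partial bs \<phi>" and ?w = "\<lambda>x::'a. \<Prod>b\<in>Basis. inverse (1 + (x \<bullet> b)\<^sup>2)"
  have sm: "smooth \<phi>" using assms by (simp add: Schwartz_space_def)
  have [measurable]: "?\<psi> \<in> borel_measurable borel"
    using sm bs by (rule borel_measurable_iter_partial)
  have "bounded (range (\<lambda>x. norm x ^ (2 * DIM('a)) * ?\<psi> x))"
    using assms unfolding Schwartz_space_def by blast
  then obtain B where B: "\<And>x. \<bar>norm x ^ (2 * DIM('a)) * ?\<psi> x\<bar> \<le> B"
    by (auto simp: bounded_pos)
  obtain A where A: "\<And>x. \<bar>?\<psi> x\<bar> \<le> A" using Schwartz_bounded[OF assms] by blast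
  define C where "C = 2 ^ DIM('a) * (A + B)"
  have bound: "norm (?\<psi> x) \<le> C * ?w x" for x
  proof -
    have "(\<Prod>b\<in>(Basis::'a set). 1 + (x \<bullet> b)\<^sup>2) \<le> (\<Prod>b\<in>(Basis::'a set). 1 + (norm x)\<^sup>2)"
      by (intro prod_mono) (auto simp: abs_le_square_iff[symmetric] Basis_le_norm )
    also have "\<dots> = (1 + (norm x)\<^sup>2) ^ DIM('a)" by simp
    also have "\<dots> \<le> (2 * max 1 ((norm x)\<^sup>2)) ^ DIM('a)"
      by (intro power_mono) auto
    also have "\<dots> = 2 ^ DIM('a) * max 1 ((norm x)\<^sup>2) ^ DIM('a)" by (simp add: power_mult_distrib)
    also have "max 1 ((norm x)\<^sup>2) ^ DIM('a) \<le> 1 + norm x ^ (2 * DIM('a))"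
      by (auto simp: max_def power_mult)
    finally have "(\<Prod>b\<in>(Basis::'a set). 1 + (x \<bullet> b)\<^sup>2) \<le> 2 ^ DIM('a) * (1 + norm x ^ (2 * DIM('a)))"
      by simp
    then have "(\<Prod>b\<in>(Basis::'a set). 1 + (x \<bullet> b)\<^sup>2) * \<bar>?\<psi> x\<bar> \<le> 2 ^ DIM('a) * (1 + norm x ^ (2 * DIM('a))) * \<bar>?\<psi> x\<bar>"
      by (rule mult_right_mono) simp
    also have "\<dots> = 2 ^ DIM('a) * (\<bar>?\<psi> x\<bar> + \<bar>norm x ^ (2 * DIM('a)) * ?\<psi> x\<bar>)"
      by (simp add: algebra_simps abs_mult)
    also have "\<dots> \<le> C"
      unfolding C_def using A[of x] B[of x] by (intro mult_left_mono add_mono) auto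
    finally have le: "(\<Prod>b\<in>(Basis::'a set). 1 + (x \<bullet> b)\<^sup>2) * \<bar>?\<psi> x\<bar> \<le> C" .
    have pos: "(\<Prod>b\<in>(Basis::'a set). 1 + (x \<bullet> b)\<^sup>2) > 0"
      by (intro prod_pos) (auto intro: add_pos_nonneg)
    have "?w x = inverse (\<Prod>b\<in>(Basis::'a set). 1 + (x \<bullet> b)\<^sup>2)"
      by (simp add: prod_inversef[unfolded comp_def])
    then show ?thesis using le pos by (simp add: field_simps)
  qed
  have fin1: "(\<integral>\<^sup>+t. ennreal (inverse (1 + t\<^sup>2)) \<partial>lborel) < \<infinity>"
  proof -
    have "integrable lborel (\<lambda>x::real. inverse (1 + x\<^sup>2))"
      using integrable_inverse_1_plus_square by (simp add: set_integrable_def einterval_def)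
    then show ?thesis by (simp add: integrable_iff_bounded)
  qed
  have "integrable lborel ?w"
  proof (rule integrableI_bounded)
    have "(\<integral>\<^sup>+x. ennreal (norm (?w x)) \<partial>lborel) = (\<integral>\<^sup>+x. (\<Prod>b\<in>(Basis::'a set). ennreal (inverse (1 + (x \<bullet> b)\<^sup>2))) \<partial>lborel)"
      by (simp add: prod_ennreal abs_prod)
    also have "\<dots> = (\<Prod>b\<in>(Basis::'a set). (\<integral>\<^sup>+t. ennreal (inverse (1 + t\<^sup>2)) \<partial>lborel))"
      by (rule nn_integral_lborel_prod) auto
    also have "\<dots> < \<infinity>" using fin1 by (simp add: power_less_top_ennreal)
    finally show "(\<integral>\<^sup>+x. ennreal (norm (?w x)) \<partial>lborel) < \<infinity>" .
  qed simp
  then have "integrable lborel (\<lambda>x. C * ?w x)" by simp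
  then show ?thesis
    by (rule Bochner_Integration.integrable_bound) (auto intro!: AE_I2 order_trans[OF bound[unfolded real_norm_def]])
qed

subsection \<open>Integral inequalities\<close>

lemma one_plus_powr_ge: "a \<ge> 0 \<Longrightarrow> p \<ge> 1 \<Longrightarrow> a \<le> 1 + a powr p" for a p :: real
  using powr_mono[of 1 p a] powr_ge_zero[of a p] by (cases "a \<le> 1") (auto intro: add_increasing2)

lemma add_powr_le: 
  fixes a b p :: real
  assumes "a \<ge> 0" "b \<ge> 0" "p \<ge> 1" shows "(a + b) powr p \<le> 2 powr p * (a powr p + b powr p)"
proof -
  have "(a + b) powr p \<le> (2 * max a b) powr p" using assms by (intro powr_mono2) auto
  also have "\<dots> = 2 powr p * max a b powr p" using assms by (simp add: powr_mult)
  also have "max a b powr p \<le> a powr p + b powr p" by (auto simp: max_def)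
  finally show ?thesis by simp
qed

text \<open>The tangent line of a convex function, prepared for Jensen's inequality, where c will be
  the mean. Convexity is used on the open half-line; at t = 0 the claim is c^p \<le> p c^p.\<close>

lemma powr_ge_tangent:
  fixes t c p :: real
  assumes "t \<ge> 0" "c > 0" "p \<ge> 1"
  shows "t powr p \<ge> c powr p + p * c powr (p - 1) * (t - c)"
proof (cases "t = 0")
  case True
  have "c powr p = c powr (p - 1) * c" using assms by (simp add: powr_diff)
  then show ?thesis using True assms by (simp add: algebra_simps mult_le_cancel_right1 mult_left_mono) 
next
  case False
  have "p * c powr (p - 1) * (t - c) \<le> t powr p - c powr p"
  proof (rule convex_on_imp_above_tangent[OF powr_convex])
    show "((\<lambda>x. x powr p) has_real_derivative p * c powr (p - 1)) (at c within {0<..})"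
      using assms by (auto intro!: derivative_eq_intros simp: powr_diff)
  qed (use assms False in \<open>auto simp: interior_open\<close>)
  then show ?thesis by simp
qed

text \<open>Jensen's inequality for an unnormalised measure of mass m: integrate the tangent
  inequality at c = I / m, where I is the integral of the norm. The linear term then cancels, and
  I^p = m^(p-1) (m c^p). No integrability is assumed, because the Bochner integral of a
  nonintegrable function is 0.\<close>

lemma (in finite_measure) powr_norm_integral_le:
  fixes F :: "'a \<Rightarrow> 'b::{banach, second_countable_topology}"
  assumes [measurable]: "F \<in> borel_measurable M" and p: "p \<ge> 1"
  shows "ennreal (norm (\<integral>z. F z \<partial>M) powr p) \<le>
    ennreal (measure M (space M) powr (p - 1)) * (\<integral>\<^sup>+z. ennreal (norm (F z) powr p) \<partial>M)"
proof (cases "(\<integral>z. F z \<partial>M) \<noteq> 0 \<and> (\<integral>\<^sup>+z. ennreal (norm (F z) powr p) \<partial>M) < \<infinity>")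
  case True
  let ?m = "measure M (space M)"
  have int: "integrable M F" using True not_integrable_integral_eq by blast
  have intp: "integrable M (\<lambda>z. norm (F z) powr p)"
    using True by (intro integrableI_bounded) auto
  define I where "I = (\<integral>z. norm (F z) \<partial>M)"
  have I: "norm (\<integral>z. F z \<partial>M) \<le> I" unfolding I_def by (rule integral_norm_bound)
  then have "I > 0" using True by (metis norm_le_zero_iff not_less order.trans)
  have "?m \<noteq> 0"
  proof
    assume "?m = 0"
    then have "emeasure M (space M) = 0" by (simp add: emeasure_eq_measure)
    then have "AE z in M. F z = 0" by (intro AE_I'[of "space M"]) (auto simp: null_sets_def)
    then show False using True integral_eq_zero_AE by blast
  qed
  then have m: "?m > 0" by (simp add: zero_less_measure_iff measure_nonneg less_le)
  define c where "c = I / ?m"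
  have c: "c > 0" using \<open>I > 0\<close> m by (simp add: c_def)
  have "(\<integral>z. c powr p + p * c powr (p - 1) * (norm (F z) - c) \<partial>M) \<le> (\<integral>z. norm (F z) powr p \<partial>M)"
    using int intp powr_ge_tangent[OF _ c p] by (intro integral_mono) auto
  also have "(\<integral>z. c powr p + p * c powr (p - 1) * (norm (F z) - c) \<partial>M) = ?m * c powr p + p * c powr (p - 1) * (I - ?m * c)"
    using int by (simp add: I_def)
  also have "\<dots> = ?m * c powr p" using m by (simp add: c_def)
  finally have *: "?m * c powr p \<le> (\<integral>z. norm (F z) powr p \<partial>M)" .
  have "norm (\<integral>z. F z \<partial>M) powr p \<le> I powr p" using I p by (intro powr_mono2) auto
  also have "\<dots> = ?m powr (p - 1) * (?m * c powr p)"
    using m \<open>I > 0\<close> by (simp add: c_def powr_divide powr_diff)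
  also have "\<dots> \<le> ?m powr (p - 1) * (\<integral>z. norm (F z) powr p \<partial>M)"
    by (rule mult_left_mono[OF *]) simp
  finally show ?thesis
    using intp by (simp add: nn_integral_eq_integral ennreal_mult[symmetric] integral_nonneg)
next
  case False
  \<comment> \<open>In this case either the integral is 0 or the right-hand integral is infinite;
    positivity of the mass keeps the product with the prefactor infinite.\<close>
  have "measure M (space M) > 0" if "(\<integral>z. F z \<partial>M) \<noteq> 0"
  proof (rule ccontr)
    assume "\<not> measure M (space M) > 0"
    then have "emeasure M (space M) = 0" by (simp add: emeasure_eq_measure measure_le_0_iff not_less)
    then have "AE z in M. F z = 0" by (intro AE_I'[of "space M"]) (auto simp: null_sets_def)
    then show False using that integral_eq_zero_AE by blast
  qed
  with False p show ?thesis
    by (cases "(\<integral>z. F z \<partial>M) = 0") (auto simp: ennreal_mult_top not_less top_unique)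
qed

section \<open>Translation invariance and weighted bounds\<close>

lemma nn_integral_translate:
  fixes F :: "'a::euclidean_space \<Rightarrow> ennreal"
  assumes [measurable]: "F \<in> borel_measurable borel"
  shows "(\<integral>\<^sup>+x. F (x + s) \<partial>lborel) = (\<integral>\<^sup>+x. F x \<partial>lborel)"
proof -
  have "(\<integral>\<^sup>+x. F x \<partial>lborel) = (\<integral>\<^sup>+x. F x \<partial>distr lborel borel ((+) s))"
    by (simp add: lborel_distr_plus)
  also have "\<dots> = (\<integral>\<^sup>+x. F (s + x) \<partial>lborel)" by (rule nn_integral_distr) auto
  finally show ?thesis by (simp add: add.commute)
qed

lemma integral_translate:
  fixes F :: "'a::euclidean_space \<Rightarrow> 'b::{banach, second_countable_topology}"
  assumes [measurable]: "F \<in> borel_measurable borel"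
  shows "(\<integral>x. F (x + s) \<partial>lborel) = (\<integral>x. F x \<partial>lborel)"
proof -
  have "(\<integral>x. F x \<partial>lborel) = (\<integral>x. F x \<partial>distr lborel borel ((+) s))"
    by (simp add: lborel_distr_plus)
  also have "\<dots> = (\<integral>x. F (s + x) \<partial>lborel)" by (rule integral_distr) auto
  finally show ?thesis by (simp add: add.commute)
qed

text \<open>The elementary bound \<open>a \<le> 1 + a\<^sup>p\<close> replaces Hoelder's inequality, so the case \<open>p = 1\<close> needs no
  separate treatment.\<close>

lemma nn_integral_mult_translate_le:
  fixes w :: "'a::euclidean_space \<Rightarrow> real" and v :: "'a \<Rightarrow> 'b::euclidean_space"
  assumes [measurable]: "w \<in> borel_measurable borel" "v \<in> borel_measurable borel"
    and w: "\<And>x. \<bar>w x\<bar> \<le> A" and p: "p \<ge> 1"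
  shows "(\<integral>\<^sup>+x. ennreal (\<bar>w x\<bar> * norm (v (x + s))) \<partial>lborel) \<le>
    (\<integral>\<^sup>+x. ennreal \<bar>w x\<bar> \<partial>lborel) + ennreal A * (\<integral>\<^sup>+x. ennreal (norm (v x) powr p) \<partial>lborel)"
proof -
  have A: "A \<ge> 0" using w[of 0] by linarith
  have "(\<integral>\<^sup>+x. ennreal (\<bar>w x\<bar> * norm (v (x + s))) \<partial>lborel) \<le>
     (\<integral>\<^sup>+x. ennreal \<bar>w x\<bar> + ennreal A * ennreal (norm (v (x + s)) powr p) \<partial>lborel)"
  proof (rule nn_integral_mono)
    fix x
    have "\<bar>w x\<bar> * norm (v (x + s)) \<le> \<bar>w x\<bar> * (1 + norm (v (x + s)) powr p)"
      using one_plus_powr_ge[OF _ p] by (intro mult_left_mono) auto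
    also have "\<dots> \<le> \<bar>w x\<bar> + A * norm (v (x + s)) powr p"
      using w[of x] by (simp add: distrib_left mult_right_mono)
    finally show "ennreal (\<bar>w x\<bar> * norm (v (x + s))) \<le> ennreal \<bar>w x\<bar> + ennreal A * ennreal (norm (v (x + s)) powr p)"
      using A by (simp add: ennreal_mult[symmetric] ennreal_plus[symmetric] del: ennreal_plus)
  qed
  also have "\<dots> = (\<integral>\<^sup>+x. ennreal \<bar>w x\<bar> \<partial>lborel) + ennreal A * (\<integral>\<^sup>+x. ennreal (norm (v (x + s)) powr p) \<partial>lborel)"
    by (simp add: nn_integral_add nn_integral_cmult)
  also have "(\<integral>\<^sup>+x. ennreal (norm (v (x + s)) powr p) \<partial>lborel) = (\<integral>\<^sup>+x. ennreal (norm (v x) powr p) \<partial>lborel)"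
    by (rule nn_integral_translate) simp
  finally show ?thesis .
qed

lemma Lp_space_iff:
  "f \<in> Lp_space p \<longleftrightarrow> f \<in> borel_measurable borel \<and> (\<integral>\<^sup>+x. ennreal (norm (f x) powr p) \<partial>lborel) < \<infinity>"
  by (auto simp: Lp_space_def Lp_norm_def Let_def less_top)

lemma locally_integrable_Lp:
  fixes f :: "'a::euclidean_space \<Rightarrow> 'b::euclidean_space"
  assumes f: "f \<in> Lp_space p" and p: "p \<ge> 1"
  shows "locally_integrable f"
  unfolding locally_integrable_def set_integrable_def
proof (intro allI impI integrableI_bounded)
  fix K :: "'a set" assume K: "compact K"
  have [measurable]: "K \<in> sets borel" "f \<in> borel_measurable borel"
    using K f by (auto simp: borel_compact Lp_space_iff)
  show "(\<lambda>x. indicator K x *\<^sub>R f x) \<in> borel_measurable lborel" by simp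
  \<comment> \<open>Shift 0 and weight \<open>indicator K\<close> put the integral into the form of
    the weighted bound, with A = 1.\<close>
  have "(\<integral>\<^sup>+x. ennreal (norm (indicator K x *\<^sub>R f x)) \<partial>lborel) =
      (\<integral>\<^sup>+x. ennreal (\<bar>indicator K x\<bar> * norm (f (x + 0))) \<partial>lborel)" by simp
  also have "\<dots> \<le> (\<integral>\<^sup>+x. ennreal \<bar>indicator K x\<bar> \<partial>lborel) + ennreal 1 * (\<integral>\<^sup>+x. ennreal (norm (f x) powr p) \<partial>lborel)"
    by (rule nn_integral_mult_translate_le) (use p in \<open>auto simp: indicator_def\<close>)
  also have "(\<integral>\<^sup>+x. ennreal \<bar>indicator K x\<bar> \<partial>lborel) = emeasure lborel K" by (simp add: ennreal_indicator)
  also have "emeasure lborel K + ennreal 1 * (\<integral>\<^sup>+x. ennreal (norm (f x) powr p) \<partial>lborel) < \<infinity>"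
    using emeasure_compact_finite[OF K] f by (simp add: Lp_space_iff)
  finally show "(\<integral>\<^sup>+x. ennreal (norm (indicator K x *\<^sub>R f x)) \<partial>lborel) < \<infinity>" .
qed

subsection \<open>Continuity of translations in \<open>L\<^sup>p\<close>\<close>

text \<open>Stated with the p-th power of the norm in \<open>ennreal\<close>, so that neither roots
  nor finiteness conditions appear in limits.\<close>

definition Lp_continuous :: "real \<Rightarrow> ('a::euclidean_space \<Rightarrow> 'b::euclidean_space) \<Rightarrow> bool" where
  "Lp_continuous p v \<longleftrightarrow>
     ((\<lambda>s. \<integral>\<^sup>+x. ennreal (norm (v (x + s) - v x) powr p) \<partial>lborel) \<longlongrightarrow> 0) (at 0)"

lemma ennreal_norm_add_powr_le:
  assumes "p \<ge> 1"
  shows "ennreal (norm (a + b) powr p) \<le> ennreal (2 powr p) * (ennreal (norm a powr p) + ennreal (norm b powr p))"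
proof -
  have "norm (a + b) powr p \<le> (norm a + norm b) powr p"
    using assms by (intro powr_mono2 norm_triangle_ineq) auto
  also have "\<dots> \<le> 2 powr p * (norm a powr p + norm b powr p)"
    using assms by (intro add_powr_le) auto
  finally show ?thesis
    by (simp add: ennreal_mult[symmetric] ennreal_plus[symmetric] del: ennreal_plus)
qed

text \<open>Replaces Minkowski's inequality: a constant factor is harmless wherever something is
  shown to be finite or to tend to 0.\<close>

lemma nn_integral_add_powr_le:
  fixes a b :: "'a \<Rightarrow> 'b::euclidean_space"
  assumes [measurable]: "a \<in> borel_measurable M" "b \<in> borel_measurable M" and p: "p \<ge> 1"
  shows "(\<integral>\<^sup>+x. ennreal (norm (a x + b x) powr p) \<partial>M) \<le>
    ennreal (2 powr p) * ((\<integral>\<^sup>+x. ennreal (norm (a x) powr p) \<partial>M) + (\<integral>\<^sup>+x. ennreal (norm (b x) powr p) \<partial>M))"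
proof -
  have "(\<integral>\<^sup>+x. ennreal (norm (a x + b x) powr p) \<partial>M) \<le>
     (\<integral>\<^sup>+x. ennreal (2 powr p) * (ennreal (norm (a x) powr p) + ennreal (norm (b x) powr p)) \<partial>M)"
    by (intro nn_integral_mono ennreal_norm_add_powr_le p)
  also have "\<dots> = ennreal (2 powr p) * ((\<integral>\<^sup>+x. ennreal (norm (a x) powr p) \<partial>M) + (\<integral>\<^sup>+x. ennreal (norm (b x) powr p) \<partial>M))"
    by (simp add: nn_integral_add nn_integral_cmult)
  finally show ?thesis .
qed

lemma Lp_continuous_add:
  fixes u v :: "'a::euclidean_space \<Rightarrow> 'b::euclidean_space"
  assumes [measurable]: "u \<in> borel_measurable borel" "v \<in> borel_measurable borel"
    and "Lp_continuous p u" "Lp_continuous p v" and p: "p \<ge> 1"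
  shows "Lp_continuous p (\<lambda>x. u x + v x)"
  unfolding Lp_continuous_def
proof (rule tendsto_sandwich[OF always_eventually always_eventually tendsto_const])
  let ?I = "\<lambda>v s. \<integral>\<^sup>+x. ennreal (norm (v (x + s) - v x) powr p) \<partial>lborel"
  have "((\<lambda>s. ennreal (2 powr p) * (?I u s + ?I v s)) \<longlongrightarrow> ennreal (2 powr p) * (0 + 0)) (at 0)"
    using assms unfolding Lp_continuous_def by (intro ennreal_tendsto_cmult tendsto_add) auto
  then show "((\<lambda>s. ennreal (2 powr p) * (?I u s + ?I v s)) \<longlongrightarrow> 0) (at 0)" by simp
  show "\<forall>s. ?I (\<lambda>x. u x + v x) s \<le> ennreal (2 powr p) * (?I u s + ?I v s)"
    using nn_integral_add_powr_le[OF _ _ p, of "\<lambda>x. u (x + _) - u x" lborel "\<lambda>x. v (x + _) - v x"]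
    by (auto simp: algebra_simps)
qed simp

lemma Lp_continuous_scaleR:
  fixes u :: "'a::euclidean_space \<Rightarrow> real" and c :: "'b::euclidean_space"
  assumes [measurable]: "u \<in> borel_measurable borel" and "Lp_continuous p u"
  shows "Lp_continuous p (\<lambda>x. u x *\<^sub>R c)"
proof -
  have "norm (u (x + s) *\<^sub>R c - u x *\<^sub>R c) powr p = norm c powr p * norm (u (x + s) - u x) powr p" for x s
    by (simp add: scaleR_diff_left[symmetric] powr_mult mult.commute)
  then have *: "(\<integral>\<^sup>+x. ennreal (norm (u (x + s) *\<^sub>R c - u x *\<^sub>R c) powr p) \<partial>lborel) =
    ennreal (norm c powr p) * (\<integral>\<^sup>+x. ennreal (norm (u (x + s) - u x) powr p) \<partial>lborel)" for s
    by (simp add: ennreal_mult nn_integral_cmult)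
  have "((\<lambda>s. ennreal (norm c powr p) * (\<integral>\<^sup>+x. ennreal (norm (u (x + s) - u x) powr p) \<partial>lborel)) \<longlongrightarrow>
      ennreal (norm c powr p) * 0) (at 0)"
    using assms unfolding Lp_continuous_def by (intro ennreal_tendsto_cmult) auto
  then show ?thesis by (simp add: Lp_continuous_def *)
qed

lemma Lp_continuous_sum:
  fixes v :: "'i \<Rightarrow> 'a::euclidean_space \<Rightarrow> 'b::euclidean_space"
  assumes "finite I" "p \<ge> 1" "\<And>i. i \<in> I \<Longrightarrow> v i \<in> borel_measurable borel \<and> Lp_continuous p (v i)"
  shows "Lp_continuous p (\<lambda>x. \<Sum>i\<in>I. v i x)"
  using assms
proof (induction I rule: finite_induct)
  case empty
  then show ?case by (simp add: Lp_continuous_def)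
next
  case (insert i I)
  then have "Lp_continuous p (\<lambda>x. v i x + (\<Sum>i\<in>I. v i x))"
    by (intro Lp_continuous_add borel_measurable_sum) auto
  then show ?case using insert by simp
qed

lemma Lp_continuous_approx:
  fixes u :: "'a::euclidean_space \<Rightarrow> 'b::euclidean_space"
  assumes [measurable]: "u \<in> borel_measurable borel" and p: "p \<ge> 1"
    and approx: "\<And>e::real. e > 0 \<Longrightarrow> \<exists>v. v \<in> borel_measurable borel \<and> Lp_continuous p v \<and>
       (\<integral>\<^sup>+x. ennreal (norm (u x - v x) powr p) \<partial>lborel) \<le> ennreal e"
  shows "Lp_continuous p u"
  unfolding Lp_continuous_def
proof (rule order_tendstoI)
  let ?I = "\<lambda>v s. \<integral>\<^sup>+x. ennreal (norm (v (x + s) - v x) powr p) \<partial>lborel"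
  fix a :: ennreal assume "0 < a"
  then obtain d' where d': "0 < d'" "d' < a" using dense by blast
  then obtain d :: real where "d' = ennreal d" "d \<ge> 0" by (cases d') auto
  with d' have d: "d > 0" "ennreal d < a" by auto
  let ?A = "2 powr p"
  \<comment> \<open>The increment of u splits into that of v and the two errors u - v, at x + s and
    at x. Two uses of the 2^p inequality, with A = 2^p \<ge> 1, bound it by A (e + 2 A e) \<le> 3
    A^2 e, which is 3 d / 4.\<close>
  define e where "e = d / (4 * ?A * ?A)"
  have e: "e > 0" using d by (simp add: e_def)
  obtain v where [measurable]: "v \<in> borel_measurable borel" and v: "Lp_continuous p v"
     and le: "(\<integral>\<^sup>+x. ennreal (norm (u x - v x) powr p) \<partial>lborel) \<le> ennreal e"
    using approx[OF e] by blast
  have "\<forall>\<^sub>F s in at 0. ?I v s < ennreal e"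
    using v e unfolding Lp_continuous_def by (intro order_tendstoD(2)) auto
  then show "\<forall>\<^sub>F s in at 0. ?I u s < a"
  proof eventually_elim
    case (elim s)
    have 1: "?I u s \<le> ennreal ?A * ((\<integral>\<^sup>+x. ennreal (norm (v (x + s) - v x) powr p) \<partial>lborel) +
        (\<integral>\<^sup>+x. ennreal (norm ((u (x + s) - v (x + s)) + (v x - u x)) powr p) \<partial>lborel))"
      using nn_integral_add_powr_le[OF _ _ p, of "\<lambda>x. v (x + s) - v x" lborel "\<lambda>x. (u (x + s) - v (x + s)) + (v x - u x)"]
      by (simp add: algebra_simps)
    have "(\<integral>\<^sup>+x. ennreal (norm ((u (x + s) - v (x + s)) + (v x - u x)) powr p) \<partial>lborel) \<le>
      ennreal ?A * ((\<integral>\<^sup>+x. ennreal (norm (u (x + s) - v (x + s)) powr p) \<partial>lborel) + (\<integral>\<^sup>+x. ennreal (norm (v x - u x) powr p) \<partial>lborel))"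
      by (rule nn_integral_add_powr_le[OF _ _ p]) auto
    also have "(\<integral>\<^sup>+x. ennreal (norm (u (x + s) - v (x + s)) powr p) \<partial>lborel) = (\<integral>\<^sup>+x. ennreal (norm (u x - v x) powr p) \<partial>lborel)"
      by (rule nn_integral_translate) simp
    also have "(\<integral>\<^sup>+x. ennreal (norm (v x - u x) powr p) \<partial>lborel) = (\<integral>\<^sup>+x. ennreal (norm (u x - v x) powr p) \<partial>lborel)"
      by (simp add: norm_minus_commute)
    finally have 2: "(\<integral>\<^sup>+x. ennreal (norm ((u (x + s) - v (x + s)) + (v x - u x)) powr p) \<partial>lborel) \<le>
      ennreal ?A * (ennreal e + ennreal e)"
      by (rule order_trans) (intro mult_left_mono add_mono le zero_le)
    have "?I u s \<le> ennreal ?A * (ennreal e + ennreal ?A * (ennreal e + ennreal e))"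
      using elim by (intro order_trans[OF 1] mult_left_mono add_mono 2) auto
    also have "\<dots> = ennreal (?A * (e + ?A * (e + e)))"
      using e by (simp add: ennreal_mult[symmetric] ennreal_plus[symmetric] del: ennreal_plus)
    also have "\<dots> \<le> ennreal (?A * (?A * e + ?A * (e + e)))"
      using e p by (intro ennreal_leI mult_left_mono add_mono) (auto simp: ge_one_powr_ge_zero)
    also have "?A * (?A * e + ?A * (e + e)) = 3 * d / 4"
      by (simp add: e_def field_simps)
    also have "ennreal (3 * d / 4) \<le> ennreal d" using d by (intro ennreal_leI) auto
    also have "\<dots> < a" by (fact d)
    finally show ?case .
  qed
qed simp

text \<open>For open \<open>U\<close>, a point of \<open>U\<close> stays in \<open>U\<close> under small translations, so dominated convergence
  applies with majorant \<open>1\<^sub>U\<close>.\<close>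

lemma Lp_continuous_indicator_open:
  fixes U :: "'a::euclidean_space set"
  assumes U: "open U" "emeasure lborel U < \<infinity>" and p: "p \<ge> 1"
  shows "Lp_continuous p (indicator U :: 'a \<Rightarrow> real)"
  unfolding Lp_continuous_def tendsto_at_iff_sequentially
proof (intro allI impI)
  fix X :: "nat \<Rightarrow> 'a" assume "X \<longlonglongrightarrow> 0"
  have [measurable]: "U \<in> sets borel" using U by simp
  have conv: "(\<lambda>n. \<integral>\<^sup>+x. indicator U x * indicator (- U) (x + Y n) \<partial>lborel) \<longlonglongrightarrow> 0" if Y: "Y \<longlonglongrightarrow> 0" for Y
  proof -
    have "(\<lambda>n. \<integral>\<^sup>+x. indicator U x * indicator (- U) (x + Y n) \<partial>lborel) \<longlonglongrightarrow> (\<integral>\<^sup>+(x::'a). 0 \<partial>lborel)"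
    proof (rule nn_integral_dominated_convergence[where w = "indicator U"])
      show "AE x in lborel. (\<lambda>n. indicator U x * indicator (- U) (x + Y n)) \<longlonglongrightarrow> (0::ennreal)"
      proof (rule AE_I2)
        fix x :: 'a
        show "(\<lambda>n. indicator U x * indicator (- U) (x + Y n)) \<longlonglongrightarrow> (0::ennreal)"
        proof (cases "x \<in> U")
          case True
          have "(\<lambda>n. x + Y n) \<longlonglongrightarrow> x + 0" by (intro tendsto_intros Y)
          then have "\<forall>\<^sub>F n in sequentially. x + Y n \<in> U"
            using U True by (auto dest!: topological_tendstoD)
          then have "\<forall>\<^sub>F n in sequentially. indicator U x * indicator (- U) (x + Y n) = (0::ennreal)"
            by eventually_elim simp
          then show ?thesis by (rule tendsto_eventually)
        qed simp
      qed
      show "(\<integral>\<^sup>+ x. indicator U x \<partial>lborel) < \<infinity>" using U by simp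
    qed (auto simp: indicator_def intro!: AE_I2)
    then show ?thesis by simp
  qed
  have eq: "(\<integral>\<^sup>+x. ennreal (norm (indicator U (x + s) - indicator U x :: real) powr p) \<partial>lborel) =
     (\<integral>\<^sup>+x. indicator U x * indicator (- U) (x + s) \<partial>lborel) + (\<integral>\<^sup>+x. indicator U x * indicator (- U) (x + - s) \<partial>lborel)" for s
  proof -
    have "ennreal (norm (indicator U (x + s) - indicator U x :: real) powr p) =
       indicator U x * indicator (- U) (x + s) + indicator U (x + s) * indicator (- U) x" for x
      by (auto simp: indicator_def)
    then have "(\<integral>\<^sup>+x. ennreal (norm (indicator U (x + s) - indicator U x :: real) powr p) \<partial>lborel) =
      (\<integral>\<^sup>+x. indicator U x * indicator (- U) (x + s) \<partial>lborel) + (\<integral>\<^sup>+x. indicator U (x + s) * indicator (- U) x \<partial>lborel)"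
      by (simp add: nn_integral_add)
    also have "(\<integral>\<^sup>+x. indicator U (x + s) * indicator (- U) x \<partial>lborel) = (\<integral>\<^sup>+x. indicator U x * indicator (- U) (x + - s) \<partial>lborel)"
      using nn_integral_translate[of "\<lambda>x. indicator U x * indicator (- U) (x + - s)" s] by simp
    finally show ?thesis .
  qed
  have "(\<lambda>n. (\<integral>\<^sup>+x. indicator U x * indicator (- U) (x + X n) \<partial>lborel) + (\<integral>\<^sup>+x. indicator U x * indicator (- U) (x + - X n) \<partial>lborel))
      \<longlonglongrightarrow> 0 + 0"
    using tendsto_minus[OF \<open>X \<longlonglongrightarrow> 0\<close>] by (intro tendsto_add conv \<open>X \<longlonglongrightarrow> 0\<close>) simp
  then show "((\<lambda>s. \<integral>\<^sup>+x. ennreal (norm (indicator U (x + s) - indicator U x :: real) powr p) \<partial>lborel) \<circ> X) \<longlonglongrightarrow> 0"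
    unfolding comp_def eq by simp
qed

text \<open>Induction along the construction of measurable functions, with finiteness of the p-th
  power integral inside the induction, so each case passes it down to its constituents. An indicator
  is approximated by that of an open superset (outer regularity); a monotone limit is approximated
  by its terms, with |u|^p as majorant.\<close>

lemma Lp_continuous_nonneg:
  fixes u :: "'a::euclidean_space \<Rightarrow> real"
  assumes "u \<in> borel_measurable borel" "\<And>x. 0 \<le> u x" and p: "p \<ge> 1"
    and "(\<integral>\<^sup>+x. ennreal (norm (u x) powr p) \<partial>lborel) < \<infinity>"
  shows "Lp_continuous p u"
  using assms(1,2,4)
proof (induction u rule: borel_measurable_induct_real)
  case (set A)
  then have [measurable]: "A \<in> sets borel" by simp
  have "norm (indicator A x :: real) powr p = indicator A x" for x
    by (auto simp: indicator_def)
  then have fin: "emeasure lborel A < \<infinity>" using set by (simp add: ennreal_indicator)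
  show ?case
  proof (rule Lp_continuous_approx[OF _ p])
    fix e :: real assume e: "e > 0"
    have "A \<in> sets lebesgue" using set by (simp add: sets_completionI_sets)
    then obtain U where U: "open U" "A \<subseteq> U" "emeasure lebesgue (U - A) < ennreal e"
      using sets_lebesgue_outer_open e by metis
    then have UA: "emeasure lborel (U - A) < ennreal e" by (simp add: borel_open)
    have "U = A \<union> (U - A)" using U by auto
    then have "emeasure lborel U \<le> emeasure lborel A + emeasure lborel (U - A)"
      using emeasure_subadditive[of A lborel "U - A"] U(1) by (simp add: borel_open)
    also have "\<dots> < \<infinity>" using fin less_trans[OF UA ennreal_less_top] by (simp flip: less_top)
    finally have "Lp_continuous p (indicator U :: 'a \<Rightarrow> real)"
      using U p by (intro Lp_continuous_indicator_open)
    moreover have "(\<integral>\<^sup>+x. ennreal (norm (indicator A x - indicator U x :: real) powr p) \<partial>lborel) \<le> ennreal e"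
    proof -
      have "norm (indicator A x - indicator U x :: real) powr p = indicator (U - A) x" for x
        using U by (auto simp: indicator_def)
      then show ?thesis using UA U by (simp add: ennreal_indicator borel_open)
    qed
    ultimately show "\<exists>v. v \<in> borel_measurable borel \<and> Lp_continuous p v \<and>
       (\<integral>\<^sup>+x. ennreal (norm (indicator A x - v x :: real) powr p) \<partial>lborel) \<le> ennreal e"
      using U by (intro exI[of _ "indicator U"]) (auto intro!: borel_measurable_indicator borel_open)
  qed simp
next
  case (mult u c)
  show ?case
  proof (cases "c = 0")
    case True
    then show ?thesis by (simp add: Lp_continuous_def)
  next
    case False
    have "(\<integral>\<^sup>+x. ennreal (norm (c * u x) powr p) \<partial>lborel) = ennreal (c powr p) * (\<integral>\<^sup>+x. ennreal (norm (u x) powr p) \<partial>lborel)"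
      using mult.hyps by (simp add: abs_mult powr_mult ennreal_mult nn_integral_cmult)
    then have "(\<integral>\<^sup>+x. ennreal (norm (u x) powr p) \<partial>lborel) < \<infinity>"
      using mult.prems mult.hyps(1) False by (auto simp: ennreal_mult_less_top)
    then have "Lp_continuous p (\<lambda>x. u x *\<^sub>R c)"
      using mult by (intro Lp_continuous_scaleR) auto
    then show ?thesis by (simp add: mult.commute)
  qed
next
  case (add u v)
  have "(\<integral>\<^sup>+x. ennreal (norm (u x) powr p) \<partial>lborel) \<le> (\<integral>\<^sup>+x. ennreal (norm (v x + u x) powr p) \<partial>lborel)"
     "(\<integral>\<^sup>+x. ennreal (norm (v x) powr p) \<partial>lborel) \<le> (\<integral>\<^sup>+x. ennreal (norm (v x + u x) powr p) \<partial>lborel)"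
    using add.hyps p by (auto intro!: nn_integral_mono ennreal_leI powr_mono2)
  then show ?case
    using add p by (intro Lp_continuous_add) (auto intro: le_less_trans)
next
  case (seq U)
  have Ule: "U i x \<le> u x" for i x
    using seq.hyps by (intro incseq_le[of "\<lambda>i. U i x"]) (auto simp: incseq_def le_fun_def)
  have [measurable]: "U i \<in> borel_measurable borel" for i using seq by simp
  have [measurable]: "u \<in> borel_measurable borel"
    by (rule borel_measurable_LIMSEQ_real[where u = U]) (use seq.hyps in simp_all)
  have lim: "(\<lambda>i. \<integral>\<^sup>+x. ennreal (norm (u x - U i x) powr p) \<partial>lborel) \<longlonglongrightarrow> (\<integral>\<^sup>+(x::'a). 0 \<partial>lborel)"
  proof (rule nn_integral_dominated_convergence[where w = "\<lambda>x. ennreal (norm (u x) powr p)"])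
    show "AE x in lborel. ennreal (norm (u x - U i x) powr p) \<le> ennreal (norm (u x) powr p)" for i
      using p by (intro AE_I2 ennreal_leI powr_mono2) (simp_all add: Ule seq.hyps(2) order_trans[OF seq.hyps(2) Ule])
    show "AE x in lborel. (\<lambda>i. ennreal (norm (u x - U i x) powr p)) \<longlonglongrightarrow> 0"
    proof (rule AE_I2)
      fix x :: 'a
      have "(\<lambda>i. norm (u x - U i x) powr p) \<longlonglongrightarrow> norm (u x - u x) powr p"
        using seq.hyps p by (intro tendsto_powr2 tendsto_intros) auto
      then show "(\<lambda>i. ennreal (norm (u x - U i x) powr p)) \<longlonglongrightarrow> 0"
        using p by (auto simp flip: ennreal_0)
    qed
  qed (use seq.prems in auto)
  show ?case
  proof (rule Lp_continuous_approx[OF _ p])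
    fix e :: real assume "e > 0"
    then obtain i where "(\<integral>\<^sup>+x. ennreal (norm (u x - U i x) powr p) \<partial>lborel) < ennreal e"
      using order_tendstoD(2)[OF lim, of "ennreal e"] by (auto simp: eventually_sequentially)
    moreover have "(\<integral>\<^sup>+x. ennreal (norm (U i x) powr p) \<partial>lborel) \<le> (\<integral>\<^sup>+x. ennreal (norm (u x) powr p) \<partial>lborel)"
      using p by (intro nn_integral_mono ennreal_leI powr_mono2)
         (simp_all add: seq.hyps(2) order_trans[OF Ule abs_ge_self])
    ultimately show "\<exists>v. v \<in> borel_measurable borel \<and> Lp_continuous p v \<and>
       (\<integral>\<^sup>+x. ennreal (norm (u x - v x) powr p) \<partial>lborel) \<le> ennreal e"
      using seq by (intro exI[of _ "U i"]) (auto intro: less_imp_le le_less_trans)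
  qed simp
qed

lemma Lp_continuous_Lp:
  fixes v :: "'a::euclidean_space \<Rightarrow> 'b::euclidean_space"
  assumes v: "v \<in> Lp_space p" and p: "p \<ge> 1"
  shows "Lp_continuous p v"
proof -
  have [measurable]: "v \<in> borel_measurable borel" and fin: "(\<integral>\<^sup>+x. ennreal (norm (v x) powr p) \<partial>lborel) < \<infinity>"
    using v by (auto simp: Lp_space_iff)
  \<comment> \<open>Stated for unit vectors rather than basis vectors, because the negative part of
    a coordinate is the positive part along \<open>- b\<close>.\<close>
  have pos: "Lp_continuous p (\<lambda>x. max 0 (v x \<bullet> b))" if b: "norm b = 1" for b
  proof (rule Lp_continuous_nonneg[OF _ _ p])
    have "(\<integral>\<^sup>+x. ennreal (norm (max 0 (v x \<bullet> b)) powr p) \<partial>lborel) \<le> (\<integral>\<^sup>+x. ennreal (norm (v x) powr p) \<partial>lborel)"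
    proof (intro nn_integral_mono ennreal_leI powr_mono2)
      show "norm (max 0 (v x \<bullet> b)) \<le> norm (v x)" for x
        using Cauchy_Schwarz_ineq2[of "v x" b] b by auto
    qed (use p in auto)
    then show "(\<integral>\<^sup>+x. ennreal (norm (max 0 (v x \<bullet> b)) powr p) \<partial>lborel) < \<infinity>" using fin by (rule le_less_trans)
  qed auto
  have *: "v x = (\<Sum>b\<in>Basis. max 0 (v x \<bullet> b) *\<^sub>R b + max 0 (v x \<bullet> (- b)) *\<^sub>R (- b))" for x
  proof -
    have "max 0 (v x \<bullet> b) *\<^sub>R b + max 0 (v x \<bullet> (- b)) *\<^sub>R (- b) = (v x \<bullet> b) *\<^sub>R b" for b
      by (auto simp: max_def)
    then show ?thesis by (simp only: euclidean_representation)
  qed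
  have "Lp_continuous p (\<lambda>x. \<Sum>b\<in>Basis. max 0 (v x \<bullet> b) *\<^sub>R b + max 0 (v x \<bullet> (- b)) *\<^sub>R (- b))"
    using p by (intro Lp_continuous_sum conjI Lp_continuous_add Lp_continuous_scaleR pos) auto
  then show ?thesis by (simp only: *[symmetric])
qed

subsection \<open>Integration along segments\<close>

text \<open>A density on the whole line rather than a restricted space: measurability stays that of
  \<open>borel\<close>, while Jensen and Fubini apply to a probability measure.\<close>

definition unit_interval :: "real measure" where
  "unit_interval = density lborel (indicator {0..1})"

lemma sets_unit_interval [simp, measurable_cong]: "sets unit_interval = sets borel"
  by (simp add: unit_interval_def)

lemma AE_unit_interval: "AE t in unit_interval. t \<in> {0..1}"
  unfolding unit_interval_def by (subst AE_density) (auto simp: indicator_def intro!: AE_I2)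

interpretation unit_interval: prob_space unit_interval
  by (rule prob_spaceI) (simp add: unit_interval_def emeasure_density)

lemma norm_integral_le_nn_integral:
  fixes F :: "'a \<Rightarrow> 'b::{banach, second_countable_topology}"
  shows "ennreal (norm (\<integral>z. F z \<partial>M)) \<le> (\<integral>\<^sup>+z. ennreal (norm (F z)) \<partial>M)"
  by (cases "integrable M F") (auto intro: integral_norm_bound_ennreal simp: not_integrable_integral_eq)

lemma (in finite_measure) integrable_if_powr_finite:
  fixes F :: "'a \<Rightarrow> 'b::{banach, second_countable_topology}"
  assumes [measurable]: "F \<in> borel_measurable M" and p: "p \<ge> 1"
    and fin: "(\<integral>\<^sup>+z. ennreal (norm (F z) powr p) \<partial>M) < \<infinity>"
  shows "integrable M F"
proof (rule integrableI_bounded)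
  have "(\<integral>\<^sup>+z. ennreal (norm (F z)) \<partial>M) \<le> (\<integral>\<^sup>+z. 1 + ennreal (norm (F z) powr p) \<partial>M)"
    using one_plus_powr_ge[OF norm_ge_zero p]
    by (intro nn_integral_mono) (auto simp: ennreal_plus[symmetric] simp flip: ennreal_1 simp del: ennreal_plus)
  also have "\<dots> = emeasure M (space M) + (\<integral>\<^sup>+z. ennreal (norm (F z) powr p) \<partial>M)"
    by (simp add: nn_integral_add)
  also have "\<dots> < \<infinity>" using fin emeasure_finite by (simp flip: less_top)
  finally show "(\<integral>\<^sup>+z. ennreal (norm (F z)) \<partial>M) < \<infinity>" .
qed simp

text \<open>Supplies the hypothesis of Fubini's theorem in the duality computations: since N is
  finite, a bound on the x-integrals that is uniform in z suffices.\<close>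

lemma integrable_pair_lborel:
  fixes k :: "'a::euclidean_space \<Rightarrow> 'z \<Rightarrow> 'b::{banach, second_countable_topology}"
  assumes "finite_measure N" and [measurable]: "case_prod k \<in> borel_measurable (lborel \<Otimes>\<^sub>M N)"
    and bound: "\<And>z. z \<in> space N \<Longrightarrow> (\<integral>\<^sup>+x. ennreal (norm (k x z)) \<partial>lborel) \<le> C" and "C < \<infinity>"
  shows "integrable (lborel \<Otimes>\<^sub>M N) (case_prod k)"
proof (rule integrableI_bounded)
  interpret N: finite_measure N by fact
  interpret pair_sigma_finite "lborel :: 'a measure" N ..
  have "(\<integral>\<^sup>+z. ennreal (norm (case_prod k z)) \<partial>(lborel \<Otimes>\<^sub>M N)) = (\<integral>\<^sup>+z. (\<integral>\<^sup>+x. ennreal (norm (k x z)) \<partial>lborel) \<partial>N)"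
    by (subst nn_integral_snd[symmetric]) (auto simp: split_beta')
  also have "\<dots> \<le> (\<integral>\<^sup>+z. C \<partial>N)" using bound by (intro nn_integral_mono) auto
  also have "\<dots> < \<infinity>" using \<open>C < \<infinity>\<close> N.emeasure_finite[of "space N"] by (simp add: ennreal_mult_eq_top_iff flip: less_top)
  finally show "(\<integral>\<^sup>+z. ennreal (norm (case_prod k z)) \<partial>(lborel \<Otimes>\<^sub>M N)) < \<infinity>" .
qed simp

lemma borel_measurable_Lp_space: "f \<in> Lp_space p \<Longrightarrow> f \<in> borel_measurable borel"
  by (simp add: Lp_space_iff)

text \<open>The fundamental theorem of calculus along the segment from x to x + u, for almost every
  x, the null set being allowed to depend on u. It is the common interface of Schwartz functions
  with their gradient and Sobolev functions with their weak gradient.\<close>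

definition line_formula :: "('a::euclidean_space \<Rightarrow> real) \<Rightarrow> ('a \<Rightarrow> 'a) \<Rightarrow> 'a \<Rightarrow> bool" where
  "line_formula F \<Gamma> u \<longleftrightarrow>
     (AE x in lborel. F (x + u) - F x = (\<integral>t. u \<bullet> \<Gamma> (x + t *\<^sub>R u) \<partial>unit_interval))"

lemma line_formula_weighted_bound:
  fixes F :: "'a::euclidean_space \<Rightarrow> real" and w :: "'a \<Rightarrow> real"
  assumes [measurable]: "F \<in> borel_measurable borel" "\<Gamma> \<in> borel_measurable borel" "w \<in> borel_measurable borel"
    and line: "line_formula F \<Gamma> u"
    and bound: "\<And>s. (\<integral>\<^sup>+x. ennreal (\<bar>w x\<bar> * norm (\<Gamma> (x + s))) \<partial>lborel) \<le> C"
  shows "(\<integral>\<^sup>+x. ennreal (\<bar>w x\<bar> * \<bar>F (x + u) - F x\<bar>) \<partial>lborel) \<le> ennreal (norm u) * C"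
proof -
  interpret pair_sigma_finite "lborel :: 'a measure" unit_interval ..
  have "(\<integral>\<^sup>+x. ennreal (\<bar>w x\<bar> * \<bar>F (x + u) - F x\<bar>) \<partial>lborel) \<le>
    (\<integral>\<^sup>+x. (\<integral>\<^sup>+t. ennreal (norm u) * ennreal (\<bar>w x\<bar> * norm (\<Gamma> (x + t *\<^sub>R u))) \<partial>unit_interval) \<partial>lborel)"
  proof (rule nn_integral_mono_AE)
    show "AE x in lborel. ennreal (\<bar>w x\<bar> * \<bar>F (x + u) - F x\<bar>) \<le>
      (\<integral>\<^sup>+t. ennreal (norm u) * ennreal (\<bar>w x\<bar> * norm (\<Gamma> (x + t *\<^sub>R u))) \<partial>unit_interval)"
      using line unfolding line_formula_def
    proof eventually_elim
      case (elim x)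
      have "ennreal (\<bar>w x\<bar> * \<bar>F (x + u) - F x\<bar>) = ennreal \<bar>w x\<bar> * ennreal (norm (\<integral>t. u \<bullet> \<Gamma> (x + t *\<^sub>R u) \<partial>unit_interval))"
        by (simp add: elim ennreal_mult)
      also have "\<dots> \<le> ennreal \<bar>w x\<bar> * (\<integral>\<^sup>+t. ennreal (norm (u \<bullet> \<Gamma> (x + t *\<^sub>R u))) \<partial>unit_interval)"
        by (intro mult_left_mono norm_integral_le_nn_integral) auto
      also have "\<dots> = (\<integral>\<^sup>+t. ennreal \<bar>w x\<bar> * ennreal (norm (u \<bullet> \<Gamma> (x + t *\<^sub>R u))) \<partial>unit_interval)"
        by (simp add: nn_integral_cmult)
      also have "\<dots> \<le> (\<integral>\<^sup>+t. ennreal (norm u) * ennreal (\<bar>w x\<bar> * norm (\<Gamma> (x + t *\<^sub>R u))) \<partial>unit_interval)"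
      proof (rule nn_integral_mono)
        fix t
        have "\<bar>w x\<bar> * norm (u \<bullet> \<Gamma> (x + t *\<^sub>R u)) \<le> \<bar>w x\<bar> * (norm u * norm (\<Gamma> (x + t *\<^sub>R u)))"
          using Cauchy_Schwarz_ineq2 by (intro mult_left_mono) auto
        then show "ennreal \<bar>w x\<bar> * ennreal (norm (u \<bullet> \<Gamma> (x + t *\<^sub>R u))) \<le> ennreal (norm u) * ennreal (\<bar>w x\<bar> * norm (\<Gamma> (x + t *\<^sub>R u)))"
          by (simp add: ennreal_mult[symmetric] mult.left_commute)
      qed
      finally show ?case .
    qed
  qed
  also have "\<dots> = (\<integral>\<^sup>+t. (\<integral>\<^sup>+x. ennreal (norm u) * ennreal (\<bar>w x\<bar> * norm (\<Gamma> (x + t *\<^sub>R u))) \<partial>lborel) \<partial>unit_interval)"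
    by (rule Fubini'[symmetric]) simp
  also have "\<dots> \<le> (\<integral>\<^sup>+t. ennreal (norm u) * C \<partial>unit_interval)"
    using bound by (intro nn_integral_mono) (simp add: nn_integral_cmult mult_left_mono)
  also have "\<dots> = ennreal (norm u) * C" by (simp add: unit_interval.emeasure_space_1[simplified])
  finally show ?thesis .
qed

text \<open>Jensen in t, then Tonelli. G is kept apart from \<Gamma> for two uses: G = 0 bounds the
  increment itself, G = \<Gamma> bounds its deviation from the linear part.\<close>

lemma line_formula_powr_bound:
  fixes F :: "'a::euclidean_space \<Rightarrow> real" and \<Gamma> G :: "'a \<Rightarrow> 'a"
  assumes [measurable]: "F \<in> borel_measurable borel" "G \<in> borel_measurable borel"
    and \<Gamma>: "\<Gamma> \<in> Lp_space p" and p: "p \<ge> 1"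
    and line: "line_formula F \<Gamma> u"
    and bound: "\<And>t. t \<in> {0..1} \<Longrightarrow> (\<integral>\<^sup>+x. ennreal (norm (\<Gamma> (x + t *\<^sub>R u) - G x) powr p) \<partial>lborel) \<le> C"
  shows "(\<integral>\<^sup>+x. ennreal (\<bar>F (x + u) - F x - u \<bullet> G x\<bar> powr p) \<partial>lborel) \<le> ennreal (norm u powr p) * C"
proof -
  interpret pair_sigma_finite "lborel :: 'a measure" unit_interval ..
  have [measurable]: "\<Gamma> \<in> borel_measurable borel" and fin: "(\<integral>\<^sup>+x. ennreal (norm (\<Gamma> x) powr p) \<partial>lborel) < \<infinity>"
    using \<Gamma> by (auto simp: Lp_space_iff)
  have "(\<integral>\<^sup>+x. (\<integral>\<^sup>+t. ennreal (norm (\<Gamma> (x + t *\<^sub>R u)) powr p) \<partial>unit_interval) \<partial>lborel) =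
     (\<integral>\<^sup>+t. (\<integral>\<^sup>+x. ennreal (norm (\<Gamma> (x + t *\<^sub>R u)) powr p) \<partial>lborel) \<partial>unit_interval)"
    by (rule Fubini'[symmetric]) simp
  also have "\<dots> = (\<integral>\<^sup>+t. (\<integral>\<^sup>+x. ennreal (norm (\<Gamma> x) powr p) \<partial>lborel) \<partial>unit_interval)"
    by (intro nn_integral_cong nn_integral_translate) simp
  also have "\<dots> < \<infinity>" using fin by (simp add: unit_interval.emeasure_space_1[simplified])
  finally have "AE x in lborel. (\<integral>\<^sup>+t. ennreal (norm (\<Gamma> (x + t *\<^sub>R u)) powr p) \<partial>unit_interval) \<noteq> \<infinity>"
    by (intro nn_integral_PInf_AE) auto
  \<comment> \<open>Needed to move u \<bullet> G x under the integral: for a nonintegrable segment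
    the integral would be the default 0 and the subtraction would fail.\<close>
  then have int: "AE x in lborel. integrable unit_interval (\<lambda>t. \<Gamma> (x + t *\<^sub>R u))"
    by eventually_elim (intro unit_interval.integrable_if_powr_finite[OF _ p], auto simp: less_top)
  have "(\<integral>\<^sup>+x. ennreal (\<bar>F (x + u) - F x - u \<bullet> G x\<bar> powr p) \<partial>lborel) \<le>
    (\<integral>\<^sup>+x. (\<integral>\<^sup>+t. ennreal (norm u powr p) * ennreal (norm (\<Gamma> (x + t *\<^sub>R u) - G x) powr p) \<partial>unit_interval) \<partial>lborel)"
  proof (rule nn_integral_mono_AE)
    show "AE x in lborel. ennreal (\<bar>F (x + u) - F x - u \<bullet> G x\<bar> powr p) \<le>
      (\<integral>\<^sup>+t. ennreal (norm u powr p) * ennreal (norm (\<Gamma> (x + t *\<^sub>R u) - G x) powr p) \<partial>unit_interval)"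
      using line int unfolding line_formula_def
    proof eventually_elim
      case (elim x)
      have "F (x + u) - F x - u \<bullet> G x = (\<integral>t. u \<bullet> (\<Gamma> (x + t *\<^sub>R u) - G x) \<partial>unit_interval)"
        using elim by (simp add: inner_diff_right unit_interval.prob_space[simplified])
      then have "ennreal (\<bar>F (x + u) - F x - u \<bullet> G x\<bar> powr p) = ennreal (norm (\<integral>t. u \<bullet> (\<Gamma> (x + t *\<^sub>R u) - G x) \<partial>unit_interval) powr p)"
        by simp
      also have "\<dots> \<le> (\<integral>\<^sup>+t. ennreal (norm (u \<bullet> (\<Gamma> (x + t *\<^sub>R u) - G x)) powr p) \<partial>unit_interval)"
        using unit_interval.powr_norm_integral_le[OF _ p, of "\<lambda>t. u \<bullet> (\<Gamma> (x + t *\<^sub>R u) - G x)"]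
        by (simp add: unit_interval.prob_space[simplified])
      also have "\<dots> \<le> (\<integral>\<^sup>+t. ennreal (norm u powr p) * ennreal (norm (\<Gamma> (x + t *\<^sub>R u) - G x) powr p) \<partial>unit_interval)"
      proof (rule nn_integral_mono)
        fix t
        have "norm (u \<bullet> (\<Gamma> (x + t *\<^sub>R u) - G x)) powr p \<le> (norm u * norm (\<Gamma> (x + t *\<^sub>R u) - G x)) powr p"
          using Cauchy_Schwarz_ineq2 p by (intro powr_mono2) auto
        then show "ennreal (norm (u \<bullet> (\<Gamma> (x + t *\<^sub>R u) - G x)) powr p) \<le> ennreal (norm u powr p) * ennreal (norm (\<Gamma> (x + t *\<^sub>R u) - G x) powr p)"
          by (simp add: ennreal_mult[symmetric] powr_mult)
      qed
      finally show ?case .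
    qed
  qed
  also have "\<dots> = (\<integral>\<^sup>+t. (\<integral>\<^sup>+x. ennreal (norm u powr p) * ennreal (norm (\<Gamma> (x + t *\<^sub>R u) - G x) powr p) \<partial>lborel) \<partial>unit_interval)"
    by (rule Fubini'[symmetric]) simp
  also have "\<dots> \<le> (\<integral>\<^sup>+t. ennreal (norm u powr p) * C \<partial>unit_interval)"
    using bound by (intro nn_integral_mono_AE eventually_mono[OF AE_unit_interval]) (simp add: nn_integral_cmult mult_left_mono)
  also have "\<dots> = ennreal (norm u powr p) * C" by (simp add: unit_interval.emeasure_space_1[simplified])
  finally show ?thesis .
qed

subsection \<open>The line formula for Schwartz and Sobolev functions\<close>

definition gradient :: "('a::euclidean_space \<Rightarrow> real) \<Rightarrow> 'a \<Rightarrow> 'a" where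
  "gradient \<phi> x = (\<Sum>b\<in>Basis. iter_partial [b] \<phi> x *\<^sub>R b)"

lemma lists_Basis_single [simp]: "b \<in> Basis \<Longrightarrow> [b] \<in> lists Basis" by auto

lemma smooth_Schwartz: "\<phi> \<in> Schwartz_space \<Longrightarrow> smooth \<phi>"
  by (simp add: Schwartz_space_def)

lemma inner_gradient: "u \<bullet> gradient \<phi> x = (\<Sum>b\<in>Basis. (u \<bullet> b) * iter_partial [b] \<phi> x)"
  by (simp add: gradient_def inner_sum_right mult.commute)

lemma has_derivative_gradient:
  assumes "smooth \<phi>"
  shows "(\<phi> has_derivative (\<lambda>u. u \<bullet> gradient \<phi> x)) (at x)"
proof -
  have "\<phi> differentiable at x" using iter_partial_differentiable[OF assms, of "[]"] by simp
  then have D: "(\<phi> has_derivative frechet_derivative \<phi> (at x)) (at x)" by (simp add: frechet_derivative_works)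
  then interpret bounded_linear "frechet_derivative \<phi> (at x)" by (rule has_derivative_bounded_linear)
  have "frechet_derivative \<phi> (at x) u = u \<bullet> gradient \<phi> x" for u
  proof -
    have "frechet_derivative \<phi> (at x) u = frechet_derivative \<phi> (at x) (\<Sum>b\<in>Basis. (u \<bullet> b) *\<^sub>R b)"
      by (simp add: euclidean_representation)
    also have "\<dots> = u \<bullet> gradient \<phi> x" by (simp add: sum scaleR inner_gradient)
    finally show ?thesis .
  qed
  with D show ?thesis by (metis (no_types, lifting) ext)
qed

lemma continuous_on_gradient: "smooth \<phi> \<Longrightarrow> continuous_on UNIV (gradient \<phi>)"
  unfolding gradient_def by (intro continuous_intros continuous_on_iter_partial) auto

lemma borel_measurable_gradient: "smooth \<phi> \<Longrightarrow> gradient \<phi> \<in> borel_measurable borel"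
  by (intro borel_measurable_continuous_onI continuous_on_gradient)

lemma Schwartz_line_formula:
  assumes sm: "smooth \<phi>"
  shows "\<phi> (x + u) - \<phi> x = (\<integral>t. u \<bullet> gradient \<phi> (x + t *\<^sub>R u) \<partial>unit_interval)"
proof -
  note [measurable] = borel_measurable_gradient[OF sm]
  have cont: "continuous_on {0..1} (\<lambda>t. u \<bullet> gradient \<phi> (x + t *\<^sub>R u))"
    by (intro continuous_intros continuous_on_compose2[OF continuous_on_gradient[OF sm]]) auto
  have "(\<integral>t. indicator {0..1} t *\<^sub>R (u \<bullet> gradient \<phi> (x + t *\<^sub>R u)) \<partial>lborel) = \<phi> (x + 1 *\<^sub>R u) - \<phi> (x + 0 *\<^sub>R u)"
  proof (rule integral_FTC_atLeastAtMost[OF _ _ cont])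
    fix t :: real
    have "((\<lambda>t. \<phi> (x + t *\<^sub>R u)) has_derivative (\<lambda>h. (h *\<^sub>R u) \<bullet> gradient \<phi> (x + t *\<^sub>R u))) (at t within {0..1})"
      by (rule has_derivative_compose[OF _ has_derivative_gradient[OF sm]]) (auto intro!: derivative_eq_intros)
    then show "((\<lambda>t. \<phi> (x + t *\<^sub>R u)) has_vector_derivative u \<bullet> gradient \<phi> (x + t *\<^sub>R u)) (at t within {0..1})"
      by (simp add: has_vector_derivative_def)
  qed simp
  moreover have "(\<integral>t. u \<bullet> gradient \<phi> (x + t *\<^sub>R u) \<partial>unit_interval) = (\<integral>t. indicator {0..1} t *\<^sub>R (u \<bullet> gradient \<phi> (x + t *\<^sub>R u)) \<partial>lborel)"
    unfolding unit_interval_def ennreal_indicator[symmetric] by (subst integral_density) auto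
  ultimately show ?thesis by simp
qed

lemma Schwartz_gradient_integrable:
  assumes "\<phi> \<in> Schwartz_space"
  obtains A where "\<And>x. norm (gradient \<phi> x) \<le> A" "integrable lborel (gradient \<phi>)"
proof -
  have "\<exists>A. \<forall>x. \<bar>iter_partial [b] \<phi> x\<bar> \<le> A" if "b \<in> Basis" for b
    using Schwartz_bounded[OF assms lists_Basis_single[OF that]] by metis
  then obtain A where A: "\<And>b x. b \<in> Basis \<Longrightarrow> \<bar>iter_partial [b] \<phi> x\<bar> \<le> A b" by metis
  show thesis
  proof
    show "norm (gradient \<phi> x) \<le> sum A Basis" for x
      unfolding gradient_def using A by (intro sum_norm_le) auto
    show "integrable lborel (gradient \<phi>)"
      unfolding gradient_def using Schwartz_integrable[OF assms]
      by (intro Bochner_Integration.integrable_sum integrable_scaleR_left) (auto simp del: iter_partial.simps)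
  qed
qed

text \<open>The constant does not depend on the shift s, which is what integration over segments and
  jumps requires. Shifts on \<phi> are reduced to shifts on v by translation invariance.\<close>

lemma Schwartz_mult_Lp_bound:
  fixes v :: "'a::euclidean_space \<Rightarrow> 'b::euclidean_space"
  assumes \<phi>: "\<phi> \<in> Schwartz_space" and v: "v \<in> Lp_space p" and p: "p \<ge> 1"
  obtains C where "C < \<infinity>" "\<And>s. (\<integral>\<^sup>+x. ennreal (\<bar>\<phi> x\<bar> * norm (v (x + s))) \<partial>lborel) \<le> C"
    "\<And>s. (\<integral>\<^sup>+x. ennreal (norm (v x) * \<bar>\<phi> (x + s)\<bar>) \<partial>lborel) \<le> C"
    "\<And>s. (\<integral>\<^sup>+x. ennreal (norm (v x) * norm (gradient \<phi> (x + s))) \<partial>lborel) \<le> C"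
proof -
  have [measurable]: "v \<in> borel_measurable borel" and fin: "(\<integral>\<^sup>+x. ennreal (norm (v x) powr p) \<partial>lborel) < \<infinity>"
    using v by (auto simp: Lp_space_iff)
  note sm = smooth_Schwartz[OF \<phi>]
  note [measurable] = borel_measurable_gradient[OF sm] borel_measurable_iter_partial[OF sm, of "[]", simplified]
  obtain A where A: "\<And>x. \<bar>\<phi> x\<bar> \<le> A" using Schwartz_bounded[OF \<phi>, of "[]"] by auto
  have int: "integrable lborel \<phi>" using Schwartz_integrable[OF \<phi>, of "[]"] by simp
  obtain A' where A': "\<And>x. norm (gradient \<phi> x) \<le> A'" "integrable lborel (gradient \<phi>)"
    using Schwartz_gradient_integrable[OF \<phi>] by blast
  let ?C1 = "(\<integral>\<^sup>+x. ennreal \<bar>\<phi> x\<bar> \<partial>lborel) + ennreal A * (\<integral>\<^sup>+x. ennreal (norm (v x) powr p) \<partial>lborel)"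
  let ?C2 = "(\<integral>\<^sup>+x. ennreal \<bar>norm (gradient \<phi> x)\<bar> \<partial>lborel) + ennreal A' * (\<integral>\<^sup>+x. ennreal (norm (v x) powr p) \<partial>lborel)"
  have 1: "(\<integral>\<^sup>+x. ennreal (\<bar>\<phi> x\<bar> * norm (v (x + s))) \<partial>lborel) \<le> ?C1" for s
    by (rule nn_integral_mult_translate_le[OF _ _ A p]) auto
  have 2: "(\<integral>\<^sup>+x. ennreal (\<bar>norm (gradient \<phi> x)\<bar> * norm (v (x + s))) \<partial>lborel) \<le> ?C2" for s
    by (rule nn_integral_mult_translate_le[OF _ _ _ p]) (use A' in auto)
  have swap: "(\<integral>\<^sup>+x. ennreal (norm (v x) * norm (w (x + s))) \<partial>lborel) = (\<integral>\<^sup>+x. ennreal (norm (w x) * norm (v (x + - s))) \<partial>lborel)"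
    if [measurable]: "w \<in> borel_measurable borel" for w :: "'a \<Rightarrow> 'c::euclidean_space" and s
    using nn_integral_translate[of "\<lambda>x. ennreal (norm (w x) * norm (v (x + - s)))" s] by (simp add: mult.commute)
  show thesis
  proof
    show "?C1 + ?C2 < \<infinity>"
      using int A'(2) fin by (auto simp: integrable_iff_bounded ennreal_mult_less_top)
    show "(\<integral>\<^sup>+x. ennreal (\<bar>\<phi> x\<bar> * norm (v (x + s))) \<partial>lborel) \<le> ?C1 + ?C2" for s
      using 1 by (rule order_trans) simp
    show "(\<integral>\<^sup>+x. ennreal (norm (v x) * \<bar>\<phi> (x + s)\<bar>) \<partial>lborel) \<le> ?C1 + ?C2" for s
      using order_trans[OF 1[of "- s"], of "?C1 + ?C2"] swap[of \<phi> s] by simp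
    show "(\<integral>\<^sup>+x. ennreal (norm (v x) * norm (gradient \<phi> (x + s))) \<partial>lborel) \<le> ?C1 + ?C2" for s
      using order_trans[OF 2[of "- s"], of "?C1 + ?C2"] swap[of "gradient \<phi>" s] by simp
  qed
qed

lemma Schwartz_mult_Lp_integrable:
  fixes v :: "'a::euclidean_space \<Rightarrow> real"
  assumes \<phi>: "\<phi> \<in> Schwartz_space" and v: "v \<in> Lp_space p" and p: "p \<ge> 1"
  shows "integrable lborel (\<lambda>x. v x * \<phi> (x + s))"
proof (rule integrableI_bounded)
  note [measurable] = borel_measurable_iter_partial[OF smooth_Schwartz[OF \<phi>], of "[]", simplified]
    borel_measurable_Lp_space[OF v]
  obtain C where "C < \<infinity>" and C: "\<And>s. (\<integral>\<^sup>+x. ennreal (norm (v x) * \<bar>\<phi> (x + s)\<bar>) \<partial>lborel) \<le> C"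
    using Schwartz_mult_Lp_bound[OF \<phi> v p] by metis
  then show "(\<integral>\<^sup>+x. ennreal (norm (v x * \<phi> (x + s))) \<partial>lborel) < \<infinity>"
    by (auto simp: abs_mult intro: le_less_trans)
  show "(\<lambda>x. v x * \<phi> (x + s)) \<in> borel_measurable lborel" by measurable
qed

text \<open>In the final theorem the given gradient is known only to be locally integrable; this
  identifies it with the L^p gradient provided by \<open>Sobolev1\<close>. Integrability against a
  test function comes from its compact support.\<close>

lemma weak_gradient_unique:
  assumes "has_weak_gradient f g" "has_weak_gradient f g'"
  shows "AE x in lborel. g x = g' x"
proof -
  have li: "locally_integrable (\<lambda>x. (g x - g' x) \<bullet> b)" for b
  proof -
    have "set_integrable lborel K (\<lambda>x. g x - g' x)" if "compact K" for K
      using assms that by (auto simp: has_weak_gradient_def locally_integrable_def intro: set_integral_diff)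
    then show ?thesis
      unfolding locally_integrable_def set_integrable_def by (auto simp flip: inner_scaleR_left)
  qed
  have "AE x in lborel. (g x - g' x) \<bullet> b = 0" if b: "b \<in> Basis" for b
  proof (rule fundamental_lemma_calculus_of_variations[OF li])
    fix \<phi> :: "'a \<Rightarrow> real" assume \<phi>: "\<phi> \<in> test_functions"
    have int: "integrable lborel (\<lambda>x. (h x \<bullet> b) * \<phi> x)" if h: "locally_integrable h" for h :: "'a \<Rightarrow> 'a"
    proof -
      let ?K = "closure {x. \<phi> x \<noteq> 0}"
      have "\<phi> \<in> Schwartz_space" using \<phi> test_functions_subset_Schwartz_space by blast
      then obtain A where A: "\<And>x. \<bar>\<phi> x\<bar> \<le> A" using Schwartz_bounded[of \<phi> "[]"] by auto
      have [measurable]: "\<phi> \<in> borel_measurable borel"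
        using \<phi> borel_measurable_iter_partial[of \<phi> "[]"] by (simp add: test_functions_def)
      have [measurable]: "h \<in> borel_measurable borel" using h by (rule borel_measurable_locally_integrable)
      have "compact ?K" using \<phi> by (simp add: test_functions_def)
      then have "integrable lborel (\<lambda>x. A * norm (indicator ?K x *\<^sub>R h x))"
        using h unfolding locally_integrable_def set_integrable_def by (intro integrable_mult_right integrable_norm) blast
      then show ?thesis
      proof (rule Bochner_Integration.integrable_bound)
        show "AE x in lborel. norm ((h x \<bullet> b) * \<phi> x) \<le> norm (A * norm (indicator ?K x *\<^sub>R h x))"
        proof (rule AE_I2)
          fix x
          show "norm ((h x \<bullet> b) * \<phi> x) \<le> norm (A * norm (indicator ?K x *\<^sub>R h x))"
          proof (cases "\<phi> x = 0")
            case False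
            then have "x \<in> ?K" using closure_subset[of "{x. \<phi> x \<noteq> 0}"] by auto
            moreover have "\<bar>h x \<bullet> b\<bar> * \<bar>\<phi> x\<bar> \<le> norm (h x) * \<bar>A\<bar>"
              using A[of x] b by (intro mult_mono Basis_le_norm) auto
            ultimately show ?thesis by (simp add: abs_mult mult.commute)
          qed simp
        qed
      qed simp
    qed
    have "(\<integral>x. (g x - g' x) \<bullet> b * \<phi> x \<partial>lborel) = (\<integral>x. (g x \<bullet> b) * \<phi> x \<partial>lborel) - (\<integral>x. (g' x \<bullet> b) * \<phi> x \<partial>lborel)"
      using assms int by (simp add: has_weak_gradient_def inner_diff_left left_diff_distrib)
    also have "\<dots> = 0"
    proof -
      have "(\<integral>x. f x * iter_partial [b] \<phi> x \<partial>lborel) = - (\<integral>x. (h x \<bullet> b) * \<phi> x \<partial>lborel)"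
        if "has_weak_gradient f h" for h
        using that \<phi> b unfolding has_weak_gradient_def by blast
      from this[OF assms(1)] this[OF assms(2)] show ?thesis by linarith
    qed
    finally show "(\<integral>x. (g x - g' x) \<bullet> b * \<phi> x \<partial>lborel) = 0" .
  qed
  then have "AE x in lborel. \<forall>b\<in>Basis. (g x - g' x) \<bullet> b = 0"
    by (subst AE_finite_all) auto
  then show ?thesis
    by eventually_elim (rule euclidean_eqI, simp add: inner_diff_left)
qed

text \<open>The difference of the two sides is tested against \<phi>. Translation moves the
  increment of f onto \<phi>, where the classical formula along the segment from x to x - u applies;
  Fubini, integration by parts for each t, and Fubini back produce the segment integral J of the
  weak gradient.\<close>

lemma Sobolev1_line_formula:
  fixes f :: "'a::euclidean_space \<Rightarrow> real" and g :: "'a \<Rightarrow> 'a"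
  assumes f: "f \<in> Lp_space p" and g: "g \<in> Lp_space p" and p: "p \<ge> 1" and wg: "has_weak_gradient f g"
  shows "line_formula f g u"
proof -
  interpret pair_sigma_finite "lborel :: 'a measure" unit_interval ..
  have [measurable]: "f \<in> borel_measurable borel" "g \<in> borel_measurable borel"
    and fin: "(\<integral>\<^sup>+x. ennreal (norm (f x) powr p) \<partial>lborel) < \<infinity>" "(\<integral>\<^sup>+x. ennreal (norm (g x) powr p) \<partial>lborel) < \<infinity>"
    using f g by (auto simp: Lp_space_iff)
  define J where "J x = (\<integral>t. u \<bullet> g (x + t *\<^sub>R u) \<partial>unit_interval)" for x
  have [measurable]: "J \<in> borel_measurable borel" unfolding J_def by simp
  have J: "J \<in> Lp_space p"
  proof -
    have "(\<integral>\<^sup>+x. ennreal (norm (J x) powr p) \<partial>lborel) \<le>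
      (\<integral>\<^sup>+x. (\<integral>\<^sup>+t. ennreal (norm (u \<bullet> g (x + t *\<^sub>R u)) powr p) \<partial>unit_interval) \<partial>lborel)"
      using unit_interval.powr_norm_integral_le[OF _ p, of "\<lambda>t. u \<bullet> g (_ + t *\<^sub>R u)"]
      by (intro nn_integral_mono) (simp add: J_def unit_interval.prob_space[simplified])
    also have "\<dots> = (\<integral>\<^sup>+t. (\<integral>\<^sup>+x. ennreal (norm (u \<bullet> g (x + t *\<^sub>R u)) powr p) \<partial>lborel) \<partial>unit_interval)"
      by (rule Fubini'[symmetric]) simp
    also have "\<dots> = (\<integral>\<^sup>+t. (\<integral>\<^sup>+x. ennreal (norm (u \<bullet> g x) powr p) \<partial>lborel) \<partial>unit_interval)"
      by (intro nn_integral_cong nn_integral_translate) simp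
    also have "\<dots> = (\<integral>\<^sup>+x. ennreal (norm (u \<bullet> g x) powr p) \<partial>lborel)"
      by (simp add: unit_interval.emeasure_space_1[simplified])
    also have "\<dots> \<le> (\<integral>\<^sup>+x. ennreal (norm u powr p) * ennreal (norm (g x) powr p) \<partial>lborel)"
      using Cauchy_Schwarz_ineq2[of u] p
      by (intro nn_integral_mono) (auto simp: ennreal_mult[symmetric] powr_mult[symmetric] intro!: ennreal_leI powr_mono2)
    also have "\<dots> < \<infinity>" using fin by (simp add: nn_integral_cmult ennreal_mult_less_top)
    finally show ?thesis by (simp add: Lp_space_iff)
  qed
  have fu: "(\<lambda>x. f (x + u)) \<in> Lp_space p"
    using f nn_integral_translate[of "\<lambda>x. ennreal (norm (f x) powr p)" u] by (simp add: Lp_space_iff)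
  have li: "locally_integrable (\<lambda>x. f (x + u) - f x - J x)"
    using locally_integrable_Lp[OF f p] locally_integrable_Lp[OF fu p] locally_integrable_Lp[OF J p]
    unfolding locally_integrable_def by (auto intro!: set_integral_diff)
  have "AE x in lborel. f (x + u) - f x - J x = 0"
  proof (rule fundamental_lemma_calculus_of_variations[OF li])
    fix \<phi> :: "'a \<Rightarrow> real" assume test: "\<phi> \<in> test_functions"
    then have \<phi>: "\<phi> \<in> Schwartz_space" using test_functions_subset_Schwartz_space by blast
    note sm = smooth_Schwartz[OF \<phi>]
    note [measurable] = borel_measurable_gradient[OF sm] borel_measurable_iter_partial[OF sm, of "[]", simplified]
    note intg = Schwartz_mult_Lp_integrable[OF \<phi> _ p]
    obtain C where Cf: "C < \<infinity>" "\<And>s. (\<integral>\<^sup>+x. ennreal (norm (f x) * norm (gradient \<phi> (x + s))) \<partial>lborel) \<le> C"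
      using Schwartz_mult_Lp_bound[OF \<phi> f p] by metis
    obtain C' where Cg: "C' < \<infinity>" "\<And>s. (\<integral>\<^sup>+x. ennreal (\<bar>\<phi> x\<bar> * norm (g (x + s))) \<partial>lborel) \<le> C'"
      using Schwartz_mult_Lp_bound[OF \<phi> g p] by metis
    have int1: "integrable (lborel \<Otimes>\<^sub>M unit_interval) (\<lambda>(x, t). f x * (- u \<bullet> gradient \<phi> (x + t *\<^sub>R - u)))"
    proof (rule integrable_pair_lborel[where C = "ennreal (norm u) * C"])
      fix t
      have "(\<integral>\<^sup>+x. ennreal (norm (f x * (- u \<bullet> gradient \<phi> (x + t *\<^sub>R - u)))) \<partial>lborel) \<le>
         (\<integral>\<^sup>+x. ennreal (norm u) * ennreal (norm (f x) * norm (gradient \<phi> (x + t *\<^sub>R - u))) \<partial>lborel)"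
      proof (rule nn_integral_mono)
        fix x
        have "\<bar>f x\<bar> * \<bar>u \<bullet> gradient \<phi> (x + t *\<^sub>R - u)\<bar> \<le> \<bar>f x\<bar> * (norm u * norm (gradient \<phi> (x + t *\<^sub>R - u)))"
          by (intro mult_left_mono Cauchy_Schwarz_ineq2) auto
        then show "ennreal (norm (f x * (- u \<bullet> gradient \<phi> (x + t *\<^sub>R - u)))) \<le> ennreal (norm u) * ennreal (norm (f x) * norm (gradient \<phi> (x + t *\<^sub>R - u)))"
          by (simp add: ennreal_mult[symmetric] abs_mult mult_ac)
      qed
      also have "\<dots> \<le> ennreal (norm u) * C"
        using Cf(2)[of "t *\<^sub>R - u"] by (simp add: nn_integral_cmult mult_left_mono)
      finally show "(\<integral>\<^sup>+x. ennreal (norm (f x * (- u \<bullet> gradient \<phi> (x + t *\<^sub>R - u)))) \<partial>lborel) \<le> ennreal (norm u) * C" .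
    qed (use Cf(1) in \<open>auto simp: ennreal_mult_less_top unit_interval.finite_measure_axioms\<close>)
    have int2: "integrable (lborel \<Otimes>\<^sub>M unit_interval) (\<lambda>(x, t). \<phi> x * (u \<bullet> g (x + t *\<^sub>R u)))"
    proof (rule integrable_pair_lborel[where C = "ennreal (norm u) * C'"])
      fix t
      have "(\<integral>\<^sup>+x. ennreal (norm (\<phi> x * (u \<bullet> g (x + t *\<^sub>R u)))) \<partial>lborel) \<le>
         (\<integral>\<^sup>+x. ennreal (norm u) * ennreal (\<bar>\<phi> x\<bar> * norm (g (x + t *\<^sub>R u))) \<partial>lborel)"
      proof (rule nn_integral_mono)
        fix x
        have "\<bar>\<phi> x\<bar> * \<bar>u \<bullet> g (x + t *\<^sub>R u)\<bar> \<le> \<bar>\<phi> x\<bar> * (norm u * norm (g (x + t *\<^sub>R u)))"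
          by (intro mult_left_mono Cauchy_Schwarz_ineq2) auto
        then show "ennreal (norm (\<phi> x * (u \<bullet> g (x + t *\<^sub>R u)))) \<le> ennreal (norm u) * ennreal (\<bar>\<phi> x\<bar> * norm (g (x + t *\<^sub>R u)))"
          by (simp add: ennreal_mult[symmetric] abs_mult mult_ac)
      qed
      also have "\<dots> \<le> ennreal (norm u) * C'"
        using Cg(2) by (simp add: nn_integral_cmult mult_left_mono)
      finally show "(\<integral>\<^sup>+x. ennreal (norm (\<phi> x * (u \<bullet> g (x + t *\<^sub>R u)))) \<partial>lborel) \<le> ennreal (norm u) * C'" .
    qed (use Cg(1) in \<open>auto simp: ennreal_mult_less_top unit_interval.finite_measure_axioms\<close>)
    \<comment> \<open>For fixed t this is the definition of the weak gradient, tested with the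
      translate of \<phi> by t u, followed by the substitution of x + t u for x.\<close>
    have inner: "(\<integral>x. f x * (- u \<bullet> gradient \<phi> (x + t *\<^sub>R - u)) \<partial>lborel) = (\<integral>x. \<phi> x * (u \<bullet> g (x + t *\<^sub>R u)) \<partial>lborel)" for t
    proof -
      let ?\<psi> = "\<lambda>x. \<phi> (x - t *\<^sub>R u)"
      have t\<psi>: "?\<psi> \<in> test_functions" by (rule test_functions_translate[OF test])
      then have S\<psi>: "?\<psi> \<in> Schwartz_space" using test_functions_subset_Schwartz_space by blast
      have part: "iter_partial [b] ?\<psi> x = iter_partial [b] \<phi> (x - t *\<^sub>R u)" if "b \<in> Basis" for b x
        using iter_partial_translate[OF sm, of "[b]"] that by simp
      have intb: "integrable lborel (\<lambda>x. f x * iter_partial [b] ?\<psi> x)" if b: "b \<in> Basis" for b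
      proof (rule integrableI_bounded)
        note [measurable] = borel_measurable_iter_partial[OF smooth_Schwartz[OF S\<psi>] lists_Basis_single[OF b]]
        show "(\<lambda>x. f x * iter_partial [b] ?\<psi> x) \<in> borel_measurable lborel" by measurable
        have "norm (f x * iter_partial [b] ?\<psi> x) \<le> norm (f x) * norm (gradient \<phi> (x + - t *\<^sub>R u))" for x
        proof -
          have "iter_partial [b] \<phi> y = gradient \<phi> y \<bullet> b" for y
            using b by (simp add: gradient_def inner_sum_left inner_Basis if_distrib[of "\<lambda>c. _ * c"] sum.delta' cong: if_cong)
          then have "\<bar>iter_partial [b] \<phi> y\<bar> \<le> norm (gradient \<phi> y)" for y
            using Basis_le_norm[OF b, of "gradient \<phi> y"] by simp
          then show ?thesis unfolding part[OF b] by (simp add: abs_mult mult_left_mono del: iter_partial.simps)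
        qed
        then have "(\<integral>\<^sup>+x. ennreal (norm (f x * iter_partial [b] ?\<psi> x)) \<partial>lborel) \<le> C"
          by (intro order_trans[OF nn_integral_mono Cf(2)] ennreal_leI)
        then show "(\<integral>\<^sup>+x. ennreal (norm (f x * iter_partial [b] ?\<psi> x)) \<partial>lborel) < \<infinity>" using Cf(1) by (rule le_less_trans)
      qed
      have intg': "integrable lborel (\<lambda>x. (g x \<bullet> b) * ?\<psi> x)" if b: "b \<in> Basis" for b
      proof -
        have "(\<lambda>x. g x \<bullet> b) \<in> Lp_space p"
        proof -
          have "(\<integral>\<^sup>+x. ennreal (norm (g x \<bullet> b) powr p) \<partial>lborel) \<le> (\<integral>\<^sup>+x. ennreal (norm (g x) powr p) \<partial>lborel)"
            using Basis_le_norm[OF b] p by (intro nn_integral_mono ennreal_leI powr_mono2) auto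
          then show ?thesis using fin by (auto simp: Lp_space_iff intro: le_less_trans)
        qed
        from intg[OF this, of "- t *\<^sub>R u"] show ?thesis by simp
      qed
      have "(\<integral>x. f x * (- u \<bullet> gradient \<phi> (x + t *\<^sub>R - u)) \<partial>lborel) = (\<integral>x. (\<Sum>b\<in>Basis. - (u \<bullet> b) * (f x * iter_partial [b] ?\<psi> x)) \<partial>lborel)"
      proof (rule Bochner_Integration.integral_cong[OF refl])
        fix x
        have "(- u) \<bullet> gradient \<phi> (x - t *\<^sub>R u) = (\<Sum>b\<in>Basis. - (u \<bullet> b) * iter_partial [b] ?\<psi> x)"
          unfolding inner_gradient by (intro sum.cong refl) (simp only: part inner_minus_left)
        then show "f x * (- u \<bullet> gradient \<phi> (x + t *\<^sub>R - u)) = (\<Sum>b\<in>Basis. - (u \<bullet> b) * (f x * iter_partial [b] ?\<psi> x))"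
          by (simp add: sum_distrib_left mult.left_commute del: iter_partial.simps)
      qed
      also have "\<dots> = (\<Sum>b\<in>Basis. - (u \<bullet> b) * (\<integral>x. f x * iter_partial [b] ?\<psi> x \<partial>lborel))"
        using intb by (subst Bochner_Integration.integral_sum) (auto simp del: iter_partial.simps)
      also have "\<dots> = (\<Sum>b\<in>Basis. (u \<bullet> b) * (\<integral>x. (g x \<bullet> b) * ?\<psi> x \<partial>lborel))"
        using wg t\<psi> by (intro sum.cong refl) (simp add: has_weak_gradient_def del: iter_partial.simps)
      also have "\<dots> = (\<integral>x. (\<Sum>b\<in>Basis. (u \<bullet> b) * ((g x \<bullet> b) * ?\<psi> x)) \<partial>lborel)"
        using intg' by (subst Bochner_Integration.integral_sum) auto
      also have "\<dots> = (\<integral>x. \<phi> (x + - t *\<^sub>R u) * (u \<bullet> g x) \<partial>lborel)"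
        by (intro Bochner_Integration.integral_cong refl)
           (subst euclidean_inner, simp add: sum_distrib_left mult_ac)
      also have "\<dots> = (\<integral>x. \<phi> x * (u \<bullet> g (x + t *\<^sub>R u)) \<partial>lborel)"
        using integral_translate[of "\<lambda>x. \<phi> (x + - t *\<^sub>R u) * (u \<bullet> g x)" "t *\<^sub>R u"] by simp
      finally show ?thesis .
    qed
    have "(\<integral>x. f (x + u) * \<phi> x \<partial>lborel) = (\<integral>x. f x * \<phi> (x + - u) \<partial>lborel)"
      using integral_translate[of "\<lambda>x. f x * \<phi> (x + - u)" u] by simp
    then have "(\<integral>x. f (x + u) * \<phi> x \<partial>lborel) - (\<integral>x. f x * \<phi> x \<partial>lborel) = (\<integral>x. f x * (\<phi> (x + - u) - \<phi> x) \<partial>lborel)"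
      using intg[OF f, of "- u"] intg[OF f, of 0] by (simp add: right_diff_distrib)
    \<comment> \<open>The everywhere valid formula for \<phi> with displacement - u; from here only
      the order of integration and \<open>inner\<close> are used.\<close>
    also have "\<dots> = (\<integral>x. (\<integral>t. f x * (- u \<bullet> gradient \<phi> (x + t *\<^sub>R - u)) \<partial>unit_interval) \<partial>lborel)"
      by (subst Schwartz_line_formula[OF sm]) (simp only: integral_mult_right_zero)
    also have "\<dots> = (\<integral>t. (\<integral>x. f x * (- u \<bullet> gradient \<phi> (x + t *\<^sub>R - u)) \<partial>lborel) \<partial>unit_interval)"
      by (rule Fubini_integral[OF int1, symmetric])
    also have "\<dots> = (\<integral>t. (\<integral>x. \<phi> x * (u \<bullet> g (x + t *\<^sub>R u)) \<partial>lborel) \<partial>unit_interval)"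
      by (simp only: inner)
    also have "\<dots> = (\<integral>x. (\<integral>t. \<phi> x * (u \<bullet> g (x + t *\<^sub>R u)) \<partial>unit_interval) \<partial>lborel)"
      by (rule Fubini_integral[OF int2])
    also have "\<dots> = (\<integral>x. J x * \<phi> x \<partial>lborel)"
      by (simp add: J_def mult.commute)
    finally have eq: "(\<integral>x. f (x + u) * \<phi> x \<partial>lborel) - (\<integral>x. f x * \<phi> x \<partial>lborel) = (\<integral>x. J x * \<phi> x \<partial>lborel)" .
    have "(\<integral>x. (f (x + u) - f x - J x) * \<phi> x \<partial>lborel) =
      (\<integral>x. f (x + u) * \<phi> x \<partial>lborel) - (\<integral>x. f x * \<phi> x \<partial>lborel) - (\<integral>x. J x * \<phi> x \<partial>lborel)"
      using intg[OF f, of 0] intg[OF fu, of 0] intg[OF J, of 0] by (simp add: left_diff_distrib)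
    with eq show "(\<integral>x. (f (x + u) - f x - J x) * \<phi> x \<partial>lborel) = 0" by simp
  qed
  then show ?thesis unfolding line_formula_def J_def by eventually_elim simp
qed

subsection \<open>Averages of difference quotients\<close>

text \<open>Dividing by \<open>min r 1\<close> rather than by \<open>r\<close> keeps both the small and the large jumps bounded
  in \<open>L\<^sup>p\<close>: the former through the gradient, the latter through the function itself.\<close>

definition diff_quot :: "('a::euclidean_space \<Rightarrow> real) \<Rightarrow> 'a \<Rightarrow> real \<Rightarrow> 'a \<Rightarrow> real" where
  "diff_quot F x r y = (F (x + r *\<^sub>R y) - F x) / min r 1"

lemma diff_quot_weighted_bound:
  fixes F :: "'a::euclidean_space \<Rightarrow> real" and w :: "'a \<Rightarrow> real"
  assumes [measurable]: "F \<in> borel_measurable borel" "\<Gamma> \<in> borel_measurable borel" "w \<in> borel_measurable borel"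
    and line: "line_formula F \<Gamma> (r *\<^sub>R y)"
    and r: "r > 0" and y: "norm y = 1"
    and \<Gamma>: "\<And>s. (\<integral>\<^sup>+x. ennreal (\<bar>w x\<bar> * norm (\<Gamma> (x + s))) \<partial>lborel) \<le> C"
    and F: "\<And>s. (\<integral>\<^sup>+x. ennreal (\<bar>w x\<bar> * \<bar>F (x + s)\<bar>) \<partial>lborel) \<le> C'"
  shows "(\<integral>\<^sup>+x. ennreal (\<bar>w x\<bar> * \<bar>diff_quot F x r y\<bar>) \<partial>lborel) \<le> C + (C' + C')"
proof (cases "r \<le> 1")
  case True
  have "(\<integral>\<^sup>+x. ennreal (\<bar>w x\<bar> * \<bar>diff_quot F x r y\<bar>) \<partial>lborel) =
      (\<integral>\<^sup>+x. ennreal (1 / r) * ennreal (\<bar>w x\<bar> * \<bar>F (x + r *\<^sub>R y) - F x\<bar>) \<partial>lborel)"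
    using True r by (intro nn_integral_cong) (simp add: diff_quot_def ennreal_mult[symmetric] min_absorb1)
  also have "\<dots> = ennreal (1 / r) * (\<integral>\<^sup>+x. ennreal (\<bar>w x\<bar> * \<bar>F (x + r *\<^sub>R y) - F x\<bar>) \<partial>lborel)"
    by (rule nn_integral_cmult) simp
  also have "\<dots> \<le> ennreal (1 / r) * (ennreal (norm (r *\<^sub>R y)) * C)"
    by (intro mult_left_mono line_formula_weighted_bound[OF _ _ _ line \<Gamma>]) auto
  also have "\<dots> = C" using r y by (simp add: mult.assoc[symmetric] ennreal_mult[symmetric])
  finally show ?thesis by (rule order_trans) simp
next
  case False
  have "(\<integral>\<^sup>+x. ennreal (\<bar>w x\<bar> * \<bar>diff_quot F x r y\<bar>) \<partial>lborel) \<le>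
      (\<integral>\<^sup>+x. ennreal (\<bar>w x\<bar> * \<bar>F (x + r *\<^sub>R y)\<bar>) + ennreal (\<bar>w x\<bar> * \<bar>F (x + 0)\<bar>) \<partial>lborel)"
  proof (rule nn_integral_mono)
    fix x
    have "\<bar>w x\<bar> * \<bar>F (x + r *\<^sub>R y) - F x\<bar> \<le> \<bar>w x\<bar> * (\<bar>F (x + r *\<^sub>R y)\<bar> + \<bar>F x\<bar>)"
      by (intro mult_left_mono) auto
    then show "ennreal (\<bar>w x\<bar> * \<bar>diff_quot F x r y\<bar>) \<le> ennreal (\<bar>w x\<bar> * \<bar>F (x + r *\<^sub>R y)\<bar>) + ennreal (\<bar>w x\<bar> * \<bar>F (x + 0)\<bar>)"
      using False by (simp add: diff_quot_def min_absorb2 distrib_left ennreal_plus[symmetric] del: ennreal_plus)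
  qed
  also have "\<dots> \<le> C' + C'"
    using F[of "r *\<^sub>R y"] F[of 0] by (simp add: nn_integral_add add_mono)
  finally show ?thesis by (rule order_trans) simp
qed

text \<open>The factor r^-p of the quotient cancels the p-th power of the norm of r y in
  \<open>line_formula_powr_bound\<close>, so no dependence on r is left besides that of C.\<close>

lemma diff_quot_powr_bound_small:
  fixes F :: "'a::euclidean_space \<Rightarrow> real" and \<Gamma> G :: "'a \<Rightarrow> 'a"
  assumes [measurable]: "F \<in> borel_measurable borel" "G \<in> borel_measurable borel"
    and \<Gamma>: "\<Gamma> \<in> Lp_space p" and p: "p \<ge> 1"
    and line: "line_formula F \<Gamma> (r *\<^sub>R y)"
    and r: "r > 0" "r \<le> 1" and y: "norm y = 1"
    and bound: "\<And>t. t \<in> {0..1} \<Longrightarrow> (\<integral>\<^sup>+x. ennreal (norm (\<Gamma> (x + t *\<^sub>R (r *\<^sub>R y)) - G x) powr p) \<partial>lborel) \<le> C"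
  shows "(\<integral>\<^sup>+x. ennreal (\<bar>diff_quot F x r y - y \<bullet> G x\<bar> powr p) \<partial>lborel) \<le> C"
proof -
  have "\<bar>diff_quot F x r y - y \<bullet> G x\<bar> powr p = (1 / r) powr p * \<bar>F (x + r *\<^sub>R y) - F x - (r *\<^sub>R y) \<bullet> G x\<bar> powr p" for x
  proof -
    have "\<bar>diff_quot F x r y - y \<bullet> G x\<bar> = (1 / r) * \<bar>F (x + r *\<^sub>R y) - F x - (r *\<^sub>R y) \<bullet> G x\<bar>"
      using r by (simp add: diff_quot_def min_absorb1 field_simps abs_mult_pos')
    then show ?thesis using r by (simp add: powr_mult powr_divide)
  qed
  then have "(\<integral>\<^sup>+x. ennreal (\<bar>diff_quot F x r y - y \<bullet> G x\<bar> powr p) \<partial>lborel) =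
      ennreal ((1 / r) powr p) * (\<integral>\<^sup>+x. ennreal (\<bar>F (x + r *\<^sub>R y) - F x - (r *\<^sub>R y) \<bullet> G x\<bar> powr p) \<partial>lborel)"
    by (simp add: ennreal_mult nn_integral_cmult)
  also have "\<dots> \<le> ennreal ((1 / r) powr p) * (ennreal (norm (r *\<^sub>R y) powr p) * C)"
    by (intro mult_left_mono line_formula_powr_bound[OF _ _ \<Gamma> p line bound]) auto
  also have "\<dots> = C" using r y by (simp add: mult.assoc[symmetric] ennreal_mult[symmetric] powr_divide)
  finally show ?thesis .
qed

lemma diff_quot_powr_bound_large:
  fixes F :: "'a::euclidean_space \<Rightarrow> real"
  assumes [measurable]: "F \<in> borel_measurable borel" and p: "p \<ge> 1" and r: "r > 1"
  shows "(\<integral>\<^sup>+x. ennreal (\<bar>diff_quot F x r y\<bar> powr p) \<partial>lborel) \<le>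
    ennreal (2 powr p) * ((\<integral>\<^sup>+x. ennreal (norm (F x) powr p) \<partial>lborel) + (\<integral>\<^sup>+x. ennreal (norm (F x) powr p) \<partial>lborel))"
proof -
  have "(\<integral>\<^sup>+x. ennreal (\<bar>diff_quot F x r y\<bar> powr p) \<partial>lborel) = (\<integral>\<^sup>+x. ennreal (norm (F (x + r *\<^sub>R y) + - F x) powr p) \<partial>lborel)"
    using r by (simp add: diff_quot_def min_absorb2)
  also have "\<dots> \<le> ennreal (2 powr p) * ((\<integral>\<^sup>+x. ennreal (norm (F (x + r *\<^sub>R y)) powr p) \<partial>lborel) + (\<integral>\<^sup>+x. ennreal (norm (- F x) powr p) \<partial>lborel))"
    by (rule nn_integral_add_powr_le[OF _ _ p]) auto
  also have "(\<integral>\<^sup>+x. ennreal (norm (F (x + r *\<^sub>R y)) powr p) \<partial>lborel) = (\<integral>\<^sup>+x. ennreal (norm (F x) powr p) \<partial>lborel)"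
    by (rule nn_integral_translate) simp
  finally show ?thesis by simp
qed

text \<open>If F is not integrable and c is nonzero, both sides are the default 0, since pairing
  with c would give integrability back. Directions can thus be pulled out of inner integrals without
  checking integrability for each jump.\<close>

lemma integral_scaleR_left_unconditional:
  fixes F :: "'z \<Rightarrow> real" and c :: "'b::euclidean_space"
  shows "(\<integral>z. F z *\<^sub>R c \<partial>M) = (\<integral>z. F z \<partial>M) *\<^sub>R c"
proof (cases "integrable M F \<or> c = 0")
  case False
  have "\<not> integrable M (\<lambda>z. F z *\<^sub>R c)"
  proof
    assume "integrable M (\<lambda>z. F z *\<^sub>R c)"
    then have "integrable M (\<lambda>z. (F z *\<^sub>R c) \<bullet> c)" by (rule integrable_inner_left)
    with False show False by simp
  qed
  with False show ?thesis by (simp add: not_integrable_integral_eq)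
qed auto

text \<open>A point z encodes a jump of length \<open>\<rho> z\<close> in the direction
  \<open>\<eta> z\<close>. The estimates see Q only through its total mass and its mass on jumps
  longer than \<delta>, so \<alpha> does not appear in this part.\<close>

locale jump_measure = finite_measure Q for Q :: "'z measure" +
  fixes \<rho> :: "'z \<Rightarrow> real" and \<eta> :: "'z \<Rightarrow> 'a::euclidean_space"
  assumes rho_measurable [measurable]: "\<rho> \<in> borel_measurable Q"
    and eta_measurable [measurable]: "\<eta> \<in> borel_measurable Q"
    and rho_pos: "z \<in> space Q \<Longrightarrow> \<rho> z > 0"
    and norm_eta: "z \<in> space Q \<Longrightarrow> norm (\<eta> z) = 1"
begin

text \<open>For \<open>stable_jumps\<close> this is the fractional gradient: the density contains
  min r 1, which cancels the denominator of \<open>diff_quot\<close>.\<close>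

definition jump_average :: "('a \<Rightarrow> real) \<Rightarrow> 'a \<Rightarrow> 'a" where
  "jump_average F x = (\<integral>z. diff_quot F x (\<rho> z) (\<eta> z) *\<^sub>R \<eta> z \<partial>Q)"

lemma borel_measurable_diff_quot [measurable]:
  assumes [measurable]: "F \<in> borel_measurable borel" "\<theta> \<in> borel_measurable Q"
  shows "(\<lambda>(x, z). diff_quot F x (\<rho> z) (\<theta> z)) \<in> borel_measurable (lborel \<Otimes>\<^sub>M Q)"
  unfolding diff_quot_def by measurable

lemma borel_measurable_jump_average:
  assumes [measurable]: "F \<in> borel_measurable borel"
  shows "jump_average F \<in> borel_measurable borel"
  unfolding jump_average_def diff_quot_def by measurable

lemma powr_average_le:
  assumes [measurable]: "case_prod k \<in> borel_measurable (lborel \<Otimes>\<^sub>M Q)" and p: "p \<ge> 1"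
  shows "(\<integral>\<^sup>+x. ennreal (norm (\<integral>z. k x z *\<^sub>R \<eta> z \<partial>Q) powr p) \<partial>(lborel :: 'a measure)) \<le>
    ennreal (measure Q (space Q) powr (p - 1)) * (\<integral>\<^sup>+z. (\<integral>\<^sup>+x. ennreal (\<bar>k x z\<bar> powr p) \<partial>lborel) \<partial>Q)"
proof -
  interpret pair_sigma_finite "lborel :: 'a measure" Q ..
  have "(\<integral>\<^sup>+x. ennreal (norm (\<integral>z. k x z *\<^sub>R \<eta> z \<partial>Q) powr p) \<partial>lborel) \<le>
    (\<integral>\<^sup>+x. ennreal (measure Q (space Q) powr (p - 1)) * (\<integral>\<^sup>+z. ennreal (\<bar>k x z\<bar> powr p) \<partial>Q) \<partial>lborel)"
  proof (rule nn_integral_mono)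
    fix x :: 'a
    have [measurable]: "(\<lambda>z. k x z) \<in> borel_measurable Q"
      using measurable_compose_Pair1[of x lborel "case_prod k" Q borel] by simp
    have "ennreal (norm (\<integral>z. k x z *\<^sub>R \<eta> z \<partial>Q) powr p) \<le>
      ennreal (measure Q (space Q) powr (p - 1)) * (\<integral>\<^sup>+z. ennreal (norm (k x z *\<^sub>R \<eta> z) powr p) \<partial>Q)"
      by (rule powr_norm_integral_le[OF _ p]) simp
    also have "(\<integral>\<^sup>+z. ennreal (norm (k x z *\<^sub>R \<eta> z) powr p) \<partial>Q) = (\<integral>\<^sup>+z. ennreal (\<bar>k x z\<bar> powr p) \<partial>Q)"
      by (intro nn_integral_cong) (simp add: norm_eta)
    finally show "ennreal (norm (\<integral>z. k x z *\<^sub>R \<eta> z \<partial>Q) powr p) \<le>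
      ennreal (measure Q (space Q) powr (p - 1)) * (\<integral>\<^sup>+z. ennreal (\<bar>k x z\<bar> powr p) \<partial>Q)" .
  qed
  also have "\<dots> = ennreal (measure Q (space Q) powr (p - 1)) * (\<integral>\<^sup>+x. (\<integral>\<^sup>+z. ennreal (\<bar>k x z\<bar> powr p) \<partial>Q) \<partial>lborel)"
    by (rule nn_integral_cmult) measurable
  also have "(\<integral>\<^sup>+x. (\<integral>\<^sup>+z. ennreal (\<bar>k x z\<bar> powr p) \<partial>Q) \<partial>lborel) = (\<integral>\<^sup>+z. (\<integral>\<^sup>+x. ennreal (\<bar>k x z\<bar> powr p) \<partial>lborel) \<partial>Q)"
    by (rule Fubini'[symmetric]) simp
  finally show ?thesis .
qed

context
  fixes f :: "'a \<Rightarrow> real" and g :: "'a \<Rightarrow> 'a" and p :: real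
  assumes f: "f \<in> Lp_space p" and g: "g \<in> Lp_space p" and p: "p \<ge> 1"
    and line: "\<And>u. line_formula f g u"
begin

abbreviation (input) powr_int :: "('a \<Rightarrow> 'b::euclidean_space) \<Rightarrow> ennreal" where
  "powr_int v \<equiv> \<integral>\<^sup>+x. ennreal (norm (v x) powr p) \<partial>lborel"

lemma diff_quot_powr_bound:
  assumes z: "z \<in> space Q"
  shows "(\<integral>\<^sup>+x. ennreal (\<bar>diff_quot f x (\<rho> z) (\<eta> z)\<bar> powr p) \<partial>lborel) \<le>
    powr_int g + ennreal (2 powr p) * (powr_int f + powr_int f)"
proof (cases "\<rho> z \<le> 1")
  note [measurable] = borel_measurable_Lp_space[OF f] borel_measurable_Lp_space[OF g]
  case True
  \<comment> \<open>Choosing G = 0 turns the estimate of the deviation from a linear part into a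
    plain bound by the gradient.\<close>
  have "(\<integral>\<^sup>+x. ennreal (\<bar>diff_quot f x (\<rho> z) (\<eta> z) - \<eta> z \<bullet> 0\<bar> powr p) \<partial>lborel) \<le> powr_int g"
  proof (rule diff_quot_powr_bound_small[OF _ _ g p line rho_pos[OF z] True norm_eta[OF z]])
    fix t
    have "(\<integral>\<^sup>+x. ennreal (norm (g (x + t *\<^sub>R (\<rho> z *\<^sub>R \<eta> z))) powr p) \<partial>lborel) = powr_int g"
      by (rule nn_integral_translate) simp
    then show "(\<integral>\<^sup>+x. ennreal (norm (g (x + t *\<^sub>R (\<rho> z *\<^sub>R \<eta> z)) - 0) powr p) \<partial>lborel) \<le> powr_int g" by simp
  qed auto
  then show ?thesis by (simp add: add_increasing2)
next
  note [measurable] = borel_measurable_Lp_space[OF f] borel_measurable_Lp_space[OF g]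
  case False
  then show ?thesis using diff_quot_powr_bound_large[of f p "\<rho> z"] p by (simp add: add_increasing)
qed

lemma diff_quot_powr_total:
  "(\<integral>\<^sup>+z. (\<integral>\<^sup>+x. ennreal (\<bar>diff_quot f x (\<rho> z) (\<eta> z)\<bar> powr p) \<partial>lborel) \<partial>Q) < \<infinity>"
proof -
  note [measurable] = borel_measurable_Lp_space[OF f] borel_measurable_Lp_space[OF g]
  have "(\<integral>\<^sup>+z. (\<integral>\<^sup>+x. ennreal (\<bar>diff_quot f x (\<rho> z) (\<eta> z)\<bar> powr p) \<partial>lborel) \<partial>Q) \<le>
    (\<integral>\<^sup>+z. powr_int g + ennreal (2 powr p) * (powr_int f + powr_int f) \<partial>Q)"
    by (intro nn_integral_mono diff_quot_powr_bound)
  also have "\<dots> < \<infinity>"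
    using f g emeasure_finite[of "space Q"] by (simp add: Lp_space_iff ennreal_mult_eq_top_iff flip: less_top)
  finally show ?thesis .
qed

lemma jump_average_Lp: "jump_average f \<in> Lp_space p"
proof -
  note [measurable] = borel_measurable_Lp_space[OF f] borel_measurable_Lp_space[OF g]
  have "powr_int (jump_average f) \<le> ennreal (measure Q (space Q) powr (p - 1)) *
      (\<integral>\<^sup>+z. (\<integral>\<^sup>+x. ennreal (\<bar>diff_quot f x (\<rho> z) (\<eta> z)\<bar> powr p) \<partial>lborel) \<partial>Q)"
    unfolding jump_average_def by (rule powr_average_le[OF _ p]) simp
  also have "\<dots> < \<infinity>" using diff_quot_powr_total by (simp add: ennreal_mult_less_top)
  finally show ?thesis by (simp add: Lp_space_iff borel_measurable_jump_average)
qed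

text \<open>Lets the linear part be subtracted under the integral defining
  \<open>jump_average\<close>, which is a genuine integral, not a default value, for almost every
  x.\<close>

lemma AE_integrable_diff_quot:
  "AE x in lborel. integrable Q (\<lambda>z. diff_quot f x (\<rho> z) (\<eta> z) *\<^sub>R \<eta> z)"
proof -
  note [measurable] = borel_measurable_Lp_space[OF f] borel_measurable_Lp_space[OF g]
  interpret pair_sigma_finite "lborel :: 'a measure" Q ..
  have "(\<integral>\<^sup>+x. (\<integral>\<^sup>+z. ennreal (\<bar>diff_quot f x (\<rho> z) (\<eta> z)\<bar> powr p) \<partial>Q) \<partial>lborel) =
     (\<integral>\<^sup>+z. (\<integral>\<^sup>+x. ennreal (\<bar>diff_quot f x (\<rho> z) (\<eta> z)\<bar> powr p) \<partial>lborel) \<partial>Q)"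
    by (rule Fubini'[symmetric]) simp
  with diff_quot_powr_total have "AE x in lborel. (\<integral>\<^sup>+z. ennreal (\<bar>diff_quot f x (\<rho> z) (\<eta> z)\<bar> powr p) \<partial>Q) \<noteq> \<infinity>"
    by (intro nn_integral_PInf_AE) auto
  then show ?thesis
  proof eventually_elim
    case (elim x)
    have "(\<integral>\<^sup>+z. ennreal (norm (diff_quot f x (\<rho> z) (\<eta> z) *\<^sub>R \<eta> z) powr p) \<partial>Q) = (\<integral>\<^sup>+z. ennreal (\<bar>diff_quot f x (\<rho> z) (\<eta> z)\<bar> powr p) \<partial>Q)"
      by (intro nn_integral_cong) (simp add: norm_eta)
    with elim show ?case by (intro integrable_if_powr_finite[OF _ p]) (auto simp flip: less_top)
  qed
qed

text \<open>For one jump, translation by r y turns the backward difference of \<phi> into the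
  forward difference of f; this is \<open>swap\<close>. Integrating over jumps takes Fubini on both
  sides, justified by the line formula of \<phi> on the left and that of f on the right.\<close>

lemma jump_average_duality:
  assumes \<phi>: "\<phi> \<in> Schwartz_space"
  shows "(\<integral>x. f x *\<^sub>R (\<integral>z. diff_quot \<phi> x (\<rho> z) (- \<eta> z) *\<^sub>R \<eta> z \<partial>Q) \<partial>lborel) = (\<integral>x. \<phi> x *\<^sub>R jump_average f x \<partial>lborel)"
proof -
  note [measurable] = borel_measurable_Lp_space[OF f] borel_measurable_Lp_space[OF g]
  interpret pair_sigma_finite "lborel :: 'a measure" Q ..
  note sm = smooth_Schwartz[OF \<phi>]
  note [measurable] = borel_measurable_gradient[OF sm] borel_measurable_iter_partial[OF sm, of "[]", simplified]
  obtain C where C: "C < \<infinity>" "\<And>s. (\<integral>\<^sup>+x. ennreal (\<bar>\<phi> x\<bar> * \<bar>f (x + s)\<bar>) \<partial>lborel) \<le> C"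
     "\<And>s. (\<integral>\<^sup>+x. ennreal (\<bar>f x\<bar> * \<bar>\<phi> (x + s)\<bar>) \<partial>lborel) \<le> C"
     "\<And>s. (\<integral>\<^sup>+x. ennreal (\<bar>f x\<bar> * norm (gradient \<phi> (x + s))) \<partial>lborel) \<le> C"
    by (rule Schwartz_mult_Lp_bound[OF \<phi> f p, unfolded real_norm_def]) (rule that)
  obtain C' where C': "C' < \<infinity>" "\<And>s. (\<integral>\<^sup>+x. ennreal (\<bar>\<phi> x\<bar> * norm (g (x + s))) \<partial>lborel) \<le> C'"
    using Schwartz_mult_Lp_bound[OF \<phi> g p] by metis
  have line\<phi>: "line_formula \<phi> (gradient \<phi>) u" for u
    unfolding line_formula_def using Schwartz_line_formula[OF sm] by simp
  have int1: "integrable (lborel \<Otimes>\<^sub>M Q) (\<lambda>(x, z). f x *\<^sub>R diff_quot \<phi> x (\<rho> z) (- \<eta> z) *\<^sub>R \<eta> z)"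
  proof (rule integrable_pair_lborel[OF finite_measure_axioms, where C = "C + (C + C)"])
    fix z assume z: "z \<in> space Q"
    have "(\<integral>\<^sup>+x. ennreal (\<bar>f x\<bar> * \<bar>diff_quot \<phi> x (\<rho> z) (- \<eta> z)\<bar>) \<partial>lborel) \<le> C + (C + C)"
      by (rule diff_quot_weighted_bound[OF _ _ _ line\<phi> rho_pos[OF z] _ C(4) C(3)]) (auto simp: norm_eta z)
    then show "(\<integral>\<^sup>+x. ennreal (norm (f x *\<^sub>R diff_quot \<phi> x (\<rho> z) (- \<eta> z) *\<^sub>R \<eta> z)) \<partial>lborel) \<le> C + (C + C)"
      by (simp add: norm_eta z abs_mult)
  qed (use C(1) in auto)
  have int2: "integrable (lborel \<Otimes>\<^sub>M Q) (\<lambda>(x, z). \<phi> x *\<^sub>R diff_quot f x (\<rho> z) (\<eta> z) *\<^sub>R \<eta> z)"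
  proof (rule integrable_pair_lborel[OF finite_measure_axioms, where C = "C' + (C + C)"])
    fix z assume z: "z \<in> space Q"
    have "(\<integral>\<^sup>+x. ennreal (\<bar>\<phi> x\<bar> * \<bar>diff_quot f x (\<rho> z) (\<eta> z)\<bar>) \<partial>lborel) \<le> C' + (C + C)"
      by (rule diff_quot_weighted_bound[OF _ _ _ line rho_pos[OF z] norm_eta[OF z] C'(2) C(2)]) auto
    then show "(\<integral>\<^sup>+x. ennreal (norm (\<phi> x *\<^sub>R diff_quot f x (\<rho> z) (\<eta> z) *\<^sub>R \<eta> z)) \<partial>lborel) \<le> C' + (C + C)"
      by (simp add: norm_eta z abs_mult)
  qed (use C(1) C'(1) in auto)
  have swap: "(\<integral>x. f x * diff_quot \<phi> x r (- y) \<partial>lborel) = (\<integral>x. \<phi> x * diff_quot f x r y \<partial>lborel)" for r y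
  proof -
    have tr: "(\<lambda>x. f (x + r *\<^sub>R y)) \<in> Lp_space p"
      using f nn_integral_translate[of "\<lambda>x. ennreal (norm (f x) powr p)" "r *\<^sub>R y"] by (simp add: Lp_space_iff)
    have "(\<integral>x. f x * (\<phi> (x + r *\<^sub>R - y) - \<phi> x) \<partial>lborel) = (\<integral>x. f x * \<phi> (x + r *\<^sub>R - y) \<partial>lborel) - (\<integral>x. f x * \<phi> x \<partial>lborel)"
      using Schwartz_mult_Lp_integrable[OF \<phi> f p, of "r *\<^sub>R - y"] Schwartz_mult_Lp_integrable[OF \<phi> f p, of 0]
      by (simp add: right_diff_distrib)
    also have "(\<integral>x. f x * \<phi> (x + r *\<^sub>R - y) \<partial>lborel) = (\<integral>x. f (x + r *\<^sub>R y) * \<phi> x \<partial>lborel)"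
      using integral_translate[of "\<lambda>x. f x * \<phi> (x + r *\<^sub>R - y)" "r *\<^sub>R y"] by simp
    also have "\<dots> - (\<integral>x. f x * \<phi> x \<partial>lborel) = (\<integral>x. \<phi> x * (f (x + r *\<^sub>R y) - f x) \<partial>lborel)"
      using Schwartz_mult_Lp_integrable[OF \<phi> tr p, of 0] Schwartz_mult_Lp_integrable[OF \<phi> f p, of 0]
      by (simp add: right_diff_distrib mult.commute)
    finally show ?thesis by (simp add: diff_quot_def)
  qed
  have "(\<integral>x. f x *\<^sub>R (\<integral>z. diff_quot \<phi> x (\<rho> z) (- \<eta> z) *\<^sub>R \<eta> z \<partial>Q) \<partial>lborel) =
      (\<integral>x. (\<integral>z. f x *\<^sub>R diff_quot \<phi> x (\<rho> z) (- \<eta> z) *\<^sub>R \<eta> z \<partial>Q) \<partial>lborel)"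
    by (simp only: integral_scaleR_right)
  also have "\<dots> = (\<integral>z. (\<integral>x. f x *\<^sub>R diff_quot \<phi> x (\<rho> z) (- \<eta> z) *\<^sub>R \<eta> z \<partial>lborel) \<partial>Q)"
    by (rule Fubini_integral[OF int1, symmetric])
  also have "\<dots> = (\<integral>z. (\<integral>x. \<phi> x *\<^sub>R diff_quot f x (\<rho> z) (\<eta> z) *\<^sub>R \<eta> z \<partial>lborel) \<partial>Q)"
    by (simp only: scaleR_scaleR real_scaleR_def integral_scaleR_left_unconditional swap)
  also have "\<dots> = (\<integral>x. (\<integral>z. \<phi> x *\<^sub>R diff_quot f x (\<rho> z) (\<eta> z) *\<^sub>R \<eta> z \<partial>Q) \<partial>lborel)"
    by (rule Fubini_integral[OF int2])
  also have "\<dots> = (\<integral>x. \<phi> x *\<^sub>R jump_average f x \<partial>lborel)"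
    by (simp only: integral_scaleR_right jump_average_def)
  finally show ?thesis .
qed

text \<open>The linear part is subtracted only for lengths at most 1, where the quotient has
  denominator r. Jumps up to \<delta> cost at most e each; those between \<delta> and 1 are bounded
  through g, those beyond 1 through f, and both are paid for by the mass of the jumps longer than
  \<delta>.\<close>

lemma jump_average_gradient_bound:
  assumes \<delta>: "0 < \<delta>" "\<delta> < 1"
    and small: "\<And>s. norm s \<le> \<delta> \<Longrightarrow> (\<integral>\<^sup>+x. ennreal (norm (g (x + s) - g x) powr p) \<partial>lborel) \<le> e"
  shows "(\<integral>\<^sup>+x. ennreal (norm (jump_average f x - (\<integral>z. (indicator {..1} (\<rho> z) * (\<eta> z \<bullet> g x)) *\<^sub>R \<eta> z \<partial>Q)) powr p) \<partial>lborel) \<le>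
    ennreal (measure Q (space Q) powr (p - 1)) * (e * emeasure Q (space Q) +
      ennreal (2 powr p) * (powr_int f + powr_int f + (powr_int g + powr_int g)) * emeasure Q {z\<in>space Q. \<rho> z > \<delta>})"
proof -
  note [measurable] = borel_measurable_Lp_space[OF f] borel_measurable_Lp_space[OF g]
  define k where "k x z = diff_quot f x (\<rho> z) (\<eta> z) - indicator {..1} (\<rho> z) * (\<eta> z \<bullet> g x)" for x z
  have [measurable]: "case_prod k \<in> borel_measurable (lborel \<Otimes>\<^sub>M Q)"
    unfolding k_def diff_quot_def by measurable
  let ?B = "ennreal (2 powr p) * (powr_int f + powr_int f + (powr_int g + powr_int g))"
  have g_bound: "(\<integral>\<^sup>+x. ennreal (norm (g (x + s) - g x) powr p) \<partial>lborel) \<le> ennreal (2 powr p) * (powr_int g + powr_int g)" for s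
  proof -
    have "(\<integral>\<^sup>+x. ennreal (norm (g (x + s) + - g x) powr p) \<partial>lborel) \<le>
       ennreal (2 powr p) * ((\<integral>\<^sup>+x. ennreal (norm (g (x + s)) powr p) \<partial>lborel) + (\<integral>\<^sup>+x. ennreal (norm (- g x) powr p) \<partial>lborel))"
      by (rule nn_integral_add_powr_le[OF _ _ p]) auto
    also have "(\<integral>\<^sup>+x. ennreal (norm (g (x + s)) powr p) \<partial>lborel) = powr_int g"
      by (rule nn_integral_translate) simp
    finally show ?thesis by simp
  qed
  have k_bound: "(\<integral>\<^sup>+x. ennreal (\<bar>k x z\<bar> powr p) \<partial>lborel) \<le> e + ?B * indicator {z\<in>space Q. \<rho> z > \<delta>} z" if z: "z \<in> space Q" for z
  proof -
    consider "\<rho> z \<le> \<delta>" | "\<rho> z > \<delta>" "\<rho> z \<le> 1" | "\<rho> z > 1" by linarith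
    then show ?thesis
    proof cases
      case 1
      have "(\<integral>\<^sup>+x. ennreal (\<bar>diff_quot f x (\<rho> z) (\<eta> z) - \<eta> z \<bullet> g x\<bar> powr p) \<partial>lborel) \<le> e"
      proof (rule diff_quot_powr_bound_small[OF _ _ g p line rho_pos[OF z] _ norm_eta[OF z] small])
        fix t :: real assume "t \<in> {0..1}"
        then show "norm (t *\<^sub>R (\<rho> z *\<^sub>R \<eta> z)) \<le> \<delta>"
          using 1 rho_pos[OF z] by (auto simp: norm_eta[OF z] intro: order_trans[OF mult_left_le_one_le])
      qed (use 1 \<delta> in auto)
      then show ?thesis using 1 \<delta> by (simp add: k_def add_increasing2)
    next
      case 2
      have "(\<integral>\<^sup>+x. ennreal (\<bar>diff_quot f x (\<rho> z) (\<eta> z) - \<eta> z \<bullet> g x\<bar> powr p) \<partial>lborel) \<le> ennreal (2 powr p) * (powr_int g + powr_int g)"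
        by (rule diff_quot_powr_bound_small[OF _ _ g p line rho_pos[OF z] 2(2) norm_eta[OF z] g_bound]) auto
      also have "\<dots> \<le> ?B" by (intro mult_left_mono) (auto simp: add_increasing)
      finally show ?thesis using 2 z by (simp add: k_def add_increasing)
    next
      case 3
      have "(\<integral>\<^sup>+x. ennreal (\<bar>diff_quot f x (\<rho> z) (\<eta> z)\<bar> powr p) \<partial>lborel) \<le> ennreal (2 powr p) * (powr_int f + powr_int f)"
        by (rule diff_quot_powr_bound_large[OF _ p 3]) simp
      also have "\<dots> \<le> ?B" by (intro mult_left_mono) (auto simp: add_increasing2)
      finally show ?thesis using 3 \<delta> z by (simp add: k_def add_increasing)
    qed
  qed
  have "AE x in lborel. jump_average f x - (\<integral>z. (indicator {..1} (\<rho> z) * (\<eta> z \<bullet> g x)) *\<^sub>R \<eta> z \<partial>Q) = (\<integral>z. k x z *\<^sub>R \<eta> z \<partial>Q)"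
    using AE_integrable_diff_quot
  proof eventually_elim
    case (elim x)
    have "integrable Q (\<lambda>z. (indicator {..1} (\<rho> z) * (\<eta> z \<bullet> g x)) *\<^sub>R \<eta> z)"
    proof (rule integrable_const_bound)
      show "AE z in Q. norm ((indicator {..1} (\<rho> z) * (\<eta> z \<bullet> g x)) *\<^sub>R \<eta> z) \<le> norm (g x)"
      proof (rule AE_I2)
        fix z assume z: "z \<in> space Q"
        show "norm ((indicator {..1} (\<rho> z) * (\<eta> z \<bullet> g x)) *\<^sub>R \<eta> z) \<le> norm (g x)"
          using Cauchy_Schwarz_ineq2[of "\<eta> z" "g x"] by (auto simp: norm_eta[OF z] indicator_def)
      qed
    qed simp
    with elim show ?case by (simp add: jump_average_def k_def scaleR_diff_left)
  qed
  then have "(\<integral>\<^sup>+x. ennreal (norm (jump_average f x - (\<integral>z. (indicator {..1} (\<rho> z) * (\<eta> z \<bullet> g x)) *\<^sub>R \<eta> z \<partial>Q)) powr p) \<partial>lborel) =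
     (\<integral>\<^sup>+x. ennreal (norm (\<integral>z. k x z *\<^sub>R \<eta> z \<partial>Q) powr p) \<partial>lborel)"
    by (intro nn_integral_cong_AE) (auto elim: eventually_mono)
  also have "\<dots> \<le> ennreal (measure Q (space Q) powr (p - 1)) * (\<integral>\<^sup>+z. (\<integral>\<^sup>+x. ennreal (\<bar>k x z\<bar> powr p) \<partial>lborel) \<partial>Q)"
    by (rule powr_average_le[OF _ p]) simp
  also have "(\<integral>\<^sup>+z. (\<integral>\<^sup>+x. ennreal (\<bar>k x z\<bar> powr p) \<partial>lborel) \<partial>Q) \<le> (\<integral>\<^sup>+z. e + ?B * indicator {z\<in>space Q. \<rho> z > \<delta>} z \<partial>Q)"
    by (intro nn_integral_mono k_bound)
  also have "\<dots> = e * emeasure Q (space Q) + ?B * emeasure Q {z\<in>space Q. \<rho> z > \<delta>}"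
    by (subst nn_integral_add) (auto simp: nn_integral_cmult)
  finally show ?thesis by (simp add: mult_left_mono)
qed

end

end

subsection \<open>The jump measure of a stable law\<close>

abbreviation (input) radial :: "real measure" where
  "radial \<equiv> restrict_space lborel {0<..}"

text \<open>The polar density r^(-\<alpha>-1) of the Levy measure, times r from the vector u = r y,
  times the denominator min r 1 of \<open>diff_quot\<close>. Near 0 it is r^(1-\<alpha>), integrable
  for \<alpha> < 2; at infinity it is r^-\<alpha>, integrable for \<alpha> > 1.\<close>

definition stable_jumps :: "real \<Rightarrow> 'a::euclidean_space measure \<Rightarrow> ('a \<times> real) measure" where
  "stable_jumps \<alpha> \<sigma> = density (\<sigma> \<Otimes>\<^sub>M radial) (\<lambda>(y, r). ennreal (min r 1 * r powr - \<alpha>))"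

section \<open>Radial integrals\<close>

lemma has_integral_indicator:
  fixes f :: "real \<Rightarrow> real"
  shows "((\<lambda>x. indicator S x * f x) has_integral i) UNIV \<longleftrightarrow> (f has_integral i) S"
proof -
  have "(\<lambda>x. indicator S x * f x) = (\<lambda>x. if x \<in> S then f x else 0)" by auto
  then show ?thesis by (simp only: has_integral_restrict_UNIV)
qed

lemma id_radial [measurable]: "(\<lambda>r. r) \<in> borel_measurable radial"
  by (rule measurable_restrict_space1) simp

lemma space_radial: "space radial = {0<..}"
  by (simp add: space_restrict_space)

lemma sigma_finite_radial: "sigma_finite_measure radial"
  by (rule sigma_finite_measure_restrict_space) (auto intro: lborel.sigma_finite_measure_axioms)

lemma nn_integral_radial_le_1:
  assumes "\<alpha> < 2"
  shows "(\<integral>\<^sup>+r. ennreal (min r 1 * r powr - \<alpha>) * indicator {..1} r \<partial>radial) = ennreal (1 / (2 - \<alpha>))"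
proof -
  have "(\<integral>\<^sup>+r. ennreal (min r 1 * r powr - \<alpha>) * indicator {..1} r \<partial>radial) =
     (\<integral>\<^sup>+r. ennreal (indicator {0..1} r * r powr (1 - \<alpha>)) \<partial>lborel)"
    by (subst nn_integral_restrict_space)
       (auto intro!: nn_integral_cong simp: indicator_def powr_diff powr_minus field_simps)
  also have "\<dots> = ennreal (1 / (2 - \<alpha>))"
    using has_integral_powr_from_0[of "1 - \<alpha>" 1] assms
    by (intro nn_integral_has_integral_lborel) (auto simp: has_integral_indicator algebra_simps)
  finally show ?thesis .
qed

lemma nn_integral_radial_gt_1:
  assumes "1 < \<alpha>"
  shows "(\<integral>\<^sup>+r. ennreal (min r 1 * r powr - \<alpha>) * indicator {1<..} r \<partial>radial) \<le> ennreal (1 / (\<alpha> - 1))"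
proof -
  have "(\<integral>\<^sup>+r. ennreal (min r 1 * r powr - \<alpha>) * indicator {1<..} r \<partial>radial) \<le>
     (\<integral>\<^sup>+r. ennreal (indicator {1..} r * r powr - \<alpha>) \<partial>lborel)"
    by (subst nn_integral_restrict_space) (auto intro!: nn_integral_mono simp: indicator_def)
  also have "\<dots> = ennreal (- (1 powr (- \<alpha> + 1)) / (- \<alpha> + 1))"
    using has_integral_powr_to_inf[of "- \<alpha>" 1] assms
    by (intro nn_integral_has_integral_lborel) (auto simp: has_integral_indicator)
  also have "- (1 powr (- \<alpha> + 1)) / (- \<alpha> + 1) = 1 / (\<alpha> - 1)"
    using assms by (simp add: field_simps)
  finally show ?thesis .
qed

text \<open>For \<delta> < r \<le> 1 and \<alpha> < 2 one has r^(1-\<alpha>) \<le> 1/r \<le>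
  1/\<delta>. The bound does not blow up as \<alpha> tends to 2, so the factor 2 - \<alpha> removes
  these jumps in the limit.\<close>

lemma nn_integral_radial_gt:
  assumes "1 < \<alpha>" "\<alpha> < 2" "0 < \<delta>" "\<delta> < 1"
  shows "(\<integral>\<^sup>+r. ennreal (min r 1 * r powr - \<alpha>) * indicator {\<delta><..} r \<partial>radial) \<le> ennreal (1 / \<delta> + 1 / (\<alpha> - 1))"
proof -
  have le: "ennreal (min r 1 * r powr - \<alpha>) * indicator {\<delta><..} r \<le>
      ennreal (1 / \<delta>) * indicator {0..1} r + ennreal (min r 1 * r powr - \<alpha>) * indicator {1<..} r" for r
  proof -
    have "r * r powr - \<alpha> \<le> 1 / \<delta>" if r: "\<delta> < r" "r \<le> 1"
    proof -
      have "r * r powr - \<alpha> = r powr (1 - \<alpha>)" using r assms by (simp add: powr_diff powr_minus field_simps)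
      also have "\<dots> \<le> r powr (- 1)" using r assms by (intro powr_mono') auto
      also have "\<dots> = 1 / r" using r assms by (simp add: powr_minus field_simps)
      also have "\<dots> \<le> 1 / \<delta>" using r assms by (intro divide_left_mono) auto
      finally show ?thesis .
    qed
    then show ?thesis using assms by (auto simp: indicator_def intro!: ennreal_leI)
  qed
  have "(\<integral>\<^sup>+r. ennreal (min r 1 * r powr - \<alpha>) * indicator {\<delta><..} r \<partial>radial) \<le>
     (\<integral>\<^sup>+r. ennreal (1 / \<delta>) * indicator {0..1} r + ennreal (min r 1 * r powr - \<alpha>) * indicator {1<..} r \<partial>radial)"
    by (intro nn_integral_mono le)
  also have "\<dots> = ennreal (1 / \<delta>) * (\<integral>\<^sup>+r. indicator {0..1} r \<partial>radial) +
     (\<integral>\<^sup>+r. ennreal (min r 1 * r powr - \<alpha>) * indicator {1<..} r \<partial>radial)"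
    by (subst nn_integral_add) (auto simp: nn_integral_cmult)
  also have "(\<integral>\<^sup>+r. indicator {0..1} r \<partial>radial) \<le> (\<integral>\<^sup>+r. indicator {0..1::real} r \<partial>lborel)"
    by (subst nn_integral_restrict_space) (simp, rule nn_integral_mono, auto simp: indicator_def)
  also have "(\<integral>\<^sup>+r. indicator {0..1::real} r \<partial>lborel) = 1" by simp
  also have "(\<integral>\<^sup>+r. ennreal (min r 1 * r powr - \<alpha>) * indicator {1<..} r \<partial>radial) \<le> ennreal (1 / (\<alpha> - 1))"
    by (rule nn_integral_radial_gt_1) fact
  also have "ennreal (1 / \<delta>) * 1 + ennreal (1 / (\<alpha> - 1)) = ennreal (1 / \<delta> + 1 / (\<alpha> - 1))"
    using assms by simp
  finally show ?thesis by (simp add: add_mono mult_left_mono)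
qed

context
  fixes \<sigma> :: "'a::euclidean_space measure"
  assumes \<sigma>: "spherical_component \<sigma>"
begin

lemma sets_spherical: "sets \<sigma> = sets (restrict_space borel (sphere 0 1))"
  using \<sigma> by (simp add: spherical_component_def)

lemma space_spherical: "space \<sigma> = sphere 0 1"
  using sets_eq_imp_space_eq[OF sets_spherical] by (simp add: space_restrict_space)

lemma finite_spherical: "finite_measure \<sigma>"
  using \<sigma> by (simp add: spherical_component_def)

lemma id_spherical: "(\<lambda>y. y) \<in> borel_measurable \<sigma>"
  using measurable_ident[of "borel :: 'a measure"] unfolding id_def
  by (subst measurable_cong_sets[OF sets_spherical refl]) (rule measurable_restrict_space1)

lemma fst_spherical [measurable]: "fst \<in> borel_measurable (\<sigma> \<Otimes>\<^sub>M N)"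
  by (rule measurable_compose[OF measurable_fst id_spherical])

lemma space_stable_jumps: "space (stable_jumps \<alpha> \<sigma>) = sphere 0 1 \<times> {0<..}"
  by (simp add: stable_jumps_def space_pair_measure space_spherical space_radial)

lemma sets_stable_jumps [measurable_cong]: "sets (stable_jumps \<alpha> \<sigma>) = sets (\<sigma> \<Otimes>\<^sub>M radial)"
  by (simp add: stable_jumps_def)

lemma emeasure_stable_jumps:
  assumes [measurable]: "A \<in> sets borel"
  shows "emeasure (stable_jumps \<alpha> \<sigma>) {z \<in> space (stable_jumps \<alpha> \<sigma>). snd z \<in> A} =
    (\<integral>\<^sup>+r. ennreal (min r 1 * r powr - \<alpha>) * indicator A r \<partial>radial) * emeasure \<sigma> (space \<sigma>)"
proof -
  interpret radial: sigma_finite_measure radial by (rule sigma_finite_radial)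
  interpret \<sigma>: finite_measure \<sigma> by (rule finite_spherical)
  have [measurable]: "{z \<in> space (\<sigma> \<Otimes>\<^sub>M radial). snd z \<in> A} \<in> sets (\<sigma> \<Otimes>\<^sub>M radial)" by measurable
  have "emeasure (stable_jumps \<alpha> \<sigma>) {z \<in> space (stable_jumps \<alpha> \<sigma>). snd z \<in> A} =
      (\<integral>\<^sup>+z. (\<lambda>(y, r). ennreal (min r 1 * r powr - \<alpha>)) z * indicator {z \<in> space (\<sigma> \<Otimes>\<^sub>M radial). snd z \<in> A} z \<partial>(\<sigma> \<Otimes>\<^sub>M radial))"
    unfolding stable_jumps_def space_density by (rule emeasure_density) measurable
  also have "\<dots> = (\<integral>\<^sup>+z. (\<lambda>(y, r). ennreal (min r 1 * r powr - \<alpha>) * indicator A r) z \<partial>(\<sigma> \<Otimes>\<^sub>M radial))"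
    by (intro nn_integral_cong) (auto simp: indicator_def split: prod.splits)
  also have "\<dots> = (\<integral>\<^sup>+y. (\<integral>\<^sup>+r. ennreal (min r 1 * r powr - \<alpha>) * indicator A r \<partial>radial) \<partial>\<sigma>)"
    by (subst radial.nn_integral_fst[symmetric]) (auto simp: split_beta')
  finally show ?thesis by simp
qed

lemma emeasure_stable_jumps_space_le:
  assumes "1 < \<alpha>" "\<alpha> < 2"
  shows "emeasure (stable_jumps \<alpha> \<sigma>) (space (stable_jumps \<alpha> \<sigma>)) \<le>
    ennreal ((1 / (2 - \<alpha>) + 1 / (\<alpha> - 1)) * measure \<sigma> (space \<sigma>))"
proof -
  interpret \<sigma>: finite_measure \<sigma> by (rule finite_spherical)
  have "(\<integral>\<^sup>+r. ennreal (min r 1 * r powr - \<alpha>) * indicator UNIV r \<partial>radial) =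
     (\<integral>\<^sup>+r. ennreal (min r 1 * r powr - \<alpha>) * indicator {..1} r + ennreal (min r 1 * r powr - \<alpha>) * indicator {1<..} r \<partial>radial)"
    by (intro nn_integral_cong) (auto simp: indicator_def)
  also have "\<dots> = (\<integral>\<^sup>+r. ennreal (min r 1 * r powr - \<alpha>) * indicator {..1} r \<partial>radial) + (\<integral>\<^sup>+r. ennreal (min r 1 * r powr - \<alpha>) * indicator {1<..} r \<partial>radial)"
    by (rule nn_integral_add) auto
  also have "\<dots> \<le> ennreal (1 / (2 - \<alpha>)) + ennreal (1 / (\<alpha> - 1))"
    using assms by (intro add_mono nn_integral_radial_gt_1) (auto simp: nn_integral_radial_le_1)
  also have "\<dots> = ennreal (1 / (2 - \<alpha>) + 1 / (\<alpha> - 1))" using assms by simp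
  finally show ?thesis
    using emeasure_stable_jumps[of UNIV \<alpha>] assms
    by (simp add: \<sigma>.emeasure_eq_measure ennreal_mult mult_right_mono)
qed

lemma emeasure_stable_jumps_gt_le:
  assumes "1 < \<alpha>" "\<alpha> < 2" "0 < \<delta>" "\<delta> < 1"
  shows "emeasure (stable_jumps \<alpha> \<sigma>) {z \<in> space (stable_jumps \<alpha> \<sigma>). snd z > \<delta>} \<le>
    ennreal ((1 / \<delta> + 1 / (\<alpha> - 1)) * measure \<sigma> (space \<sigma>))"
proof -
  interpret \<sigma>: finite_measure \<sigma> by (rule finite_spherical)
  have "emeasure (stable_jumps \<alpha> \<sigma>) {z \<in> space (stable_jumps \<alpha> \<sigma>). snd z > \<delta>} \<le>
     ennreal (1 / \<delta> + 1 / (\<alpha> - 1)) * emeasure \<sigma> (space \<sigma>)"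
    using emeasure_stable_jumps[of "{\<delta><..}" \<alpha>] nn_integral_radial_gt[OF assms] by (simp add: mult_right_mono)
  then show ?thesis using assms by (simp add: \<sigma>.emeasure_eq_measure ennreal_mult)
qed

lemma jump_measure_stable_jumps:
  assumes "1 < \<alpha>" "\<alpha> < 2"
  shows "jump_measure (stable_jumps \<alpha> \<sigma>) snd fst"
proof (intro jump_measure.intro jump_measure_axioms.intro)
  show "finite_measure (stable_jumps \<alpha> \<sigma>)"
    using emeasure_stable_jumps_space_le[OF assms] by (intro finite_measureI) (auto simp: top_unique)
qed (auto simp: space_stable_jumps)

text \<open>The definition gives only values on sets; as the image of a density under polar
  coordinates, the Levy measure admits change of variables in Bochner integrals.\<close>

lemma levy_measure_eq_distr:
  "levy_measure \<alpha> \<sigma> = distr (density (\<sigma> \<Otimes>\<^sub>M radial) (\<lambda>(y, r). ennreal (1 / r powr (\<alpha> + 1)))) borel (\<lambda>(y, r). r *\<^sub>R y)"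
    (is "_ = distr ?K _ _")
proof (rule measure_eqI)
  interpret radial: sigma_finite_measure radial by (rule sigma_finite_radial)
  show "sets (levy_measure \<alpha> \<sigma>) = sets (distr ?K borel (\<lambda>(y, r). r *\<^sub>R y))"
    by (simp add: sets_levy_measure[OF \<sigma>])
  fix B assume "B \<in> sets (levy_measure \<alpha> \<sigma>)"
  then have [measurable]: "B \<in> sets borel" by (simp add: sets_levy_measure[OF \<sigma>])
  have "emeasure (distr ?K borel (\<lambda>(y, r). r *\<^sub>R y)) B = (\<integral>\<^sup>+u. indicator B u \<partial>distr ?K borel (\<lambda>(y, r). r *\<^sub>R y))"
    by simp
  also have "\<dots> = (\<integral>\<^sup>+z. indicator B ((\<lambda>(y, r). r *\<^sub>R y) z) \<partial>?K)"
    by (rule nn_integral_distr) (auto simp: split_beta')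
  also have "\<dots> = (\<integral>\<^sup>+z. (\<lambda>(y, r). ennreal (1 / r powr (\<alpha> + 1))) z * indicator B ((\<lambda>(y, r). r *\<^sub>R y) z) \<partial>(\<sigma> \<Otimes>\<^sub>M radial))"
    by (rule nn_integral_density) (auto simp: split_beta')
  also have "\<dots> = (\<integral>\<^sup>+y. (\<integral>\<^sup>+r. ennreal (1 / r powr (\<alpha> + 1)) * indicator B (r *\<^sub>R y) \<partial>radial) \<partial>\<sigma>)"
    by (subst radial.nn_integral_fst[symmetric]) (auto simp: split_beta')
  also have "\<dots> = (\<integral>\<^sup>+y. (\<integral>\<^sup>+r\<in>{0<..}. indicator B (r *\<^sub>R y) * ennreal (1 / r powr (\<alpha> + 1)) \<partial>lborel) \<partial>\<sigma>)"
    by (simp add: nn_integral_restrict_space mult.commute)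
  finally show "emeasure (levy_measure \<alpha> \<sigma>) B = emeasure (distr ?K borel (\<lambda>(y, r). r *\<^sub>R y)) B"
    by (simp add: emeasure_levy_measure[OF \<sigma>])
qed

text \<open>The integrands agree pointwise after the change of variables, so the equality also
  covers integrals with the default value 0. The direction \<open>- fst z\<close> reflects the
  argument x - u of the adjoint.\<close>

lemma frac_gradient_adj_eq:
  assumes [measurable]: "\<phi> \<in> borel_measurable borel"
  shows "frac_gradient_adj \<sigma> \<alpha> \<phi> x = (\<integral>z. diff_quot \<phi> x (snd z) (- fst z) *\<^sub>R fst z \<partial>stable_jumps \<alpha> \<sigma>)"
proof -
  let ?K = "density (\<sigma> \<Otimes>\<^sub>M radial) (\<lambda>(y, r). ennreal (1 / r powr (\<alpha> + 1)))"
  have "frac_gradient_adj \<sigma> \<alpha> \<phi> x = (\<integral>z. (\<phi> (x - snd z *\<^sub>R fst z) - \<phi> x) *\<^sub>R (snd z *\<^sub>R fst z) \<partial>?K)"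
    unfolding frac_gradient_adj_def levy_measure_eq_distr by (subst integral_distr) (auto simp: split_beta')
  also have "\<dots> = (\<integral>z. (1 / snd z powr (\<alpha> + 1)) *\<^sub>R (\<phi> (x - snd z *\<^sub>R fst z) - \<phi> x) *\<^sub>R (snd z *\<^sub>R fst z) \<partial>(\<sigma> \<Otimes>\<^sub>M radial))"
    unfolding split_beta' by (rule integral_density) auto
  also have "\<dots> = (\<integral>z. (min (snd z) 1 * snd z powr - \<alpha>) *\<^sub>R diff_quot \<phi> x (snd z) (- fst z) *\<^sub>R fst z \<partial>(\<sigma> \<Otimes>\<^sub>M radial))"
  proof (rule Bochner_Integration.integral_cong[OF refl])
    fix z assume "z \<in> space (\<sigma> \<Otimes>\<^sub>M radial)"
    then have r: "snd z > 0" by (auto simp: space_pair_measure space_radial)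
    have 1: "1 / snd z powr (\<alpha> + 1) * snd z = snd z powr - \<alpha>"
      using r by (simp add: powr_add powr_minus field_simps)
    have 2: "min (snd z) 1 * snd z powr - \<alpha> * diff_quot \<phi> x (snd z) (- fst z) = snd z powr - \<alpha> * (\<phi> (x - snd z *\<^sub>R fst z) - \<phi> x)"
      using r by (auto simp: diff_quot_def min_def)
    have "1 / snd z powr (\<alpha> + 1) * ((\<phi> (x - snd z *\<^sub>R fst z) - \<phi> x) * snd z) =
        (1 / snd z powr (\<alpha> + 1) * snd z) * (\<phi> (x - snd z *\<^sub>R fst z) - \<phi> x)"
      by (simp only: mult_ac)
    also have "\<dots> = min (snd z) 1 * snd z powr - \<alpha> * diff_quot \<phi> x (snd z) (- fst z)"
      by (simp only: 1 2)
    finally show "(1 / snd z powr (\<alpha> + 1)) *\<^sub>R (\<phi> (x - snd z *\<^sub>R fst z) - \<phi> x) *\<^sub>R (snd z *\<^sub>R fst z) =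
      (min (snd z) 1 * snd z powr - \<alpha>) *\<^sub>R diff_quot \<phi> x (snd z) (- fst z) *\<^sub>R fst z"
      by (simp only: scaleR_scaleR)
  qed
  also have "\<dots> = (\<integral>z. diff_quot \<phi> x (snd z) (- fst z) *\<^sub>R fst z \<partial>stable_jumps \<alpha> \<sigma>)"
    unfolding stable_jumps_def split_beta'
    by (rule integral_density[symmetric]) (auto simp: diff_quot_def space_pair_measure space_radial intro!: AE_I2)
  finally show ?thesis .
qed

text \<open>The cutoff integrand depends on r only through the indicator of r \<le> 1, so Fubini
  splits off the integral of r^(1-\<alpha>) over (0, 1], which is 1/(2 - \<alpha>). The limit thus
  becomes an average over the same jumps for every \<alpha>, and no convergence of measures has to
  be proved.\<close>

lemma aniso_gradient_eq:
  assumes "1 < \<alpha>" "\<alpha> < 2"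
  shows "aniso_gradient \<sigma> g x = (2 - \<alpha>) *\<^sub>R (\<integral>z. (indicator {..1} (snd z) * (fst z \<bullet> g x)) *\<^sub>R fst z \<partial>stable_jumps \<alpha> \<sigma>)"
proof -
  interpret jump_measure "stable_jumps \<alpha> \<sigma>" snd fst by (rule jump_measure_stable_jumps) fact+
  interpret radial: sigma_finite_measure radial by (rule sigma_finite_radial)
  interpret \<sigma>: finite_measure \<sigma> by (rule finite_spherical)
  interpret pair_sigma_finite \<sigma> radial ..
  let ?q = "\<lambda>r. min r 1 * r powr - \<alpha>"
  let ?F = "\<lambda>z. (indicator {..1} (snd z) * (fst z \<bullet> g x)) *\<^sub>R fst z"
  have "integrable (stable_jumps \<alpha> \<sigma>) ?F"
  proof (rule integrable_const_bound)
    show "AE z in stable_jumps \<alpha> \<sigma>. norm (?F z) \<le> norm (g x)"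
    proof (rule AE_I2)
      fix z assume z: "z \<in> space (stable_jumps \<alpha> \<sigma>)"
      show "norm (?F z) \<le> norm (g x)"
        using Cauchy_Schwarz_ineq2[of "fst z" "g x"] by (auto simp: norm_eta[OF z] indicator_def)
    qed
  qed simp
  then have int: "integrable (\<sigma> \<Otimes>\<^sub>M radial) (\<lambda>z. ?q (snd z) *\<^sub>R ?F z)"
    unfolding stable_jumps_def split_beta'
    by (subst (asm) integrable_density) (auto simp: space_pair_measure space_radial intro!: AE_I2)
  have q: "(\<integral>r. ?q r * indicator {..1} r \<partial>radial) = 1 / (2 - \<alpha>)"
  proof -
    have "(\<integral>r. ?q r * indicator {..1} r \<partial>radial) = enn2real (\<integral>\<^sup>+r. ennreal (?q r * indicator {..1} r) \<partial>radial)"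
      by (rule integral_eq_nn_integral) (auto simp: space_radial intro!: AE_I2)
    also have "(\<integral>\<^sup>+r. ennreal (?q r * indicator {..1} r) \<partial>radial) = (\<integral>\<^sup>+r. ennreal (?q r) * indicator {..1} r \<partial>radial)"
      by (intro nn_integral_cong) (auto simp: indicator_def)
    finally show ?thesis using assms by (simp add: nn_integral_radial_le_1)
  qed
  have "(\<integral>z. ?F z \<partial>stable_jumps \<alpha> \<sigma>) = (\<integral>z. ?q (snd z) *\<^sub>R ?F z \<partial>(\<sigma> \<Otimes>\<^sub>M radial))"
    unfolding stable_jumps_def split_beta'
    by (rule integral_density) (auto simp: space_pair_measure space_radial intro!: AE_I2)
  also have "\<dots> = (\<integral>y. (\<integral>r. ?q r *\<^sub>R ?F (y, r) \<partial>radial) \<partial>\<sigma>)"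
    using integral_fst'[OF int] by simp
  also have "\<dots> = (\<integral>y. (\<integral>r. (?q r * indicator {..1} r) *\<^sub>R ((y \<bullet> g x) *\<^sub>R y) \<partial>radial) \<partial>\<sigma>)"
    by (simp add: mult.assoc)
  also have "\<dots> = (\<integral>y. (1 / (2 - \<alpha>)) *\<^sub>R ((y \<bullet> g x) *\<^sub>R y) \<partial>\<sigma>)"
    by (intro Bochner_Integration.integral_cong refl) (simp only: integral_scaleR_left_unconditional q)
  also have "\<dots> = (1 / (2 - \<alpha>)) *\<^sub>R aniso_gradient \<sigma> g x"
    by (simp only: integral_scaleR_right aniso_gradient_def)
  finally show ?thesis using assms by simp
qed

end

subsection \<open>The local limit\<close>

text \<open>The theorem allows any representative of the fractional gradient; this replaces it by
  the jump average, almost everywhere.\<close>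

lemma distribution_is_Lp_unique:
  assumes h: "distribution_is_Lp p T h" and h': "distribution_is_Lp p T h'" and p: "p \<ge> 1"
  shows "AE x in lborel. h x = h' x"
proof -
  have Lp: "h \<in> Lp_space p" "h' \<in> Lp_space p" using h h' by (auto simp: distribution_is_Lp_def)
  note [measurable] = Lp[THEN borel_measurable_Lp_space]
  have li: "locally_integrable (\<lambda>x. (h x - h' x) \<bullet> b)" for b
  proof -
    have "set_integrable lborel K (\<lambda>x. h x - h' x)" if "compact K" for K
      using locally_integrable_Lp[OF Lp(1) p] locally_integrable_Lp[OF Lp(2) p] that unfolding locally_integrable_def by (blast intro: set_integral_diff)
    then show ?thesis
      unfolding locally_integrable_def set_integrable_def by (auto simp flip: inner_scaleR_left)
  qed
  have "AE x in lborel. (h x - h' x) \<bullet> b = 0" for b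
  proof (rule fundamental_lemma_calculus_of_variations[OF li])
    fix \<phi> :: "'a \<Rightarrow> real" assume "\<phi> \<in> test_functions"
    then have \<phi>: "\<phi> \<in> Schwartz_space" using test_functions_subset_Schwartz_space by blast
    note [measurable] = borel_measurable_iter_partial[OF smooth_Schwartz[OF \<phi>], of "[]", simplified]
    have int: "integrable lborel (\<lambda>x. \<phi> x *\<^sub>R v x)" if v: "v \<in> Lp_space p" for v :: "'a \<Rightarrow> 'a"
    proof (rule integrableI_bounded)
      obtain C where "C < \<infinity>" "\<And>s. (\<integral>\<^sup>+x. ennreal (\<bar>\<phi> x\<bar> * norm (v (x + s))) \<partial>lborel) \<le> C"
        by (rule Schwartz_mult_Lp_bound[OF \<phi> v p]) (rule that)
      from this(1) this(2)[of 0] show "(\<integral>\<^sup>+x. ennreal (norm (\<phi> x *\<^sub>R v x)) \<partial>lborel) < \<infinity>"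
        by (auto intro: le_less_trans)
      show "(\<lambda>x. \<phi> x *\<^sub>R v x) \<in> borel_measurable lborel"
        using borel_measurable_Lp_space[OF v] by measurable
    qed
    have "(\<integral>x. \<phi> x *\<^sub>R h x \<partial>lborel) = (\<integral>x. \<phi> x *\<^sub>R h' x \<partial>lborel)"
      using h h' \<phi> unfolding distribution_is_Lp_def by metis
    then have "(\<integral>x. \<phi> x *\<^sub>R h x - \<phi> x *\<^sub>R h' x \<partial>lborel) = 0"
      using int[OF Lp(1)] int[OF Lp(2)] by simp
    moreover have "(\<integral>x. (\<phi> x *\<^sub>R h x - \<phi> x *\<^sub>R h' x) \<bullet> b \<partial>lborel) = (\<integral>x. \<phi> x *\<^sub>R h x - \<phi> x *\<^sub>R h' x \<partial>lborel) \<bullet> b"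
      using int[OF Lp(1)] int[OF Lp(2)] by (intro integral_inner_left) auto
    ultimately show "(\<integral>x. (h x - h' x) \<bullet> b * \<phi> x \<partial>lborel) = 0"
      by (simp add: inner_diff_left algebra_simps)
  qed
  then have "AE x in lborel. \<forall>b\<in>Basis. (h x - h' x) \<bullet> b = 0"
    by (subst AE_finite_all) auto
  then show ?thesis
    by eventually_elim (rule euclidean_eqI, simp add: inner_diff_left)
qed

section \<open>From p-th powers back to norms\<close>

lemma Lp_norm_le:
  assumes "(\<integral>\<^sup>+x. ennreal (norm (F x) powr p) \<partial>lborel) \<le> ennreal e" "0 \<le> e" "p > 0"
  shows "Lp_norm p F \<le> ennreal (e powr (1 / p))"
proof -
  have "(\<integral>\<^sup>+x. ennreal (norm (F x) powr p) \<partial>lborel) \<noteq> \<top>" using assms(1) by (auto simp: top_unique)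
  moreover have "enn2real (\<integral>\<^sup>+x. ennreal (norm (F x) powr p) \<partial>lborel) \<le> e"
    using enn2real_mono[OF assms(1)] assms(2) by simp
  ultimately show ?thesis
    using assms by (auto simp: Lp_norm_def Let_def intro!: ennreal_leI powr_mono2)
qed

lemma Lp_norm_tendsto_0:
  assumes p: "p > 0"
    and small: "\<And>e::real. e > 0 \<Longrightarrow> \<forall>\<^sub>F t in L. (\<integral>\<^sup>+x. ennreal (norm (F t x) powr p) \<partial>lborel) \<le> ennreal e"
  shows "((\<lambda>t. Lp_norm p (F t)) \<longlongrightarrow> 0) L"
proof (rule order_tendstoI)
  fix a :: ennreal assume "0 < a"
  then obtain d' where d': "0 < d'" "d' < a" using dense by blast
  then obtain d :: real where "d' = ennreal d" "d \<ge> 0" by (cases d') auto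
  with d' have d: "d > 0" "ennreal d < a" by auto
  have "\<forall>\<^sub>F t in L. (\<integral>\<^sup>+x. ennreal (norm (F t x) powr p) \<partial>lborel) \<le> ennreal (d powr p)"
    using d by (intro small) simp
  then show "\<forall>\<^sub>F t in L. Lp_norm p (F t) < a"
  proof eventually_elim
    case (elim t)
    have "Lp_norm p (F t) \<le> ennreal ((d powr p) powr (1 / p))" by (rule Lp_norm_le[OF elim]) (use p in auto)
    also have "(d powr p) powr (1 / p) = d" using p d by (simp add: powr_powr)
    finally show ?case using d by simp
  qed
qed simp

lemma distribution_is_Lp_jump_average:
  assumes \<sigma>: "spherical_component \<sigma>" and \<alpha>: "1 < \<alpha>" "\<alpha> < 2" and p: "p \<ge> 1"
    and f: "f \<in> Lp_space p" and g: "g \<in> Lp_space p" and wg: "has_weak_gradient f g"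
  shows "distribution_is_Lp p (frac_gradient \<sigma> \<alpha> f) (jump_measure.jump_average (stable_jumps \<alpha> \<sigma>) snd fst f)"
proof -
  interpret jump_measure "stable_jumps \<alpha> \<sigma>" snd fst by (rule jump_measure_stable_jumps[OF \<sigma> \<alpha>])
  note line = Sobolev1_line_formula[OF f g p wg]
  show ?thesis
    unfolding distribution_is_Lp_def
  proof (intro conjI ballI)
    show "jump_average f \<in> Lp_space p" by (rule jump_average_Lp[OF f g p line])
    fix \<phi> :: "'a \<Rightarrow> real" assume \<phi>: "\<phi> \<in> Schwartz_space"
    have "\<phi> \<in> borel_measurable borel" using borel_measurable_iter_partial[OF smooth_Schwartz[OF \<phi>], of "[]"] by simp
    then show "frac_gradient \<sigma> \<alpha> f \<phi> = (\<integral>x. \<phi> x *\<^sub>R jump_average f x \<partial>lborel)"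
      using jump_average_duality[OF f g p line \<phi>] by (simp add: frac_gradient_def frac_gradient_adj_eq[OF \<sigma>])
  qed
qed

text \<open>With c = 2 - \<alpha>, m the mass of the jump measure and q a bound for its tail, the
  p-th power integral is at most (c m)^(p-1) (e c m + K c q). Here c m stays below 2 S, so the
  choice of e controls the first term, and c q vanishes in the limit.\<close>

lemma jump_average_local_limit:
  fixes \<sigma> :: "'a::euclidean_space measure"
  assumes \<sigma>: "spherical_component \<sigma>" and p: "p \<ge> 1"
    and f: "f \<in> Lp_space p" and g: "g \<in> Lp_space p" and wg: "has_weak_gradient f g" and \<epsilon>: "\<epsilon> > (0::real)"
  shows "\<forall>\<^sub>F \<alpha> in at_left 2. (\<integral>\<^sup>+x. ennreal (norm ((2 - \<alpha>) *\<^sub>R jump_measure.jump_average (stable_jumps \<alpha> \<sigma>) snd fst f x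
      - aniso_gradient \<sigma> g x) powr p) \<partial>lborel) \<le> ennreal \<epsilon>"
proof -
  note line = Sobolev1_line_formula[OF f g p wg]
  let ?N = "\<lambda>f. \<integral>\<^sup>+x. ennreal (norm (f x) powr p) \<partial>lborel"
  have "ennreal (2 powr p) * (?N f + ?N f + (?N g + ?N g)) < \<infinity>"
    using f g by (simp add: Lp_space_iff ennreal_mult_less_top)
  then obtain K :: real where K: "K \<ge> 0" "ennreal (2 powr p) * (?N f + ?N f + (?N g + ?N g)) = ennreal K"
    by (cases "ennreal (2 powr p) * (?N f + ?N f + (?N g + ?N g))") auto
  define S where "S = measure \<sigma> (space \<sigma>)"
  have S: "S \<ge> 0" by (simp add: S_def)
  define M where "M = (2 * S) powr (p - 1)"
  have M: "M \<ge> 0" by (simp add: M_def)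
  \<comment> \<open>Makes M e (2 S) at most half of \<epsilon>; the summand 1 keeps the denominator
    positive when S = 0.\<close>
  define e where "e = \<epsilon> / (2 * (M * (2 * S) + 1))"
  have MS: "M * (2 * S) + 1 > 0" using M S by (simp add: add_nonneg_pos)
  then have e: "e > 0" using \<epsilon> by (simp add: e_def)
  have Me: "M * (e * (2 * S)) \<le> \<epsilon> / 2"
  proof -
    have "M * (e * (2 * S)) = (\<epsilon> / 2) * ((M * (2 * S)) / (M * (2 * S) + 1))"
      using MS by (simp add: e_def field_simps)
    also have "\<dots> \<le> (\<epsilon> / 2) * 1" using \<epsilon> MS by (intro mult_left_mono) auto
    finally show ?thesis by simp
  qed
  have "\<forall>\<^sub>F s in at 0. ?N (\<lambda>x. g (x + s) - g x) < ennreal e"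
    using Lp_continuous_Lp[OF g p] e unfolding Lp_continuous_def by (intro order_tendstoD(2)) auto
  then obtain d where d: "d > 0" "\<And>s. s \<noteq> 0 \<Longrightarrow> norm s < d \<Longrightarrow> ?N (\<lambda>x. g (x + s) - g x) < ennreal e"
    unfolding eventually_at by auto
  define \<delta> where "\<delta> = min (d / 2) (1 / 2)"
  have \<delta>: "0 < \<delta>" "\<delta> < 1" "\<delta> < d" using d(1) by (auto simp: \<delta>_def)
  \<comment> \<open>The filter \<open>at 0\<close> excludes s = 0, where the integral is 0.\<close>
  have small: "?N (\<lambda>x. g (x + s) - g x) \<le> ennreal e" if "norm s \<le> \<delta>" for s
    using d(2)[of s] that \<delta> by (cases "s = 0") auto
  define L where "L = M * (K * ((1 / \<delta> + 2) * S))"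
  have "((\<lambda>\<alpha>. L * (2 - \<alpha>)) \<longlongrightarrow> L * (2 - 2)) (at_left 2)" by (intro tendsto_intros)
  then have "\<forall>\<^sub>F \<alpha> in at_left 2. L * (2 - \<alpha>) < \<epsilon> / 2"
    using \<epsilon> by (intro order_tendstoD(2)) auto
  \<comment> \<open>Beyond 3/2 both 1/(\<alpha> - 1) \<le> 2 and 2 - \<alpha> \<le> \<alpha> - 1
    hold; the former bounds the tail by q, the latter gives c m \<le> 2 S.\<close>
  moreover have "\<forall>\<^sub>F \<alpha> in at_left 2. (3 / 2 :: real) < \<alpha> \<and> \<alpha> < 2"
    using eventually_at_left_real[of "3 / 2" "2::real"] by (auto elim: eventually_mono)
  ultimately show ?thesis
  proof eventually_elim
    case (elim \<alpha>)
    then have \<alpha>: "1 < \<alpha>" "\<alpha> < 2" "3 / 2 < \<alpha>" by auto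
    interpret jump_measure "stable_jumps \<alpha> \<sigma>" snd fst by (rule jump_measure_stable_jumps[OF \<sigma> \<alpha>(1,2)])
    let ?Q = "stable_jumps \<alpha> \<sigma>"
    define c where "c = 2 - \<alpha>"
    define m where "m = measure ?Q (space ?Q)"
    define q where "q = (1 / \<delta> + 2) * S"
    have c: "c > 0" using \<alpha> by (simp add: c_def)
    have m: "m \<ge> 0" by (simp add: m_def)
    have q: "q \<ge> 0" using \<delta> S by (simp add: q_def)
    have inv: "1 / (\<alpha> - 1) \<le> 2" using \<alpha> by (simp add: field_simps)
    have cm: "c * m \<le> 2 * S"
    proof -
      have "ennreal m \<le> ennreal ((1 / c + 1 / (\<alpha> - 1)) * S)"
        using emeasure_stable_jumps_space_le[OF \<sigma> \<alpha>(1,2)] by (simp add: emeasure_eq_measure m_def c_def S_def)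
      then have "m \<le> (1 / c + 1 / (\<alpha> - 1)) * S"
        using c \<alpha> S by (simp add: ennreal_le_iff)
      then have "c * m \<le> c * ((1 / c + 1 / (\<alpha> - 1)) * S)" using c by (intro mult_left_mono) auto
      also have "\<dots> = (1 + c / (\<alpha> - 1)) * S" using c by (simp add: field_simps)
      also have "\<dots> \<le> 2 * S" using \<alpha> S by (intro mult_right_mono) (auto simp: c_def field_simps)
      finally show ?thesis .
    qed
    have Qq: "emeasure ?Q {z \<in> space ?Q. snd z > \<delta>} \<le> ennreal q"
    proof -
      have "(1 / \<delta> + 1 / (\<alpha> - 1)) * S \<le> q"
        using inv S by (auto simp: q_def intro!: mult_right_mono)
      then show ?thesis
        using order_trans[OF emeasure_stable_jumps_gt_le[OF \<sigma> \<alpha>(1,2) \<delta>(1,2)] ennreal_leI] by (simp add: S_def)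
    qed
    let ?D = "\<lambda>x. \<integral>z. (indicator {..1} (snd z) * (fst z \<bullet> g x)) *\<^sub>R fst z \<partial>?Q"
    note [measurable] = borel_measurable_jump_average[OF borel_measurable_Lp_space[OF f]] borel_measurable_Lp_space[OF g]
    have [measurable]: "?D \<in> borel_measurable borel" by measurable
    have "?N (\<lambda>x. c *\<^sub>R jump_average f x - aniso_gradient \<sigma> g x) = ?N (\<lambda>x. c *\<^sub>R (jump_average f x - ?D x))"
      by (simp add: aniso_gradient_eq[OF \<sigma> \<alpha>(1,2)] c_def scaleR_diff_right)
    also have "\<dots> = (\<integral>\<^sup>+x. ennreal (c powr p) * ennreal (norm (jump_average f x - ?D x) powr p) \<partial>lborel)"
      using c by (simp add: powr_mult ennreal_mult)
    also have "\<dots> = ennreal (c powr p) * ?N (\<lambda>x. jump_average f x - ?D x)"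
      by (rule nn_integral_cmult) measurable
    also have "\<dots> \<le> ennreal (c powr p) * (ennreal (m powr (p - 1)) * (ennreal e * emeasure ?Q (space ?Q) +
        ennreal K * emeasure ?Q {z \<in> space ?Q. snd z > \<delta>}))"
      unfolding m_def K(2)[symmetric]
      by (intro mult_left_mono jump_average_gradient_bound[OF f g p line \<delta>(1,2) small]) auto
    also have "\<dots> \<le> ennreal (c powr p) * (ennreal (m powr (p - 1)) * (ennreal e * ennreal m + ennreal K * ennreal q))"
      using Qq by (intro mult_left_mono add_mono) (auto simp: emeasure_eq_measure m_def)
    also have "\<dots> = ennreal (c powr p * (m powr (p - 1) * (e * m + K * q)))"
      using e m K q by (simp add: ennreal_mult[symmetric] ennreal_plus[symmetric] del: ennreal_plus)
    \<comment> \<open>As m may grow like 1/c, p - 1 of the p powers of c go to m^(p-1) and the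
      remaining one to the bracket.\<close>
    also have "c powr p * (m powr (p - 1) * (e * m + K * q)) = (c * m) powr (p - 1) * (e * (c * m) + K * (c * q))"
    proof -
      have 1: "c powr p = c powr (p - 1) * c" using c by (simp add: powr_diff)
      have 2: "(c * m) powr (p - 1) = c powr (p - 1) * m powr (p - 1)" using c m by (simp add: powr_mult)
      show ?thesis unfolding 1 2 by (simp add: algebra_simps)
    qed
    also have "\<dots> \<le> M * (e * (2 * S) + K * (c * q))"
    proof (rule mult_mono)
      show "(c * m) powr (p - 1) \<le> M" unfolding M_def using cm c m p by (intro powr_mono2) auto
      show "e * (c * m) + K * (c * q) \<le> e * (2 * S) + K * (c * q)"
        using mult_left_mono[OF cm, of e] e by simp
    qed (use M c m e K q in auto)
    also have "\<dots> = M * (e * (2 * S)) + L * c" by (simp add: L_def q_def distrib_left mult_ac)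
    also have "\<dots> \<le> \<epsilon>" using Me elim by (simp add: c_def)
    finally show ?case by (simp add: c_def ennreal_leI)
  qed
qed

theorem theorem3p3:
  fixes \<sigma> :: "(real ^ 'n) measure"
    and \<mu> :: "real \<Rightarrow> (real ^ 'n) measure"
    and p :: real
    and f :: "real ^ 'n \<Rightarrow> real"
    and gradf :: "real ^ 'n \<Rightarrow> real ^ 'n"
  assumes "CARD('n) \<ge> 2"
    and "spherical_component \<sigma>"
    and "\<And>\<alpha>. \<alpha> \<in> {1<..<2} \<Longrightarrow> nondegenerate \<alpha> \<sigma>"
    and "\<And>\<alpha>. \<alpha> \<in> {1<..<2} \<Longrightarrow> symmetric_stable \<alpha> \<sigma> (\<mu> \<alpha>)"
    and "p \<ge> 1"
    and "f \<in> Sobolev1 p"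
    and "has_weak_gradient f gradf"
  shows "(\<forall>\<alpha>\<in>{1<..<2}. \<exists>h. distribution_is_Lp p (frac_gradient \<sigma> \<alpha> f) h) \<and>
         (\<forall>Df. (\<forall>\<alpha>\<in>{1<..<2}. distribution_is_Lp p (frac_gradient \<sigma> \<alpha> f) (Df \<alpha>)) \<longrightarrow>
           ((\<lambda>\<alpha>. Lp_norm p (\<lambda>x. (2 - \<alpha>) *\<^sub>R Df \<alpha> x - aniso_gradient \<sigma> gradf x)) \<longlongrightarrow> 0)
             (at_left 2))"
proof -
  note \<sigma> = assms(2) and p = assms(5) and wg = assms(7)
  have f: "f \<in> Lp_space p" using assms(6) by (simp add: Sobolev1_def)
  obtain g where g: "g \<in> Lp_space p" "has_weak_gradient f g" using assms(6) by (auto simp: Sobolev1_def)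
  \<comment> \<open>Membership of \<open>gradf\<close> in L^p is inherited from the gradient g that
    \<open>Sobolev1\<close> provides.\<close>
  have "AE x in lborel. gradf x = g x" by (rule weak_gradient_unique[OF wg g(2)])
  then have "(\<integral>\<^sup>+x. ennreal (norm (gradf x) powr p) \<partial>lborel) = (\<integral>\<^sup>+x. ennreal (norm (g x) powr p) \<partial>lborel)"
    by (intro nn_integral_cong_AE) (auto elim: eventually_mono)
  then have gradf: "gradf \<in> Lp_space p"
    using g(1) wg by (simp add: Lp_space_iff has_weak_gradient_def borel_measurable_locally_integrable)
  define h where "h \<alpha> = jump_measure.jump_average (stable_jumps \<alpha> \<sigma>) snd fst f" for \<alpha>
  have h: "distribution_is_Lp p (frac_gradient \<sigma> \<alpha> f) (h \<alpha>)" if "\<alpha> \<in> {1<..<2}" for \<alpha>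
    using distribution_is_Lp_jump_average[OF \<sigma> _ _ p f gradf wg] that by (simp add: h_def)
  show ?thesis
  proof (intro conjI allI impI)
    show "\<forall>\<alpha>\<in>{1<..<2}. \<exists>h. distribution_is_Lp p (frac_gradient \<sigma> \<alpha> f) h" using h by blast
    fix Df assume Df: "\<forall>\<alpha>\<in>{1<..<2}. distribution_is_Lp p (frac_gradient \<sigma> \<alpha> f) (Df \<alpha>)"
    show "((\<lambda>\<alpha>. Lp_norm p (\<lambda>x. (2 - \<alpha>) *\<^sub>R Df \<alpha> x - aniso_gradient \<sigma> gradf x)) \<longlongrightarrow> 0) (at_left 2)"
    proof (rule Lp_norm_tendsto_0)
      fix e :: real assume "e > 0"
      from jump_average_local_limit[OF \<sigma> p f gradf wg this]
      have "\<forall>\<^sub>F \<alpha> in at_left 2. (\<integral>\<^sup>+x. ennreal (norm ((2 - \<alpha>) *\<^sub>R h \<alpha> x - aniso_gradient \<sigma> gradf x) powr p) \<partial>lborel) \<le> ennreal e"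
        by (simp add: h_def)
      moreover have "\<forall>\<^sub>F \<alpha> in at_left (2::real). \<alpha> \<in> {1<..<2}"
        by (rule eventually_at_left_real) simp
      ultimately show "\<forall>\<^sub>F \<alpha> in at_left 2. (\<integral>\<^sup>+x. ennreal (norm ((2 - \<alpha>) *\<^sub>R Df \<alpha> x - aniso_gradient \<sigma> gradf x) powr p) \<partial>lborel) \<le> ennreal e"
      proof eventually_elim
        case (elim \<alpha>)
        have "AE x in lborel. Df \<alpha> x = h \<alpha> x"
          using Df elim(2) h by (intro distribution_is_Lp_unique[OF _ _ p]) auto
        then have "(\<integral>\<^sup>+x. ennreal (norm ((2 - \<alpha>) *\<^sub>R Df \<alpha> x - aniso_gradient \<sigma> gradf x) powr p) \<partial>lborel) =
          (\<integral>\<^sup>+x. ennreal (norm ((2 - \<alpha>) *\<^sub>R h \<alpha> x - aniso_gradient \<sigma> gradf x) powr p) \<partial>lborel)"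
          by (intro nn_integral_cong_AE) (auto elim: eventually_mono)
        with elim(1) show ?case by simp
      qed
    qed (use p in simp)
  qed
qed

end
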